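(* For all integers $n\geq 94$, $f(n)<u_n<g(n)$, where $u_n=\dfrac{\overline{p}(n-1)\overline{p}(n+1)}{\overline{p}(n)^2}$ and, with $x=\pi\sqrt{n-1}$, $y=\pi\sqrt{n}$, $z=\pi\sqrt{n+1}$, \[ f(n)=e^{x-2y+z}\frac{(x^6-x^5-1)\,y^{16}\,(z^6-z^5-1)}{x^8(y^6-y^5+1)^2z^8},\qquad g(n)=e^{x-2y+z}\frac{(x^6-x^5+1)\,y^{16}\,(z^6-z^5+1)}{x^8(y^6-y^5-1)^2z^8}. \]
   Context: An overpartition of a nonnegative integer $n$ is a nonincreasing sequence of positive integers summing to $n$ in which the first occurrence of each distinct part may (or may not) be overlined. $\overline{p}(n)$ denotes the number of overpartitions of $n$, with $\overline{p}(0)=1$. *)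

theory Defs
  imports "HOL-Analysis.Analysis" "HOL-Library.Multiset"
begin

text \<open>A partition of n is a multiset of positive integers summing to n (a nonincreasing
sequence is determined by its multiset of parts). An overpartition additionally chooses
which distinct parts have their first occurrence overlined; this is encoded as a subset
of the set of distinct parts.\<close>

definition overpartitions :: "nat \<Rightarrow> (nat multiset \<times> nat set) set" where
  "overpartitions n = {(P, S). (\<forall>k \<in># P. k > 0) \<and> sum_mset P = n \<and> S \<subseteq> set_mset P}"

definition overpartition_count :: "nat \<Rightarrow> nat" where
  "overpartition_count n = card (overpartitions n)"

definition u_ratio :: "nat \<Rightarrow> real" where
  "u_ratio n = real (overpartition_count (n - 1)) * real (overpartition_count (n + 1))
               / (real (overpartition_count n))^2"

definition f_lower :: "nat \<Rightarrow> real" where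
  "f_lower n = (let x = pi * sqrt (real n - 1); y = pi * sqrt (real n); z = pi * sqrt (real n + 1) in
     exp (x - 2*y + z) * ((x^6 - x^5 - 1) * y^16 * (z^6 - z^5 - 1))
       / (x^8 * (y^6 - y^5 + 1)^2 * z^8))"

definition g_upper :: "nat \<Rightarrow> real" where
  "g_upper n = (let x = pi * sqrt (real n - 1); y = pi * sqrt (real n); z = pi * sqrt (real n + 1) in
     exp (x - 2*y + z) * ((x^6 - x^5 + 1) * y^16 * (z^6 - z^5 + 1))
       / (x^8 * (y^6 - y^5 - 1)^2 * z^8))"

end

theory Submission
  imports
    Defs
    "HOL-Complex_Analysis.Complex_Analysis"
    "HOL-Probability.Distributions"
    "HOL-Real_Asymp.Real_Asymp"
begin

text \<open>
  Put $y = \pi\sqrt{n}$. The two inequalities follow from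
  $|8 n e^{-y}\,\overline{p}(n) - (1 - 1/y)| < y^{-6}$, which holds for $n \geq 94$; it just fails at
  $n = 93$, where the slack of the neighbouring value at $n = 95$ compensates.

  The generating function of the overpartitions is the reciprocal of the theta series
  $1 + 2 \sum_{j \geq 1} (-1)^j q^{j^2}$. For $n \geq 300$ the estimate comes from the circle method on
  $|q| = e^{-r}$ with $r = \pi / (4 \sqrt{n})$. Near $q = 1$ the theta transformation replaces the
  generating function by $\frac12 \sqrt{t/\pi}\, e^{\pi^2 / (4 t)}$ with $q = e^{-t}$; its integral is
  moved to the arc $|t| = 2 r$, where it becomes a Gaussian integral. Elsewhere the product formula
  gives a bound that is exponentially smaller than the main term.

  For $n < 300$ the values are computed from the recurrence given by the theta series and compared
  with rational enclosures of $e^y$.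
\<close>

section \<open>Overpartitions and their generating function\<close>

text \<open>The factors of \<open>f_lower\<close> and \<open>g_upper\<close> come from x^6 - x^5 - 1
  = x^6 (1 - 1/x - x^-6) and its analogues. Near q = 1 the weight sqrt t makes the saddle point
  integral elementary: 1 - 1/y is exact up to exponentially small terms, and y^-6 is slack that
  absorbs them once y is large. The other cusps are not expanded; the minor arc has only the product
  bound, and this dictates the radius. The saddle point is t = 2 r, twice the radius used. On |q| =
  e^(-r) the generating function is at most about e^y and e^(n r) = e^(y/4), while the product bound
  saves a factor of nearly e^(8 y / pi^2), which leaves at most e^(0.46 y). At radius 2 r the same
  count would give nearly e^(0.6 y), too much at n = 300. The price is that on the major arc the
  integrand reaches about e^(5 y / 4) although its integral has the size e^y. It cannot be estimated
  in absolute value, and its contour has to be moved through the saddle point.\<close>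

definition overparts_upto :: "nat \<Rightarrow> nat \<Rightarrow> (nat multiset \<times> nat set) set" where
  "overparts_upto N n = {(P, S). set_mset P \<subseteq> {1..N} \<and> sum_mset P = n \<and> S \<subseteq> set_mset P}"

definition opc :: "nat \<Rightarrow> nat \<Rightarrow> nat" where
  "opc N n = card (overparts_upto N n)"

lemma size_le_sum_mset:
  fixes P :: "nat multiset"
  assumes "\<forall>k\<in>#P. k > 0"
  shows "size P \<le> sum_mset P"
  using assms by (induction P) auto

lemma mem_le_sum_mset: "(k::nat) \<in># P \<Longrightarrow> k \<le> sum_mset P"
  by (metis le_add1 mset_add sum_mset.add_mset)

lemma overpartitions_eq_upto:
  assumes "n \<le> N"
  shows "overpartitions n = overparts_upto N n"
proof -
  have "(\<forall>k\<in>#P. k > 0) \<longleftrightarrow> set_mset P \<subseteq> {1..N}" if "sum_mset P = n" for P :: "nat multiset"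
    using mem_le_sum_mset[of _ P] assms that by (force simp: Suc_le_eq)
  then show ?thesis
    unfolding overpartitions_def overparts_upto_def by blast
qed

lemma finite_overpartitions: "finite (overpartitions n)"
proof (rule finite_subset)
  let ?M = "{P. set_mset P \<subseteq> {1..n} \<and> size P \<le> n}"
  show "overpartitions n \<subseteq> ?M \<times> Pow {1..n}"
  proof clarify
    fix P S assume "(P, S) \<in> overpartitions n"
    then have "(P, S) \<in> overparts_upto n n" "\<forall>k\<in>#P. k > 0" "sum_mset P = n"
      by (simp_all add: overpartitions_eq_upto[of n n, symmetric]) (simp_all add: overpartitions_def)
    then show "P \<in> ?M \<and> S \<in> Pow {1..n}"
      using size_le_sum_mset[of P] by (auto simp: overparts_upto_def)
  qed
  have "?M \<subseteq> mset ` {xs. set xs \<subseteq> {1..n} \<and> length xs \<le> n}"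
  proof
    fix P assume P: "P \<in> ?M"
    obtain xs where "mset xs = P" using ex_mset by blast
    with P show "P \<in> mset ` {xs. set xs \<subseteq> {1..n} \<and> length xs \<le> n}" by auto
  qed
  then show "finite (?M \<times> Pow {1..n})"
    using finite_subset finite_lists_length_le[of "{1..n}" n] by blast
qed

lemma overparts_upto_mono: "N \<le> M \<Longrightarrow> overparts_upto N n \<subseteq> overparts_upto M n"
  by (auto simp: overparts_upto_def)

lemma overparts_upto_subset: "overparts_upto N n \<subseteq> overpartitions n"
  using overparts_upto_mono[of N "max N n" n] overpartitions_eq_upto[of n "max N n"] by simp

lemma finite_overparts_upto: "finite (overparts_upto N n)"
  using finite_subset[OF overparts_upto_subset finite_overpartitions] .

lemma opc_le: "opc N n \<le> overpartition_count n"
  unfolding opc_def overpartition_count_def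
  by (rule card_mono[OF finite_overpartitions overparts_upto_subset])

lemma opc_eq: "n \<le> N \<Longrightarrow> opc N n = overpartition_count n"
  unfolding opc_def overpartition_count_def by (simp add: overpartitions_eq_upto)

lemma opc_0: "opc 0 n = (if n = 0 then 1 else 0)"
proof -
  have "overparts_upto 0 n = (if n = 0 then {({#}, {})} else {})"
    by (auto simp: overparts_upto_def)
  then show ?thesis by (simp add: opc_def)
qed

text \<open>An overpartition containing the part N + 1 is determined by removing one copy of it; the
  overlining of N + 1 is lost exactly when the removed copy was the only one and was overlined.\<close>

lemma opc_Suc:
  "opc (Suc N) n =
     opc N n + (if Suc N \<le> n then opc (Suc N) (n - Suc N) + opc N (n - Suc N) else 0)"
proof (cases "Suc N \<le> n")
  case False
  have "overparts_upto (Suc N) n = overparts_upto N n"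
  proof -
    have iff: "set_mset P \<subseteq> {1..Suc N} \<longleftrightarrow> set_mset P \<subseteq> {1..N}" if "sum_mset P = n" for P
    proof
      assume "set_mset P \<subseteq> {1..Suc N}"
      then show "set_mset P \<subseteq> {1..N}"
        using that mem_le_sum_mset[of _ P] False by force
    qed auto
    have "set_mset P \<subseteq> {1..Suc N} \<and> sum_mset P = n \<and> S \<subseteq> set_mset P \<longleftrightarrow>
        set_mset P \<subseteq> {1..N} \<and> sum_mset P = n \<and> S \<subseteq> set_mset P" for P and S :: "nat set"
      by (cases "sum_mset P = n") (simp_all only: iff simp_thms)
    then show ?thesis unfolding overparts_upto_def by (simp only:)
  qed
  with False show ?thesis by (simp add: opc_def)
next
  case True
  define m where "m = Suc N"
  define f :: "nat multiset \<times> nat set \<Rightarrow> _" where "f = (\<lambda>(P, S). (add_mset m P, S))"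
  define g :: "nat multiset \<times> nat set \<Rightarrow> _" where "g = (\<lambda>(P, S). (add_mset m P, insert m S))"
  define A where "A = overparts_upto m (n - m)"
  define B where "B = overparts_upto N (n - m)"
  define C where "C = overparts_upto N n"
  have mn: "m \<le> n" using True by (simp add: m_def)
  have notin: "m \<notin> set_mset P \<and> m \<notin> S" if "(P, S) \<in> B \<or> (P, S) \<in> C" for P S
    using that by (auto simp: B_def C_def overparts_upto_def m_def)
  have eq: "overparts_upto m n = C \<union> (f ` A \<union> g ` B)"
  proof (intro equalityI subsetI)
    fix x assume "x \<in> overparts_upto m n"
    then obtain P S where x: "x = (P, S)" and P: "set_mset P \<subseteq> {1..m}" "sum_mset P = n" "S \<subseteq> set_mset P"
      by (auto simp: overparts_upto_def)
    show "x \<in> C \<union> (f ` A \<union> g ` B)"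
    proof (cases "m \<in># P")
      case False
      then have "set_mset P \<subseteq> {1..N}"
        using P(1) by (auto simp: m_def le_Suc_eq subset_iff)
      then show ?thesis using P x by (auto simp: C_def overparts_upto_def)
    next
      case True
      then obtain Q where Q: "P = add_mset m Q" by (meson mset_add)
      show ?thesis
      proof (cases "S \<subseteq> set_mset Q")
        case True
        then have "(Q, S) \<in> A" using P Q by (auto simp: A_def overparts_upto_def)
        then show ?thesis using Q x by (force simp: f_def)
      next
        case False
        with P Q have mQ: "m \<notin># Q" and mS: "m \<in> S" by auto
        then have "set_mset Q \<subseteq> {1..N}"
          using P(1) Q by (auto simp: m_def le_Suc_eq subset_iff)
        then have "(Q, S - {m}) \<in> B" using P Q mQ by (auto simp: B_def overparts_upto_def)
        moreover have "x = g (Q, S - {m})" using mS Q x by (auto simp: g_def)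
        ultimately show ?thesis by blast
      qed
    qed
  next
    fix x assume "x \<in> C \<union> (f ` A \<union> g ` B)"
    then show "x \<in> overparts_upto m n"
      using mn by (auto simp: A_def B_def C_def f_def g_def overparts_upto_def m_def)
  qed
  have fin: "finite A" "finite B" "finite C"
    by (simp_all add: A_def B_def C_def finite_overparts_upto)
  have "inj_on f A" by (auto simp: inj_on_def f_def)
  moreover have "inj_on g B"
  proof -
    have "S = T" if "(P, S) \<in> B" "(P, T) \<in> B" "insert m S = insert m T" for P S T
      using notin that by (metis insert_ident)
    then show ?thesis by (intro inj_onI) (clarsimp simp: g_def)
  qed
  moreover have "f ` A \<inter> g ` B = {}"
  proof -
    have "f u \<noteq> g v" if "u \<in> A" "v \<in> B" for u v
      using that notin[of "fst v" "snd v"]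
      by (cases u, cases v) (auto simp: f_def g_def A_def overparts_upto_def)
    then show ?thesis by blast
  qed
  moreover have "C \<inter> (f ` A \<union> g ` B) = {}"
  proof -
    have "m \<notin># fst x" if "x \<in> C" for x
      using that notin[of "fst x" "snd x"] by simp
    moreover have "m \<in># fst x" if "x \<in> f ` A \<union> g ` B" for x
      using that by (auto simp: f_def g_def)
    ultimately show ?thesis by blast
  qed
  ultimately have "card (overparts_upto m n) = card C + (card A + card B)"
    unfolding eq using fin by (simp add: card_Un_disjoint card_image)
  then show ?thesis using True by (simp add: opc_def A_def B_def C_def m_def)
qed

section \<open>Finite products and the generating function\<close>

definition op_prod :: "nat \<Rightarrow> 'a::real_normed_field \<Rightarrow> 'a" where
  "op_prod N q = (\<Prod>m=1..N. (1 + q ^ m) / (1 - q ^ m))"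

lemma op_prod_Suc:
  "op_prod (Suc N) q = op_prod N q * ((1 + q ^ Suc N) / (1 - q ^ Suc N))"
  unfolding op_prod_def by (simp add: prod.nat_ivl_Suc')

text \<open>Each factor is 1 + 2 x^m / (1 - x^m) with x^m <= x in the denominator, and 1 + u <= exp
  u turns the product into a geometric series. The bound is free of \<open>N\<close>, so it controls
  the partial sums of the full generating function.\<close>

lemma op_prod_bound:
  assumes "0 \<le> x" "x < (1::real)"
  shows "op_prod N x \<le> exp (2 * x / (1 - x)^2)"
proof -
  have "op_prod N x \<le> (\<Prod>m=1..N. exp (2 * x ^ m / (1 - x)))"
    unfolding op_prod_def
  proof (rule prod_mono, intro conjI)
    fix m assume m: "m \<in> {1..N}"
    have xm: "x ^ m \<le> x" "0 \<le> x ^ m" using m assms by (auto intro: power_decreasing[of 1 m x, simplified])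
    then show "0 \<le> (1 + x ^ m) / (1 - x ^ m)" using assms by simp
    have "(1 + x ^ m) / (1 - x ^ m) = 1 + 2 * x ^ m / (1 - x ^ m)"
      using xm assms by (simp add: field_simps)
    also have "\<dots> \<le> 1 + 2 * x ^ m / (1 - x)"
      using xm assms by (simp add: frac_le)
    also have "\<dots> \<le> exp (2 * x ^ m / (1 - x))" by (rule exp_ge_add_one_self)
    finally show "(1 + x ^ m) / (1 - x ^ m) \<le> exp (2 * x ^ m / (1 - x))" .
  qed
  also have "\<dots> = exp (\<Sum>m=1..N. 2 * x ^ m / (1 - x))" by (simp add: exp_sum)
  also have "(\<Sum>m=1..N. 2 * x ^ m / (1 - x)) = 2 / (1 - x) * (\<Sum>m=1..N. x ^ m)"
    by (simp add: sum_distrib_left)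
  also have "(\<Sum>m=1..N. x ^ m) \<le> x / (1 - x)"
    using assms by (simp add: sum_gp divide_right_mono)
  then have "exp (2 / (1 - x) * (\<Sum>m=1..N. x ^ m)) \<le> exp (2 / (1 - x) * (x / (1 - x)))"
    using assms by (intro iffD2[OF exp_le_cancel_iff] mult_left_mono) auto
  also have "2 / (1 - x) * (x / (1 - x)) = 2 * x / (1 - x)^2"
    by (simp add: power2_eq_square)
  finally show ?thesis .
qed

text \<open>Summability has to precede the evaluation in \<open>opc_sums\<close>, so partial sums
  are bounded first. Summing \<open>opc_Suc\<close> expresses a partial sum for \<open>Suc N\<close>
  through shorter ones, which are no larger since all terms are nonnegative; the resulting linear
  inequality is solved for the partial sum.\<close>

lemma summable_opc_real:
  assumes "0 \<le> x" "x < (1::real)"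
  shows "summable (\<lambda>n. real (opc N n) * x ^ n)"
proof (induction N)
  case 0
  have "(\<lambda>n. real (opc 0 n) * x ^ n) = (\<lambda>n. if n = 0 then 1 else 0)"
    by (auto simp: opc_0)
  then show ?case by simp
next
  case (Suc N)
  define m where "m = Suc N"
  let ?a = "\<lambda>N n. real (opc N n) * x ^ n"
  have xm: "x ^ m < 1" "0 \<le> x ^ m"
    using assms by (auto simp: m_def power_less_one_iff simp del: power_Suc)
  have rec: "?a m n = ?a N n + (if m \<le> n then x ^ m * (?a m (n - m) + ?a N (n - m)) else 0)" for n
  proof (cases "m \<le> n")
    case True
    then have "x ^ n = x ^ m * x ^ (n - m)" by (simp flip: power_add)
    then show ?thesis using True unfolding m_def by (subst opc_Suc) (simp add: algebra_simps)
  next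
    case False
    then show ?thesis unfolding m_def by (subst opc_Suc) simp
  qed
  have nn: "?a k n \<ge> 0" for k n using assms by simp
  have shift: "(\<Sum>n<K. if m \<le> n then h (n - m) else 0) = (\<Sum>n<K - m. h n)" for h :: "nat \<Rightarrow> real" and K
  proof -
    have "(\<Sum>n<K. if m \<le> n then h (n - m) else 0) = (\<Sum>n\<in>{m..<K}. h (n - m))"
      by (rule sum.mono_neutral_cong_right) auto
    also have "\<dots> = (\<Sum>n<K - m. h n)"
      by (rule sum.reindex_bij_witness[of _ "\<lambda>n. n + m" "\<lambda>n. n - m"]) auto
    finally show ?thesis .
  qed
  define T where "T = suminf (?a N)"
  have part: "sum (?a N) {..<K} \<le> T" for K
    unfolding T_def by (rule sum_le_suminf[OF Suc]) (use nn in auto)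
  have bound: "sum (?a m) {..<K} \<le> T * (1 + x ^ m) / (1 - x ^ m)" for K
  proof -
    have "sum (?a m) {..<K} = sum (?a N) {..<K} + x ^ m * (sum (?a m) {..<K - m} + sum (?a N) {..<K - m})"
    proof -
      have "sum (?a m) {..<K} = (\<Sum>n<K. ?a N n + (if m \<le> n then x ^ m * (?a m (n - m) + ?a N (n - m)) else 0))"
        by (rule sum.cong[OF refl rec])
      also have "\<dots> = sum (?a N) {..<K} + (\<Sum>n<K - m. x ^ m * (?a m n + ?a N n))"
        by (subst sum.distrib) (simp only: shift[of "\<lambda>n. x ^ m * (?a m n + ?a N n)"])
      finally show ?thesis by (simp only: sum_distrib_left[symmetric] sum.distrib)
    qed
    also have "\<dots> \<le> T + x ^ m * (sum (?a m) {..<K} + T)"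
      using xm nn by (intro add_mono mult_left_mono part sum_mono2) auto
    finally show ?thesis using xm by (simp add: field_simps)
  qed
  show "summable (?a (Suc N))"
    unfolding m_def[symmetric] using nn bound by (intro summableI_nonneg_bounded) auto
qed

lemma summable_opc:
  fixes q :: "'a::{real_normed_field, banach}"
  assumes "norm q < 1"
  shows "summable (\<lambda>n. of_nat (opc N n) * q ^ n)"
  by (rule summable_norm_cancel)
     (use summable_opc_real[of "norm q" N] assms in \<open>simp add: norm_mult norm_power\<close>)

text \<open>With convergence known, \<open>opc_Suc\<close> becomes the linear equation A = P + q^m
  (A + P) for the sum \<open>A\<close>, where P is the previous product.\<close>

lemma opc_sums:
  fixes q :: "'a::{real_normed_field, banach}"
  assumes "norm q < 1"
  shows "(\<lambda>n. of_nat (opc N n) * q ^ n) sums op_prod N q"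
proof (induction N)
  case 0
  have "(\<lambda>n. of_nat (opc 0 n) * q ^ n) = (\<lambda>n. if n = 0 then 1 else 0)"
    by (auto simp: opc_0)
  moreover have "(\<lambda>n. if n = 0 then 1 else 0 :: 'a) sums 1"
    using sums_single[of 0 "\<lambda>_. 1 :: 'a"] by simp
  ultimately show ?case by (simp add: op_prod_def)
next
  case (Suc N)
  define m where "m = Suc N"
  let ?a = "\<lambda>N n. of_nat (opc N n) * q ^ n"
  have "norm (q ^ m) < 1"
    using assms by (simp add: m_def norm_power power_less_one_iff del: power_Suc)
  then have qm: "q ^ m \<noteq> 1" by auto
  have rec: "?a m n = ?a N n + (if m \<le> n then q ^ m * (?a m (n - m) + ?a N (n - m)) else 0)" for n
  proof (cases "m \<le> n")
    case True
    then have "q ^ n = q ^ m * q ^ (n - m)" by (simp flip: power_add)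
    then show ?thesis using True unfolding m_def by (subst opc_Suc) (simp add: algebra_simps)
  next
    case False
    then show ?thesis unfolding m_def by (subst opc_Suc) simp
  qed
  define A where "A = suminf (?a m)"
  have sm: "?a m sums A" unfolding A_def by (rule summable_sums[OF summable_opc[OF assms]])
  have sH: "(\<lambda>n. q ^ m * (?a m n + ?a N n)) sums (q ^ m * (A + op_prod N q))"
    by (intro sums_mult sums_add sm Suc)
  have "(\<lambda>n. if m \<le> n then q ^ m * (?a m (n - m) + ?a N (n - m)) else 0) sums (q ^ m * (A + op_prod N q))"
    (is "?h sums _")
  proof -
    have "(\<lambda>n. ?h (n + m)) sums (q ^ m * (A + op_prod N q) - sum ?h {..<m})"
      using sH by simp
    then show ?thesis by (subst (asm) sums_iff_shift)  simp
  qed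
  then have "?a m sums (op_prod N q + q ^ m * (A + op_prod N q))"
    by (subst ext[OF rec]) (rule sums_add[OF Suc])
  with sm have "A = op_prod N q + q ^ m * (A + op_prod N q)" by (rule sums_unique2)
  then have "A = op_prod N q * ((1 + q ^ m) / (1 - q ^ m))"
    using qm by (simp add: field_simps)
  with sm show ?case unfolding m_def by (simp only: op_prod_Suc)
qed

text \<open>The first \<open>K\<close> coefficients agree with those of \<open>opc K\<close>, so the
  partial sums are below a finite product whose bound is free of \<open>K\<close>.\<close>

lemma summable_overpartition_real:
  assumes "0 \<le> x" "x < (1::real)"
  shows "summable (\<lambda>n. real (overpartition_count n) * x ^ n)"
proof (rule summableI_nonneg_bounded)
  fix K
  have "(\<Sum>n<K. real (overpartition_count n) * x ^ n) = (\<Sum>n<K. real (opc K n) * x ^ n)"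
    by (intro sum.cong) (auto simp: opc_eq)
  also have "\<dots> \<le> op_prod K x"
    using opc_sums[of x K] assms by (intro sum_le_suminf[THEN order_trans]) (auto simp: sums_iff)
  also have "\<dots> \<le> exp (2 * x / (1 - x)^2)" by (rule op_prod_bound[OF assms])
  finally show "(\<Sum>n<K. real (overpartition_count n) * x ^ n) \<le> exp (2 * x / (1 - x)^2)" .
qed (use assms in auto)

definition op_gf :: "'a::{real_normed_field, banach} \<Rightarrow> 'a" where
  "op_gf q = (\<Sum>n. of_nat (overpartition_count n) * q ^ n)"

lemma summable_overpartition:
  fixes q :: "'a::{real_normed_field, banach}"
  assumes "norm q < 1"
  shows "summable (\<lambda>n. norm (of_nat (overpartition_count n) * q ^ n))"
  using summable_overpartition_real[of "norm q"] assms by (simp add: norm_mult norm_power)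

text \<open>Tannery's theorem: \<open>opc N k\<close> is constant in \<open>N\<close> from
  \<open>N = k\<close> on, and by \<open>opc_le\<close> the full series dominates.\<close>

lemma op_prod_tendsto:
  fixes q :: "'a::{real_normed_field, banach}"
  assumes "norm q < 1"
  shows "(\<lambda>N. op_prod N q) \<longlonglongrightarrow> op_gf q"
proof -
  let ?M = "\<lambda>n. norm (of_nat (overpartition_count n) * q ^ n)"
  have "(\<lambda>N. \<Sum>n. of_nat (opc N n) * q ^ n) \<longlonglongrightarrow> (\<Sum>n. of_nat (overpartition_count n) * q ^ n)"
  proof (rule tannerys_theorem[THEN conjunct2, THEN conjunct2])
    show "(\<lambda>N. of_nat (opc N k) * q ^ k) \<longlonglongrightarrow> of_nat (overpartition_count k) * q ^ k" for k
      by (rule tendsto_eventually, rule eventually_mono[OF eventually_ge_at_top[of k]]) (simp add: opc_eq)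
    show "summable ?M" by (rule summable_overpartition[OF assms])
    show "\<forall>\<^sub>F (k, N) in sequentially \<times>\<^sub>F sequentially. norm (of_nat (opc N k) * q ^ k :: 'a) \<le> ?M k"
      using opc_le by (intro always_eventually) (auto simp: norm_mult intro!: mult_right_mono)
  qed simp
  then show ?thesis using opc_sums[OF assms] by (simp add: op_gf_def sums_iff)
qed

text \<open>A finite form of Gauss' theta identity, proved by Shanks: every summand on the right with
  positive index vanishes to order more than \<open>n\<close> at \<open>q = 0\<close>.\<close>

lemma shanks_identity:
  fixes q :: "'a::real_normed_field"
  assumes "norm q < 1"
  shows "op_prod n q * (1 + 2 * (\<Sum>j=1..n. (-1) ^ j * q ^ (j ^ 2))) =
    (\<Sum>s\<le>n. (-1) ^ s * op_prod s q * 2 / (1 + q ^ s) * q ^ (s * Suc n))"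
proof -
  have nz: "1 + q ^ s \<noteq> 0 \<and> 1 - q ^ Suc s \<noteq> 0" for s
  proof -
    have *: "norm (q ^ Suc s) < 1" for s using assms by (simp add: norm_power power_less_one_iff del: power_Suc)
    have "1 + q ^ s \<noteq> 0"
      by (cases s) (use *[of "s - 1"] in \<open>auto simp: add_eq_0_iff\<close>)
    moreover have "1 - q ^ Suc s \<noteq> 0" using *[of s] by auto
    ultimately show ?thesis by blast
  qed
  define t where "t n s = (-1) ^ s * op_prod s q * 2 / (1 + q ^ s) * q ^ (s * Suc n)" for n s
  define a where "a n s = (-1) ^ s * op_prod s q * q ^ (Suc s * Suc n)" for n s
  have step: "(1 - q ^ Suc n) * t (Suc n) s - (1 + q ^ Suc n) * t n s =
      - (2 * (-1) ^ s * q ^ (s * Suc n) * (op_prod s q * ((1 - q ^ s) / (1 + q ^ s)))) - 2 * a n s" for n s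
  proof -
    have alg: "(1 - Q) * (2 * c / (1 + Z) * Z) - (1 + Q) * (2 * c / (1 + Z)) =
        - (2 * (c * ((1 - Z) / (1 + Z)))) - 2 * (c * Q)" if "1 + Z \<noteq> 0" for c Q Z :: 'a
      using that by (simp add: divide_simps) (simp add: algebra_simps)
    define c where "c = (-1) ^ s * op_prod s q * q ^ (s * Suc n)"
    have t: "t n s = 2 * c / (1 + q ^ s)" by (simp add: t_def c_def)
    have "t (Suc n) s = 2 * c / (1 + q ^ s) * q ^ s"
      by (simp add: t_def c_def power_add)
    moreover have "a n s = c * q ^ Suc n"
      by (simp add: a_def c_def power_add)
    moreover have "2 * (-1) ^ s * q ^ (s * Suc n) * (op_prod s q * ((1 - q ^ s) / (1 + q ^ s))) =
        2 * (c * ((1 - q ^ s) / (1 + q ^ s)))"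
      by (simp add: c_def)
    ultimately show ?thesis
      using alg[OF nz[THEN conjunct1], of "q ^ Suc n" c s] t by (simp only:)
  qed
  \<comment> \<open>The first term on the right of \<open>step\<close> at \<open>Suc s\<close> is
    \<open>2 * a n s\<close>, since the quotient removes the last factor of the product. At
    \<open>s = 0\<close> it vanishes because 1 - q^0 = 0.\<close>
  have tele: "(\<Sum>s\<le>k. (1 - q ^ Suc n) * t (Suc n) s - (1 + q ^ Suc n) * t n s) = - 2 * a n k" for n k
  proof (induction k)
    case 0
    then show ?case using step[of n 0] by simp
  next
    case (Suc k)
    have "op_prod (Suc k) q * ((1 - q ^ Suc k) / (1 + q ^ Suc k)) = op_prod k q"
      using nz[of k] nz[of "Suc k"] by (simp add: op_prod_Suc del: power_Suc)
    then show ?case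
      by (subst sum.atMost_Suc, subst step, subst Suc.IH) (simp add: a_def power_Suc[of "-1 :: 'a"] del: power_Suc)
  qed
  have "op_prod n q * (1 + 2 * (\<Sum>j=1..n. (-1) ^ j * q ^ (j ^ 2))) = (\<Sum>s\<le>n. t n s)" for n
  proof (induction n)
    case 0
    then show ?case by (simp add: t_def op_prod_def)
  next
    case (Suc n)
    define Q where "Q = q ^ Suc n"
    have Q: "1 + Q \<noteq> 0" "1 - Q \<noteq> 0" using nz[of n] nz[of "Suc n"] by (simp_all only: Q_def simp_thms)
    define X where "X = 1 + 2 * (\<Sum>j=1..n. (-1) ^ j * q ^ (j ^ 2))"
    define w where "w = (-1) ^ n * op_prod n q * q ^ (Suc n ^ 2)"
    have P: "(1 - Q) * op_prod (Suc n) q = (1 + Q) * op_prod n q"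
      using Q by (simp add: op_prod_Suc Q_def[symmetric] del: power_Suc)
    \<comment> \<open>After multiplication by 1 - Q, the fact \<open>P\<close> trades the new
      product for the old one, to which the induction hypothesis applies.\<close>
    have "(1 - Q) * (op_prod (Suc n) q * (1 + 2 * (\<Sum>j=1..Suc n. (-1) ^ j * q ^ (j ^ 2)))) =
      (1 - Q) * op_prod (Suc n) q * (X - 2 * ((-1) ^ n * q ^ (Suc n ^ 2)))"
      by (simp add: X_def algebra_simps)
    also have "\<dots> = (1 + Q) * (op_prod n q * X) - 2 * (1 + Q) * w"
      unfolding P w_def by (simp add: algebra_simps)
    also have "op_prod n q * X = (\<Sum>s\<le>n. t n s)"
      unfolding X_def by (rule Suc.IH)
    also have "(1 + Q) * (\<Sum>s\<le>n. t n s) = (1 - Q) * (\<Sum>s\<le>n. t (Suc n) s) + 2 * a n n"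
      using tele[of n n, unfolded sum_subtractf sum_distrib_left[symmetric], folded Q_def]
      by (simp add: algebra_simps)
    also have "a n n = w"
      by (simp add: a_def w_def power2_eq_square del: power_Suc)
    also have "(1 - Q) * (\<Sum>s\<le>n. t (Suc n) s) + 2 * w - 2 * (1 + Q) * w =
        (1 - Q) * (\<Sum>s\<le>n. t (Suc n) s) + (1 - Q) * t (Suc n) (Suc n)"
    proof -
      have "(1 - Q) * t (Suc n) (Suc n) = (-1) ^ Suc n * 2 * ((1 - Q) * op_prod (Suc n) q) / (1 + Q) * q ^ (Suc n * Suc (Suc n))"
        by (simp add: t_def Q_def)
      also have "\<dots> = - 2 * Q * w"
      proof -
        have "Suc n * Suc (Suc n) = Suc n ^ 2 + Suc n" by (simp add: power2_eq_square)
        then have "q ^ (Suc n * Suc (Suc n)) = q ^ (Suc n ^ 2) * Q" by (simp only: power_add Q_def)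
        then show ?thesis unfolding P w_def using Q by simp
      qed
      finally show ?thesis by (simp add: algebra_simps)
    qed
    also have "\<dots> = (1 - Q) * (\<Sum>s\<le>Suc n. t (Suc n) s)" by (simp add: algebra_simps)
    finally show ?case using Q by simp
  qed
  then show ?thesis unfolding t_def .
qed

text \<open>Jacobi's theta_4 at argument zero: the sum of (-1)^j q^(j^2) over all integers j, folded
  at j = 0.\<close>

definition theta4 :: "'a::{real_normed_field, banach} \<Rightarrow> 'a" where
  "theta4 q = 1 + 2 * (\<Sum>j. (-1) ^ Suc j * q ^ (Suc j ^ 2))"

lemma summable_theta4:
  fixes q :: "'a::{real_normed_field, banach}"
  assumes "norm q < 1"
  shows "summable (\<lambda>j. norm ((-1) ^ Suc j * q ^ (Suc j ^ 2)))"
proof (rule summable_comparison_test'[of "\<lambda>j. norm q ^ j" 0])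
  show "summable (\<lambda>j. norm q ^ j)" using assms by simp
  fix j :: nat
  have "j \<le> Suc j ^ 2" by (simp add: power2_eq_square)
  then show "norm (norm ((-1) ^ Suc j * q ^ (Suc j ^ 2))) \<le> norm q ^ j"
    using assms by (simp add: norm_mult norm_power power_decreasing del: power_Suc)
qed

text \<open>The limit of \<open>shanks_identity\<close>: its right-hand side tends to 1, because
  every summand with s >= 1 carries the factor q^(s (n + 1)) while the products stay
  bounded.\<close>

theorem op_gf_mult_theta4:
  fixes q :: "'a::{real_normed_field, banach}"
  assumes q: "norm q < 1"
  shows "op_gf q * theta4 q = 1"
proof -
  define B where "B = exp (2 * norm q / (1 - norm q)^2)"
  define x where "x = norm q"
  have x: "0 \<le> x" "x < 1" using q by (auto simp: x_def)
  have Pr: "norm (op_prod s q) \<le> B" for s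
  proof -
    have "norm (op_prod s q) \<le> op_prod s (norm q)"
      unfolding op_prod_def prod_norm[symmetric]
    proof (intro prod_mono conjI norm_ge_zero)
      fix m assume "m \<in> {1..s}"
      then have m: "norm (q ^ m) < 1" using q by (simp add: norm_power power_less_one_iff)
      have "norm (1 + q ^ m) \<le> 1 + norm q ^ m"
        using norm_triangle_ineq[of 1 "q ^ m"] by (simp add: norm_power)
      moreover have "1 - norm q ^ m \<le> norm (1 - q ^ m)"
        using norm_triangle_ineq2[of 1 "q ^ m"] by (simp add: norm_power)
      ultimately show "norm ((1 + q ^ m) / (1 - q ^ m)) \<le> (1 + norm q ^ m) / (1 - norm q ^ m)"
        using m by (auto simp: norm_divide norm_power intro!: frac_le)
    qed
    also have "\<dots> \<le> B" unfolding B_def by (rule op_prod_bound) (use q in auto)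
    finally show ?thesis .
  qed
  define C where "C = B * 2 / (1 - x)"
  have tbound: "norm ((-1) ^ s * op_prod s q * 2 / (1 + q ^ s) * q ^ (s * Suc n)) \<le> C * (x ^ Suc n) ^ s"
    if "s \<ge> 1" for s n
  proof -
    have "1 - x \<le> 1 - x ^ s" using that x power_decreasing[of 1 s x] by simp
    also have "\<dots> \<le> norm (1 + q ^ s)"
      using norm_triangle_ineq2[of 1 "- (q ^ s)"] by (simp add: x_def norm_power)
    finally have "norm (op_prod s q) * 2 / norm (1 + q ^ s) \<le> B * 2 / (1 - x)"
      using Pr[of s] x by (intro frac_le mult_right_mono) (auto simp: B_def)
    then have "norm (op_prod s q) * 2 / norm (1 + q ^ s) * x ^ (s * Suc n) \<le> C * x ^ (s * Suc n)"
      unfolding C_def using x by (intro mult_right_mono) auto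
    moreover have "x ^ (s * Suc n) = (x ^ Suc n) ^ s" by (simp only: power_mult[symmetric] mult.commute)
    ultimately show ?thesis by (simp add: norm_mult norm_divide norm_power x_def)
  qed
  have B0: "B > 0" "C \<ge> 0" using x by (auto simp: B_def C_def)
  \<comment> \<open>The summand s = 0 is exactly 1, thanks to the factor 2 / (1 + q^s); the others
    are dominated by a geometric series with ratio x^(n + 1).\<close>
  have dist: "norm (op_prod n q * (1 + 2 * (\<Sum>j=1..n. (-1) ^ j * q ^ (j ^ 2))) - 1) \<le> C / (1 - x) * x ^ Suc n" for n
  proof -
    have "op_prod n q * (1 + 2 * (\<Sum>j=1..n. (-1) ^ j * q ^ (j ^ 2))) - 1 =
       (\<Sum>s=1..n. (-1) ^ s * op_prod s q * 2 / (1 + q ^ s) * q ^ (s * Suc n))"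
    proof -
      have "{..n} = insert 0 {1..n}" by auto
      then show ?thesis unfolding shanks_identity[OF q] by (simp add: op_prod_def del: power_Suc)
    qed
    also have "norm \<dots> \<le> (\<Sum>s=1..n. C * (x ^ Suc n) ^ s)"
      by (rule sum_norm_le) (use tbound in auto)
    also have "\<dots> = C * (\<Sum>s=1..n. (x ^ Suc n) ^ s)" by (simp only: sum_distrib_left)
    also have "(\<Sum>s=1..n. (x ^ Suc n) ^ s) \<le> x ^ Suc n / (1 - x)"
    proof -
      have "0 \<le> x ^ Suc n" "x ^ Suc n \<le> x"
        using x power_decreasing[of 1 "Suc n" x] by simp_all
      then have y: "0 \<le> x ^ Suc n" "x ^ Suc n \<le> x" "x ^ Suc n < 1"
        using x by linarith+
      have "(\<Sum>s=1..n. (x ^ Suc n) ^ s) \<le> x ^ Suc n / (1 - x ^ Suc n)"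
        using y x by (simp add: sum_gp divide_right_mono del: power_Suc)
      also have "\<dots> \<le> x ^ Suc n / (1 - x)" using y x by (intro divide_left_mono) auto
      finally show ?thesis .
    qed
    then have "C * (\<Sum>s=1..n. (x ^ Suc n) ^ s) \<le> C * (x ^ Suc n / (1 - x))"
      using B0(2) by (rule mult_left_mono)
    finally show ?thesis by simp
  qed
  have "(\<lambda>n. op_prod n q * (1 + 2 * (\<Sum>j=1..n. (-1) ^ j * q ^ (j ^ 2))) - 1) \<longlonglongrightarrow> 0"
  proof (rule tendsto_0_le[where K = 1])
    have "(\<lambda>n. x ^ n) \<longlonglongrightarrow> 0" using x by (simp add: LIMSEQ_power_zero)
    then show "(\<lambda>n. C / (1 - x) * x ^ Suc n) \<longlonglongrightarrow> 0"
      by (intro tendsto_mult_right_zero LIMSEQ_Suc)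
    have "C / (1 - x) * x ^ Suc n \<ge> 0" for n using B0 x by simp
    then show "\<forall>\<^sub>F n in sequentially. norm (op_prod n q * (1 + 2 * (\<Sum>j=1..n. (-1) ^ j * q ^ (j ^ 2))) - 1)
        \<le> norm (C / (1 - x) * x ^ Suc n) * 1"
      using dist by (intro always_eventually allI) (simp only: real_norm_def abs_of_nonneg mult_1_right)
  qed
  moreover have "(\<lambda>n. op_prod n q * (1 + 2 * (\<Sum>j=1..n. (-1) ^ j * q ^ (j ^ 2))) - 1) \<longlonglongrightarrow> op_gf q * theta4 q - 1"
  proof -
    have "(\<lambda>n. \<Sum>j<n. (-1) ^ Suc j * q ^ (Suc j ^ 2)) \<longlonglongrightarrow> (\<Sum>j. (-1) ^ Suc j * q ^ (Suc j ^ 2))"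
      by (rule summable_LIMSEQ[OF summable_norm_cancel[OF summable_theta4[OF q]]])
    moreover have "(\<Sum>j<n. (-1) ^ Suc j * q ^ (Suc j ^ 2)) = (\<Sum>j=1..n. (-1) ^ j * q ^ (j ^ 2))" for n
      by (simp only: sum.atLeast1_atMost_eq One_nat_def)
    ultimately show ?thesis
      unfolding theta4_def by (intro tendsto_intros op_prod_tendsto[OF q]) simp
  qed
  ultimately have "op_gf q * theta4 q - 1 = 0" by (rule LIMSEQ_unique[rotated])
  then show ?thesis by simp
qed


section \<open>The generating function in the unit disc and the recurrence\<close>

text \<open>The sum is 2 Re (artanh w - w). What matters is that all coefficients are nonnegative;
  at \<open>n = 0\<close> the coefficient is 0 / 0 = 0.\<close>

lemma artanh_series:
  fixes w :: complex
  assumes "norm w < 1"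
  shows "(\<lambda>n. (if n = 1 then 0 else (1 - (-1) ^ n) / real n) * Re (w ^ n)) sums
     (ln (norm (1 + w)) - ln (norm (1 - w)) - 2 * Re w)"
proof -
  have "1 + w \<noteq> 0" "1 - w \<noteq> 0" using assms by (auto simp: add_eq_0_iff)
  then have "Re (ln (1 + w)) = ln (norm (1 + w))" "Re (ln (1 - w)) = ln (norm (1 - w))" by simp_all
  moreover have "(\<lambda>n. - ((- w) ^ n) / of_nat n) sums ln (1 + w)" "(\<lambda>n. - (w ^ n) / of_nat n) sums ln (1 - w)"
    using Ln_series'[of w] Ln_series'[of "- w"] assms by simp_all
  ultimately have "(\<lambda>n. Re (- ((- w) ^ n) / of_nat n) - Re (- (w ^ n) / of_nat n)) sums
      (ln (norm (1 + w)) - ln (norm (1 - w)))"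
    by (metis sums_Re sums_diff)
  moreover have "(\<lambda>n. if n = 1 then 2 * Re w else 0) sums (2 * Re w)"
    using sums_single[of 1 "\<lambda>_. 2 * Re w"] by simp
  ultimately have "(\<lambda>n. Re (- ((- w) ^ n) / of_nat n) - Re (- (w ^ n) / of_nat n) - (if n = 1 then 2 * Re w else 0))
     sums (ln (norm (1 + w)) - ln (norm (1 - w)) - 2 * Re w)"
    by (rule sums_diff)
  moreover have "Re (- ((- w) ^ n) / of_nat n) - Re (- (w ^ n) / of_nat n) - (if n = 1 then 2 * Re w else 0)
     = (if n = 1 then 0 else (1 - (-1) ^ n) / real n) * Re (w ^ n)" for n
  proof -
    have "Re ((- w) ^ n) = (-1) ^ n * Re (w ^ n)" by (cases "even n") simp_all
    then show ?thesis by (cases "even n"; cases "n = 1"; simp add: Re_divide_of_nat)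
  qed
  ultimately show ?thesis by simp
qed

text \<open>In \<open>artanh_series\<close> the coefficients are nonnegative and Re (w^n) <= |w|^n,
  so beyond the linear term w may be replaced by |w|. The linear term is kept exactly and yields the
  exponential saving.\<close>

lemma norm_mobius_le:
  fixes w :: complex
  assumes "norm w < 1"
  shows "norm ((1 + w) / (1 - w)) \<le> (1 + norm w) / (1 - norm w) * exp (2 * (Re w - norm w))"
proof -
  define x where "x = norm w"
  have x: "0 \<le> x" "x < 1" using assms by (auto simp: x_def)
  have "1 + w \<noteq> 0" "1 - w \<noteq> 0" using assms by (auto simp: add_eq_0_iff)
  then have pos: "norm (1 + w) > 0" "norm (1 - w) > 0" by auto
  have "1 + complex_of_real x = complex_of_real (1 + x)" "1 - complex_of_real x = complex_of_real (1 - x)"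
    by simp_all
  then have nx: "norm (1 + complex_of_real x) = 1 + x" "norm (1 - complex_of_real x) = 1 - x"
    using x by (simp_all only: norm_of_real)
  have "ln (norm (1 + w)) - ln (norm (1 - w)) - 2 * Re w \<le> ln (1 + x) - ln (1 - x) - 2 * x"
  proof (rule sums_le[OF _ artanh_series[OF assms]])
    show "(\<lambda>n. (if n = 1 then 0 else (1 - (-1) ^ n) / real n) * Re (complex_of_real x ^ n)) sums
        (ln (1 + x) - ln (1 - x) - 2 * x)"
      using artanh_series[of "complex_of_real x"] x nx by simp
    fix n
    have "Re (w ^ n) \<le> Re (complex_of_real x ^ n)"
      using complex_Re_le_cmod[of "w ^ n"] by (simp add: x_def norm_power flip: of_real_power)
    then show "(if n = 1 then 0 else (1 - (-1) ^ n) / real n) * Re (w ^ n)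
       \<le> (if n = 1 then 0 else (1 - (-1) ^ n) / real n) * Re (complex_of_real x ^ n)"
      by (intro mult_left_mono) (cases "even n"; simp)+
  qed
  then have "ln (norm (1 + w) / norm (1 - w)) \<le> ln ((1 + x) / (1 - x)) + 2 * (Re w - x)"
    using pos x by (simp add: ln_div)
  then have "exp (ln (norm (1 + w) / norm (1 - w))) \<le> exp (ln ((1 + x) / (1 - x)) + 2 * (Re w - x))"
    by simp
  moreover have "exp (ln ((1 + x) / (1 - x))) = (1 + x) / (1 - x)"
    "exp (ln (norm (1 + w) / norm (1 - w))) = norm (1 + w) / norm (1 - w)"
    using x pos by (auto intro!: exp_ln divide_pos_pos)
  ultimately show ?thesis by (simp only: exp_add norm_divide x_def)
qed

text \<open>Apply \<open>norm_mobius_le\<close> to each factor with w = q^m. The savings add up to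
  geometric series in q and |q|, and 1 + 2 Re (q / (1 - q)) is the Poisson kernel (1 - |q|^2) / |1 -
  q|^2.\<close>

lemma norm_op_gf_le:
  fixes q :: complex
  assumes q: "norm q < 1"
  shows "norm (op_gf q) \<le> op_gf (norm q) *
    exp ((1 - norm q ^ 2) / norm (1 - q) ^ 2 - (1 + norm q) / (1 - norm q))"
proof -
  define x where "x = norm q"
  have x: "0 \<le> x" "x < 1" using q by (auto simp: x_def)
  have q1: "1 - q \<noteq> 0" using q by auto
  have fin: "norm (op_prod N q) \<le> op_prod N x * exp (\<Sum>m=1..N. 2 * (Re (q ^ m) - x ^ m))" for N
  proof -
    have "norm (op_prod N q) = (\<Prod>m=1..N. norm ((1 + q ^ m) / (1 - q ^ m)))"
      unfolding op_prod_def prod_norm ..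
    also have "\<dots> \<le> (\<Prod>m=1..N. (1 + x ^ m) / (1 - x ^ m) * exp (2 * (Re (q ^ m) - x ^ m)))"
    proof (intro prod_mono conjI norm_ge_zero)
      fix m assume "m \<in> {1..N}"
      then have "norm (q ^ m) < 1" using q by (simp add: norm_power power_less_one_iff)
      from norm_mobius_le[OF this]
      show "norm ((1 + q ^ m) / (1 - q ^ m)) \<le> (1 + x ^ m) / (1 - x ^ m) * exp (2 * (Re (q ^ m) - x ^ m))"
        by (simp add: norm_power x_def)
    qed
    also have "\<dots> = op_prod N x * exp (\<Sum>m=1..N. 2 * (Re (q ^ m) - x ^ m))"
      by (simp only: op_prod_def prod.distrib exp_sum finite_atLeastAtMost)
    finally show ?thesis .
  qed
  have s1: "(\<lambda>N. \<Sum>m=1..N. z ^ m) \<longlonglongrightarrow> z / (1 - z)" if "norm z < 1" for z :: complex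
  proof -
    have "(\<lambda>n. z * z ^ n) sums (z * (1 / (1 - z)))"
      by (intro sums_mult geometric_sums that)
    then show ?thesis
      by (simp add: sums_def sum.atLeast1_atMost_eq)
  qed
  have s2: "(\<lambda>N. \<Sum>m=1..N. x ^ m) \<longlonglongrightarrow> x / (1 - x)"
  proof -
    have "(\<lambda>n. x * x ^ n) sums (x * (1 / (1 - x)))"
      using x by (intro sums_mult geometric_sums) auto
    then show ?thesis
      by (simp add: sums_def sum.atLeast1_atMost_eq)
  qed
  have lim: "(\<lambda>N. \<Sum>m=1..N. 2 * (Re (q ^ m) - x ^ m)) \<longlonglongrightarrow> 2 * (Re (q / (1 - q)) - x / (1 - x))"
  proof -
    have "(\<Sum>m=1..N. 2 * (Re (q ^ m) - x ^ m)) = 2 * (Re (\<Sum>m=1..N. q ^ m) - (\<Sum>m=1..N. x ^ m))" for N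
      by (simp add: sum_distrib_left[symmetric] sum_subtractf)
    then show ?thesis
      by (simp only:) (intro tendsto_mult tendsto_const tendsto_diff tendsto_Re s1[OF q] s2)
  qed
  have "norm (op_gf q) \<le> op_gf x * exp (2 * (Re (q / (1 - q)) - x / (1 - x)))"
  proof (rule LIMSEQ_le[OF tendsto_norm[OF op_prod_tendsto[OF q]]])
    show "(\<lambda>N. op_prod N x * exp (\<Sum>m=1..N. 2 * (Re (q ^ m) - x ^ m))) \<longlonglongrightarrow>
        op_gf x * exp (2 * (Re (q / (1 - q)) - x / (1 - x)))"
      using x by (intro tendsto_mult tendsto_exp lim op_prod_tendsto) auto
    show "\<exists>N. \<forall>n\<ge>N. norm (op_prod n q) \<le> op_prod n x * exp (\<Sum>m = 1..n. 2 * (Re (q ^ m) - x ^ m))"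
      using fin by blast
  qed
  also have "2 * (Re (q / (1 - q)) - x / (1 - x)) = (1 - x ^ 2) / norm (1 - q) ^ 2 - (1 + x) / (1 - x)"
  proof -
    have "2 * Re (q / (1 - q)) = (1 - x ^ 2) / norm (1 - q) ^ 2 - 1"
    proof -
      have n1: "norm (1 - q) ^ 2 = (1 - Re q)^2 + Im q ^ 2" by (simp add: cmod_power2)
      have n2: "x ^ 2 = Re q ^ 2 + Im q ^ 2" by (simp add: x_def cmod_power2)
      have "(1 - Re q)^2 + Im q ^ 2 \<noteq> 0" using q1 n1 by (metis norm_eq_zero zero_eq_power2)
      then show ?thesis unfolding n1 n2
        by (simp add: Re_divide divide_simps) (simp add: power2_eq_square algebra_simps)
    qed
    moreover have "2 * (x / (1 - x)) = (1 + x) / (1 - x) - 1" using x by (simp add: field_simps)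
    ultimately show ?thesis by (simp add: algebra_simps)
  qed
  finally show ?thesis by (simp add: x_def)
qed

section \<open>The recurrence obtained from the theta series\<close>

lemma theta4_powser:
  fixes q :: "'a::{real_normed_field, banach}"
  assumes "norm q < 1"
  shows "(\<lambda>n. (if n = 0 then 1 else if \<exists>j. n = j ^ 2 then 2 * (-1) ^ n else 0) * q ^ n) sums theta4 q"
    (is "?t sums _")
proof -
  have sq: "strict_mono (\<lambda>j::nat. j ^ 2)"
    by (intro strict_monoI power_strict_mono) auto
  have "(\<lambda>j. (-1) ^ Suc j * q ^ (Suc j ^ 2)) sums (\<Sum>j. (-1) ^ Suc j * q ^ (Suc j ^ 2))"
    by (rule summable_sums[OF summable_norm_cancel[OF summable_theta4[OF assms]]])
  from sums_mult[OF this, of 2]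
  have "(\<lambda>j. ?t (Suc j ^ 2)) sums (theta4 q - 1)"
  proof -
    have "?t (Suc j ^ 2) = 2 * ((-1) ^ Suc j * q ^ (Suc j ^ 2))" for j
    proof -
      \<comment> \<open>A square has the parity of its root, so the sign can be read off from the
        exponent alone.\<close>
      have "(-1) ^ (Suc j ^ 2) = ((-1) ^ Suc j :: 'a)"
        by (cases "even j") (auto simp del: power_Suc)
      moreover have "\<exists>i. Suc j ^ 2 = i ^ 2" by blast
      ultimately show ?thesis by (simp del: power_Suc)
    qed
    then have "(\<lambda>j. ?t (Suc j ^ 2)) = (\<lambda>j. 2 * ((-1) ^ Suc j * q ^ (Suc j ^ 2)))" by (rule ext)
    with \<open>(\<lambda>j. 2 * ((-1) ^ Suc j * q ^ (Suc j ^ 2))) sums _\<close> show ?thesis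
      by (simp only: theta4_def add_diff_cancel_left')
  qed
  then have "(\<lambda>j. ?t (j ^ 2)) sums theta4 q"
    by (subst (asm) sums_Suc_iff) simp
  then show ?thesis
  proof (subst (asm) sums_mono_reindex[OF sq])
    fix n assume "n \<notin> range (\<lambda>j::nat. j ^ 2)"
    moreover from this have "n \<noteq> 0" by (metis rangeI zero_power2)
    ultimately show "?t n = 0" by auto
  qed
qed

text \<open>The coefficient of q^n in \<open>op_gf q * theta4 q = 1\<close>. The identity of
  functions on the disc passes to formal power series because these are determined by their values
  near 0.\<close>

lemma overpartition_recurrence:
  assumes "n > 0"
  shows "real (overpartition_count n) +
    2 * (\<Sum>j | 0 < j \<and> j ^ 2 \<le> n. (-1) ^ j * real (overpartition_count (n - j ^ 2))) = 0"
proof -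
  define t :: "nat \<Rightarrow> complex" where
    "t n = (if n = 0 then 1 else if \<exists>j. n = j ^ 2 then 2 * (-1) ^ n else 0)" for n
  define P where "P = Abs_fps (\<lambda>n. of_nat (overpartition_count n) :: complex)"
  define T where "T = Abs_fps t"
  have radP: "fps_conv_radius P \<ge> 1"
    unfolding fps_conv_radius_def
  proof (rule conv_radius_geI_ex')
    fix r :: real assume "0 < r" "ereal r < 1"
    then show "summable (\<lambda>n. fps_nth P n * of_real r ^ n)"
      using summable_norm_cancel[OF summable_overpartition[of "of_real r :: complex"]] by (simp add: P_def)
  qed
  have radT: "fps_conv_radius T \<ge> 1"
    unfolding fps_conv_radius_def
  proof (rule conv_radius_geI_ex')
    fix r :: real assume "0 < r" "ereal r < 1"
    then show "summable (\<lambda>n. fps_nth T n * of_real r ^ n)"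
      using theta4_powser[of "of_real r :: complex"] by (simp add: T_def t_def[abs_def] sums_iff)
  qed
  have rads: "(0::ereal) < fps_conv_radius P" "(0::ereal) < fps_conv_radius T"
    using radP radT by (auto intro: less_le_trans[of 0 1])
  have "P * T = 1"
  proof (rule eval_fps_eqD)
    show "fps_conv_radius (P * T) > 0"
      by (rule less_le_trans[OF _ fps_conv_radius_mult]) (simp add: rads)
    show "fps_conv_radius (1 :: complex fps) > 0" by simp
    have "eval_fps (P * T) z = eval_fps 1 z" if z: "norm z < 1" for z :: complex
    proof -
      have "ereal (norm z) < 1" using z by (simp add: one_ereal_def)
      then have zr: "ereal (norm z) < fps_conv_radius P" "ereal (norm z) < fps_conv_radius T"
        using radP radT less_le_trans by blast+
      have "eval_fps P z = op_gf z" by (simp add: eval_fps_def P_def op_gf_def)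
      moreover have "eval_fps T z = theta4 z"
        using theta4_powser[OF z] by (simp add: eval_fps_def T_def t_def[abs_def] sums_iff)
      ultimately show ?thesis using op_gf_mult_theta4[OF z] zr by (simp add: eval_fps_mult)
    qed
    then show "\<forall>\<^sub>F z in nhds 0. eval_fps (P * T) z = eval_fps 1 z"
      by (intro eventually_mono[OF eventually_nhds_in_open[of "ball 0 1"]]) auto
  qed
  then have "fps_nth (P * T) n = 0" using assms by simp
  then have "(\<Sum>i=0..n. of_nat (overpartition_count i) * t (n - i)) = 0"
    by (simp add: fps_mult_nth P_def T_def)
  also have "(\<Sum>i=0..n. of_nat (overpartition_count i) * t (n - i)) = (\<Sum>m=0..n. of_nat (overpartition_count (n - m)) * t m)"
    by (rule sum.reindex_bij_witness[of _ "\<lambda>i. n - i" "\<lambda>i. n - i"]) auto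
  also have "\<dots> = of_nat (overpartition_count n) + (\<Sum>m=1..n. of_nat (overpartition_count (n - m)) * t m)"
    by (subst sum.atLeast_Suc_atMost) (auto simp: t_def)
  also have "(\<Sum>m=1..n. of_nat (overpartition_count (n - m)) * t m) =
      (\<Sum>m\<in>(\<lambda>j. j ^ 2) ` {j. 0 < j \<and> j ^ 2 \<le> n}. of_nat (overpartition_count (n - m)) * t m)"
    by (rule sum.mono_neutral_right) (auto simp: t_def Suc_le_eq)
  also have "\<dots> = (\<Sum>j | 0 < j \<and> j ^ 2 \<le> n. of_nat (overpartition_count (n - j ^ 2)) * t (j ^ 2))"
    by (subst sum.reindex) (auto simp: inj_on_def)
  also have "\<dots> = (\<Sum>j | 0 < j \<and> j ^ 2 \<le> n. 2 * ((-1) ^ j * of_nat (overpartition_count (n - j ^ 2))))"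
  proof (rule sum.cong[OF refl])
    fix j assume "j \<in> {j. 0 < j \<and> j ^ 2 \<le> n}"
    moreover have "(-1) ^ (j ^ 2) = ((-1) ^ j :: complex)" by (cases "even j") auto
    ultimately have "t (j ^ 2) = 2 * (-1) ^ j" by (auto simp: t_def)
    then show "of_nat (overpartition_count (n - j ^ 2)) * t (j ^ 2) = 2 * ((-1) ^ j * of_nat (overpartition_count (n - j ^ 2)))"
      by simp
  qed
  also have "of_nat (overpartition_count n) + \<dots> = complex_of_real (real (overpartition_count n) +
    2 * (\<Sum>j | 0 < j \<and> j ^ 2 \<le> n. (-1) ^ j * real (overpartition_count (n - j ^ 2))))"
    by (simp add: sum_distrib_left)
  finally show ?thesis by (simp only: of_real_eq_0_iff)
qed


section \<open>The transformation formula of the theta function\<close>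

text \<open>The binomial theorem for (e^(i x) + e^(-i x))^(2 M).\<close>

lemma two_cos_power:
  "(2 * cos x) ^ (2 * M) = (\<Sum>r\<le>2 * M. real (2 * M choose r) * cos (2 * (real r - real M) * x))"
proof -
  have "complex_of_real ((2 * cos x) ^ (2 * M)) = (cis x + cis (- x)) ^ (2 * M)"
    by (simp add: complex_eq_iff cis.ctr[symmetric] flip: cis_cnj)
  also have "\<dots> = (\<Sum>r\<le>2 * M. of_nat (2 * M choose r) * cis x ^ r * cis (- x) ^ (2 * M - r))"
    by (rule binomial_ring)
  also have "\<dots> = (\<Sum>r\<le>2 * M. complex_of_real (real (2 * M choose r)) * cis (2 * (real r - real M) * x))"
  proof (rule sum.cong[OF refl])
    fix r assume "r \<in> {..2 * M}"
    then have eq: "real r * x + real (2 * M - r) * (- x) = 2 * (real r - real M) * x"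
      by (simp add: of_nat_diff algebra_simps)
    have "cis x ^ r = cis (real r * x)" "cis (- x) ^ (2 * M - r) = cis (real (2 * M - r) * (- x))"
      by (rule Complex.DeMoivre)+
    then have "cis x ^ r * cis (- x) ^ (2 * M - r) = cis (2 * (real r - real M) * x)"
      by (metis cis_mult eq)
    then show "of_nat (2 * M choose r) * cis x ^ r * cis (- x) ^ (2 * M - r) =
        complex_of_real (real (2 * M choose r)) * cis (2 * (real r - real M) * x)"
      by (simp add: mult.assoc)
  qed
  finally have "Re (complex_of_real ((2 * cos x) ^ (2 * M))) =
      Re (\<Sum>r\<le>2 * M. complex_of_real (real (2 * M choose r)) * cis (2 * (real r - real M) * x))" by simp
  then show ?thesis by (simp only: Re_complex_of_real Re_sum Re_complex_of_real times_complex.sel cis.sel Im_complex_of_real) simp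
qed

lemma two_cos_power':
  "(2 * cos x) ^ (2 * M) =
     real (2 * M choose M) + 2 * (\<Sum>d=1..M. real (2 * M choose (M + d)) * cos (2 * real d * x))"
proof -
  define g where "g r = real (2 * M choose r) * cos (2 * (real r - real M) * x)" for r
  have "{..2 * M} = {..<M} \<union> {M..2 * M}" by auto
  then have "sum g {..2 * M} = sum g {..<M} + sum g {M..2 * M}"
    by (simp only:) (rule sum.union_disjoint, auto)
  also have "sum g {M..2 * M} = g M + sum g {M<..2 * M}"
    by (rule sum.head) simp
  also have "sum g {M<..2 * M} = (\<Sum>d=1..M. g (M + d))"
    by (rule sum.reindex_bij_witness[of _ "\<lambda>d. M + d" "\<lambda>r. r - M"]) auto
  also have "sum g {..<M} = (\<Sum>d=1..M. g (M + d))"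
  proof (rule sum.reindex_bij_witness[of _ "\<lambda>d. M - d" "\<lambda>r. M - r"])
    fix r assume "r \<in> {..<M}"
    then have r: "r < M" by simp
    have "2 * M choose r = 2 * M choose (M + (M - r))"
      using r binomial_symmetric[of r "2 * M"] by (simp add: mult_2)
    moreover have "cos (2 * (real (M + (M - r)) - real M) * x) = cos (- (2 * (real r - real M) * x))"
      using r by (intro arg_cong[of _ _ cos]) (simp add: of_nat_diff algebra_simps)
    ultimately show "g (M + (M - r)) = g r" unfolding g_def by (simp only: cos_minus)
  qed auto
  finally show ?thesis unfolding two_cos_power by (simp add: g_def)
qed

text \<open>Discrete orthogonality on the midpoints of \<open>L\<close> equal parts of [0, pi]. The
  shift by 1/2 produces the sign (-1)^(d div L), which becomes the alternating sign of
  \<open>theta4\<close>.\<close>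

lemma sum_cos_odd_multiples:
  fixes L d :: nat
  assumes "L > 0"
  shows "(\<Sum>k<L. cos (2 * real d * (pi * (real k + 1/2) / real L))) =
    (if L dvd d then real L * (-1) ^ (d div L) else 0)"
proof (cases "L dvd d")
  case True
  then obtain j where j: "d = L * j" by blast
  have "cos (2 * real d * (pi * (real k + 1/2) / real L)) = (-1) ^ j" for k
  proof -
    have "2 * real d * (pi * (real k + 1/2) / real L) = real (j * (2 * k + 1)) * pi"
      using assms j by (simp add: field_simps)
    also have "cos \<dots> = (-1) ^ (j * (2 * k + 1))" by (rule cos_npi)
    also have "\<dots> = (-1) ^ j" by (cases "even j") auto
    finally show ?thesis .
  qed
  then show ?thesis using assms j by simp
next
  case False
  define a where "a = pi * real d / real L"
  have "sin a \<noteq> 0"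
  proof
    assume "sin a = 0"
    then obtain i :: int where i: "a = of_int i * pi" by (auto simp: sin_zero_iff_int2)
    then have "real d = of_int i * real L" using assms by (simp add: a_def field_simps)
    then have "int d = i * int L" by (metis of_int_eq_iff of_int_mult of_int_of_nat_eq)
    then have "int L dvd int d" by simp
    with False show False by simp
  qed
  \<comment> \<open>Multiplication by 2 sin a makes the sum of cosines at odd multiples of a
    telescope.\<close>
  have "2 * sin a * (\<Sum>k<n. cos ((2 * real k + 1) * a)) = sin (2 * real n * a)" for n
  proof (induction n)
    case (Suc n)
    have "2 * sin a * cos ((2 * real n + 1) * a) = sin (a + (2 * real n + 1) * a) + sin (a - (2 * real n + 1) * a)"
      by (simp add: sin_add sin_diff)
    also have "\<dots> = sin (2 * real (Suc n) * a) - sin (2 * real n * a)"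
    proof -
      have "a + (2 * real n + 1) * a = 2 * real (Suc n) * a" "a - (2 * real n + 1) * a = - (2 * real n * a)"
        by (simp_all add: algebra_simps)
      then show ?thesis by (simp only: sin_minus)
    qed
    finally show ?case using Suc by (simp add: algebra_simps)
  qed simp
  from this[of L] have "2 * sin a * (\<Sum>k<L. cos ((2 * real k + 1) * a)) = sin (2 * real L * a)" .
  also have "2 * real L * a = real (2 * d) * pi" using assms by (simp add: a_def)
  also have "sin \<dots> = 0" by (rule sin_npi)
  finally have "(\<Sum>k<L. cos ((2 * real k + 1) * a)) = 0" using \<open>sin a \<noteq> 0\<close> by simp
  moreover have "2 * real d * (pi * (real k + 1/2) / real L) = (2 * real k + 1) * a" for k
    using assms by (simp add: a_def field_simps)
  ultimately show ?thesis using False by simp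
qed

text \<open>Polya's finite analogue of the transformation formula of the theta function.\<close>

lemma polya_identity:
  fixes H M :: nat
  assumes "H > 0"
  defines "L \<equiv> 2 * H"
  shows "2 * (\<Sum>k<H. (2 * cos (pi * (real k + 1/2) / real L)) ^ (2 * M)) =
    real L * (real (2 * M choose M) + 2 * (\<Sum>j=1..M. (-1) ^ j * real (2 * M choose (M + j * L))))"
proof -
  let ?x = "\<lambda>k. pi * (real k + 1/2) / real L"
  have L: "L > 0" using assms by (simp add: L_def)
  have "(\<Sum>k<L. (2 * cos (?x k)) ^ (2 * M)) =
    (\<Sum>k<L. real (2 * M choose M)) + 2 * (\<Sum>k<L. \<Sum>d=1..M. real (2 * M choose (M + d)) * cos (2 * real d * ?x k))"
    unfolding two_cos_power' by (simp only: sum.distrib sum_distrib_left)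
  also have "(\<Sum>k<L. \<Sum>d=1..M. real (2 * M choose (M + d)) * cos (2 * real d * ?x k)) =
      (\<Sum>d=1..M. real (2 * M choose (M + d)) * (\<Sum>k<L. cos (2 * real d * ?x k)))"
    by (subst sum.swap) (simp only: sum_distrib_left)
  also have "\<dots> = (\<Sum>d=1..M. if L dvd d then real L * ((-1) ^ (d div L) * real (2 * M choose (M + d))) else 0)"
    unfolding sum_cos_odd_multiples[OF L] by (intro sum.cong) auto
  also have "\<dots> = (\<Sum>d\<in>(\<lambda>j. j * L) ` {j\<in>{1..M}. j * L \<le> M}. real L * ((-1) ^ (d div L) * real (2 * M choose (M + d))))"
  proof (rule sum.mono_neutral_cong_right)
    show "(\<lambda>j. j * L) ` {j\<in>{1..M}. j * L \<le> M} \<subseteq> {1..M}" using L by auto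
    have "d \<in> (\<lambda>j. j * L) ` {j\<in>{1..M}. j * L \<le> M}" if "L dvd d" "d \<in> {1..M}" for d
    proof -
      from that(1) obtain j where j: "d = L * j" by (elim dvdE)
      have "j \<le> L * j" using L by simp
      then have "j \<in> {1..M}" using that j by (cases j) auto
      then show ?thesis using that j by (auto simp: mult.commute)
    qed
    then show "\<forall>d\<in>{1..M} - (\<lambda>j. j * L) ` {j\<in>{1..M}. j * L \<le> M}.
       (if L dvd d then real L * ((-1) ^ (d div L) * real (2 * M choose (M + d))) else 0) = 0" by auto
  qed auto
  also have "\<dots> = (\<Sum>j\<in>{j\<in>{1..M}. j * L \<le> M}. real L * ((-1) ^ j * real (2 * M choose (M + j * L))))"
    using L by (subst sum.reindex) (auto simp: inj_on_def)
  also have "\<dots> = (\<Sum>j=1..M. real L * ((-1) ^ j * real (2 * M choose (M + j * L))))"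
    by (rule sum.mono_neutral_left) (auto simp: binomial_eq_0)
  \<comment> \<open>\<open>L\<close> is even, so the reflection x -> pi - x pairs the points of the
    two halves, and the even power ignores the change of sign of the cosine.\<close>
  also have "(\<Sum>k<L. (2 * cos (?x k)) ^ (2 * M)) = 2 * (\<Sum>k<H. (2 * cos (?x k)) ^ (2 * M))"
  proof -
    have "(\<Sum>k<L. (2 * cos (?x k)) ^ (2 * M)) =
      (\<Sum>k<H. (2 * cos (?x k)) ^ (2 * M)) + (\<Sum>k\<in>{H..<L}. (2 * cos (?x k)) ^ (2 * M))"
      unfolding lessThan_atLeast0 by (rule sum.atLeastLessThan_concat[symmetric]) (simp_all add: L_def)
    also have "(\<Sum>k\<in>{H..<L}. (2 * cos (?x k)) ^ (2 * M)) = (\<Sum>k<H. (2 * cos (?x k)) ^ (2 * M))"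
    proof (rule sum.reindex_bij_witness[of _ "\<lambda>k. L - Suc k" "\<lambda>k. L - Suc k"])
      fix k assume "k \<in> {H..<L}"
      then have k: "k < L" by simp
      have "?x (L - Suc k) = pi - ?x k" using k L by (simp add: of_nat_diff field_simps)
      then have "cos (?x (L - Suc k)) = - cos (?x k)" by (simp only: cos_pi_minus)
      then show "(2 * cos (?x (L - Suc k))) ^ (2 * M) = (2 * cos (?x k)) ^ (2 * M)"
        by (simp add: power_mult)
    qed (auto simp: L_def)
    finally show ?thesis by simp
  qed
  finally show ?thesis by (simp add: sum_distrib_left algebra_simps)
qed

section \<open>Binomial coefficients near the centre\<close>

lemma binomial_step:
  fixes i M :: nat
  assumes "i < M"
  shows "real (2 * M choose (M + Suc i)) = real (2 * M choose (M + i)) * (1 - (2 * real i + 1) / (real M + real i + 1))"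
proof -
  have "Suc (M + i) * (2 * M choose Suc (M + i)) = (2 * M - (M + i)) * (2 * M choose (M + i))"
    by (metis binomial_absorption binomial_absorb_comp mult.commute)
  then have "real (Suc (M + i)) * real (2 * M choose Suc (M + i)) = real (M - i) * real (2 * M choose (M + i))"
    by (simp add: mult_2 flip: of_nat_mult del: of_nat_Suc)
  then show ?thesis using assms by (simp add: of_nat_diff field_simps)
qed
text \<open>Each step multiplies by 1 - v <= exp (-v), with v at least (2 i + 1) / (M + r); the odd
  numbers 2 i + 1 add up to a square.\<close>

lemma central_binomial_ratio_upper:
  fixes i M r :: nat
  assumes "i \<le> r" "r \<le> M"
  shows "real (2 * M choose (M + i)) \<le> real (2 * M choose M) * exp (- (real i ^ 2 / real (M + r)))"
proof -
  have sq: "real (Suc i) ^ 2 = real i ^ 2 + (2 * real i + 1)" for i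
    by (simp add: power2_eq_square algebra_simps)
  show "real (2 * M choose (M + i)) \<le> real (2 * M choose M) * exp (- (real i ^ 2 / real (M + r)))"
    using assms(1)
  proof (induction i)
    case (Suc i)
    define v where "v = (2 * real i + 1) / (real M + real i + 1)"
    have "v \<ge> (2 * real i + 1) / real (M + r)"
      unfolding v_def using Suc assms by (intro divide_left_mono) auto
    then have "1 - v \<le> exp (- ((2 * real i + 1) / real (M + r)))"
      using exp_ge_add_one_self[of "- ((2 * real i + 1) / real (M + r))"] by linarith
    moreover have "1 - v \<ge> 0" unfolding v_def using Suc assms by (simp add: field_simps)
    ultimately have "real (2 * M choose (M + i)) * (1 - v) \<le>
       real (2 * M choose M) * exp (- (real i ^ 2 / real (M + r))) * exp (- ((2 * real i + 1) / real (M + r)))"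
      using Suc by (intro mult_mono) auto
    also have "\<dots> = real (2 * M choose M) * exp (- (real (Suc i) ^ 2 / real (M + r)))"
      unfolding sq by (simp add: exp_add[symmetric] add_divide_distrib)
    finally show ?case using Suc assms binomial_step[of i M] by (simp add: v_def)
  qed simp
qed

text \<open>Here the reciprocal of the step factor is 1 + (2 i + 1) / (M - i), which is at most exp
  ((2 i + 1) / (M - r)).\<close>

lemma central_binomial_ratio_lower:
  fixes i M r :: nat
  assumes "i \<le> r" "r < M"
  shows "real (2 * M choose (M + i)) \<ge> real (2 * M choose M) * exp (- (real i ^ 2 / real (M - r)))"
proof -
  have sq: "real (Suc i) ^ 2 = real i ^ 2 + (2 * real i + 1)" for i
    by (simp add: power2_eq_square algebra_simps)
  show "real (2 * M choose (M + i)) \<ge> real (2 * M choose M) * exp (- (real i ^ 2 / real (M - r)))"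
    using assms(1)
  proof (induction i)
    case (Suc i)
    define v where "v = (2 * real i + 1) / (real M + real i + 1)"
    have v1: "1 - v = (real M - real i) / (real M + real i + 1)" by (simp add: v_def field_simps)
    have pos: "1 - v > 0" unfolding v1 using Suc assms by auto
    have "1 + (2 * real i + 1) / (real M - real i) = inverse (1 - v)"
      unfolding v1 using Suc assms by (simp add: field_simps)
    then have "inverse (1 - v) \<le> exp ((2 * real i + 1) / (real M - real i))"
      using exp_ge_add_one_self[of "(2 * real i + 1) / (real M - real i)"] by simp
    also have "\<dots> \<le> exp ((2 * real i + 1) / real (M - r))"
      using Suc assms by (intro iffD2[OF exp_le_cancel_iff] divide_left_mono) (auto simp: of_nat_diff)
    finally have "inverse (1 - v) \<le> exp ((2 * real i + 1) / real (M - r))" .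
    from le_imp_inverse_le[OF this] have "exp (- ((2 * real i + 1) / real (M - r))) \<le> 1 - v"
      using pos by (simp add: exp_minus)
    then have "real (2 * M choose M) * exp (- (real i ^ 2 / real (M - r))) * exp (- ((2 * real i + 1) / real (M - r)))
      \<le> real (2 * M choose (M + i)) * (1 - v)"
      using Suc pos by (intro mult_mono) auto
    also have "real (2 * M choose M) * exp (- (real i ^ 2 / real (M - r))) * exp (- ((2 * real i + 1) / real (M - r)))
      = real (2 * M choose M) * exp (- (real (Suc i) ^ 2 / real (M - r)))"
      unfolding sq by (simp add: exp_add[symmetric] add_divide_distrib)
    finally show ?case using Suc assms binomial_step[of i M] by (simp add: v_def)
  qed simp
qed

text \<open>Wallis' product: with \<open>b M\<close> the normalised central coefficient, b^2 (2 M +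
  1) is the reciprocal of its M-th partial product.\<close>

lemma central_binomial_asymp:
  "(\<lambda>M. real (2 * M choose M) / 4 ^ M * sqrt (real M)) \<longlonglongrightarrow> 1 / sqrt pi"
proof -
  define b where "b M = real (2 * M choose M) / 4 ^ M" for M
  have bSuc: "b (Suc M) = b M * ((2 * real M + 1) / (2 * real M + 2))" for M
  proof -
    have "real (2 * Suc M choose Suc M) * (real M + 1) = 2 * (2 * real M + 1) * real (2 * M choose M)"
    proof -
      have "Suc M * (2 * Suc M choose Suc M) = 2 * (2 * M + 1) * (2 * M choose M)"
      proof -
        have "Suc M * (Suc (Suc (2 * M)) choose Suc M) = Suc (Suc (2 * M)) * (Suc (2 * M) choose M)"
          by (metis Suc_times_binomial_eq mult.commute)
        moreover have "Suc M * (Suc (2 * M) choose Suc M) = Suc (2 * M) * (2 * M choose M)"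
          by (metis Suc_times_binomial_eq mult.commute)
        moreover have "Suc (2 * M) choose Suc M = Suc (2 * M) choose M"
          using binomial_symmetric[of "Suc M" "Suc (2 * M)"] by simp
        ultimately have "Suc M * (Suc M * (Suc (Suc (2 * M)) choose Suc M)) =
            Suc (Suc (2 * M)) * (Suc (2 * M) * (2 * M choose M))"
          by (metis mult.left_commute)
        also have "\<dots> = Suc M * (2 * (2 * M + 1) * (2 * M choose M))" by (simp add: algebra_simps)
        finally have "Suc M * (Suc (Suc (2 * M)) choose Suc M) = 2 * (2 * M + 1) * (2 * M choose M)"
          by (metis mult_left_cancel nat.distinct(1))
        then show ?thesis by (metis add_2_eq_Suc mult_2 mult_Suc_right)
      qed
      moreover have "real c * (real M + 1) = 2 * (2 * real M + 1) * real a"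
        if "Suc M * c = 2 * (2 * M + 1) * a" for a c
      proof -
        have "real (Suc M * c) = real (2 * (2 * M + 1) * a)" by (simp only: that)
        then show ?thesis by (simp add: algebra_simps)
      qed
      ultimately show ?thesis by blast
    qed
    moreover have "4 ^ Suc M = 4 * (4 ^ M :: real)" by simp
    ultimately show ?thesis unfolding b_def
      by (simp add: divide_simps del: binomial_Suc_Suc mult_Suc_right power_Suc) (simp add: algebra_simps del: binomial_Suc_Suc mult_Suc_right power_Suc)
  qed
  have prod: "b M ^ 2 * (2 * real M + 1) = inverse (\<Prod>k=1..M. (4*real k^2) / (4*real k^2 - 1))" for M
  proof (induction M)
    case 0
    then show ?case by (simp add: b_def)
  next
    case (Suc M)
    have "4 * real (Suc M) ^ 2 - 1 = (2 * real M + 1) * (2 * real M + 3)" "4 * real (Suc M) ^ 2 = (2 * real M + 2) ^ 2"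
      by (simp_all add: power2_eq_square algebra_simps)
    moreover have "b (Suc M) ^ 2 * (2 * real (Suc M) + 1) = b M ^ 2 * (2 * real M + 1) *
        (((2 * real M + 1) * (2 * real M + 3)) / (2 * real M + 2) ^ 2)"
      unfolding bSuc by (simp add: power_divide power_mult_distrib) (simp add: power2_eq_square algebra_simps)
    ultimately show ?case using Suc by (simp add: prod.nat_ivl_Suc' divide_simps)
  qed
  have "(\<lambda>M. b M ^ 2 * (2 * real M + 1)) \<longlonglongrightarrow> inverse (pi / 2)"
    unfolding prod by (intro tendsto_inverse wallis) simp
  then have "(\<lambda>M. b M ^ 2 * (2 * real M + 1) * (real M / (2 * real M + 1))) \<longlonglongrightarrow> inverse (pi / 2) * (1 / 2)"
    by (rule tendsto_mult) real_asymp
  moreover have "(\<lambda>M. b M ^ 2 * (2 * real M + 1) * (real M / (2 * real M + 1))) = (\<lambda>M. b M ^ 2 * real M)"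
  proof
    fix M :: nat
    have "2 * real M + 1 \<noteq> 0" using of_nat_0_le_iff[of M] by linarith
    then show "b M ^ 2 * (2 * real M + 1) * (real M / (2 * real M + 1)) = b M ^ 2 * real M" by simp
  qed
  moreover have "inverse (pi / 2) * (1 / 2) = 1 / pi" by simp
  ultimately have "(\<lambda>M. b M ^ 2 * real M) \<longlonglongrightarrow> 1 / pi" by (simp only:)
  then have "(\<lambda>M. sqrt (b M ^ 2 * real M)) \<longlonglongrightarrow> sqrt (1 / pi)"
    by (rule tendsto_real_sqrt)
  then show ?thesis by (simp add: real_sqrt_mult b_def real_sqrt_divide)
qed

text \<open>The function exp (x^2 / 2) cos x decreases on [0, pi/2] because x cos x <= sin x there.
  The bound serves as the Gaussian majorant in \<open>theta_transform_real\<close> and again on the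
  minor arc.\<close>

lemma cos_le_exp:
  assumes "0 \<le> x" "x \<le> pi / 2"
  shows "cos x \<le> exp (- (x ^ 2 / 2))"
proof -
  have h: "x * cos x \<le> sin x" if "0 \<le> x" "x \<le> pi / 2" for x
  proof -
    have "(\<lambda>x. sin x - x * cos x) 0 \<le> (\<lambda>x. sin x - x * cos x) x"
    proof (rule DERIV_nonneg_imp_nondecreasing[OF that(1)])
      fix y assume y: "0 \<le> y" "y \<le> x"
      have "((\<lambda>x. sin x - x * cos x) has_real_derivative y * sin y) (at y)"
        by (auto intro!: derivative_eq_intros simp: algebra_simps)
      moreover have "y * sin y \<ge> 0" using y that pi_gt_zero by (intro mult_nonneg_nonneg sin_ge_zero) linarith+
      ultimately show "\<exists>z. ((\<lambda>x. sin x - x * cos x) has_real_derivative z) (at y) \<and> 0 \<le> z" by blast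
    qed
    then show ?thesis by simp
  qed
  have "(\<lambda>x. exp (x ^ 2 / 2) * cos x) x \<le> (\<lambda>x. exp (x ^ 2 / 2) * cos x) 0"
  proof (rule DERIV_nonpos_imp_nonincreasing[OF assms(1)])
    fix y assume y: "0 \<le> y" "y \<le> x"
    have "((\<lambda>x. exp (x ^ 2 / 2) * cos x) has_real_derivative exp (y ^ 2 / 2) * (y * cos y - sin y)) (at y)"
      by (auto intro!: derivative_eq_intros simp: algebra_simps)
    moreover have "exp (y ^ 2 / 2) * (y * cos y - sin y) \<le> 0"
      using h[of y] y assms by (intro mult_nonneg_nonpos) auto
    ultimately show "\<exists>z. ((\<lambda>x. exp (x ^ 2 / 2) * cos x) has_real_derivative z) (at y) \<and> z \<le> 0" by blast
  qed
  then show ?thesis by (simp add: exp_minus field_simps)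
qed

section \<open>The transformation formula on the positive real axis\<close>

lemma summable_exp_quadratic:
  fixes a :: "nat \<Rightarrow> real"
  assumes "c > 0" "\<And>n. a n \<ge> real n"
  shows "summable (\<lambda>n. exp (- (c * a n)))"
proof (rule summable_comparison_test'[of "\<lambda>n. exp (- c) ^ n" 0])
  show "summable (\<lambda>n. exp (- c) ^ n)" using assms by simp
  fix n :: nat
  have "exp (- (c * a n)) \<le> exp (- (c * real n))" using assms by simp
  also have "\<dots> = exp (- c) ^ n" by (simp add: exp_of_nat_mult[symmetric] mult.commute)
  finally show "norm (exp (- (c * a n))) \<le> exp (- c) ^ n" by simp
qed

text \<open>The limit of \<open>polya_identity\<close>, divided by 4^M, as L tends to infinity with
  M of size L^2 / t. The powers of cosines on the left and the binomial quotients on the right both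
  become Gaussians, and Tannery's theorem exchanges limit and sum on either side.\<close>

lemma theta_transform_real:
  fixes t :: real
  assumes t: "t > 0"
  shows "sqrt t * (1 + 2 * (\<Sum>j. (-1) ^ Suc j * exp (- (t * real (Suc j) ^ 2)))) =
    2 * sqrt pi * (\<Sum>k. exp (- (pi ^ 2 * (real k + 1/2) ^ 2 / t)))"
proof -
  define L where "L n = 2 * n" for n :: nat
  \<comment> \<open>At this scale both M x^2, for x a fixed multiple of 1 / L, and (j L)^2 / M
    converge.\<close>
  define M where "M n = nat \<lceil>real (L n) ^ 2 / t\<rceil>" for n :: nat
  have M_lower: "real (L n) ^ 2 / t \<le> real (M n)" for n
    unfolding M_def by (simp add: real_nat_ceiling_ge)
  have M_upper: "real (M n) \<le> real (L n) ^ 2 / t + 1" for n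
  proof -
    have "0 \<le> real (L n) ^ 2 / t" using t by simp
    then have "0 \<le> \<lceil>real (L n) ^ 2 / t\<rceil>" by (simp add: ceiling_le_zero le_ceiling_iff)
    show ?thesis unfolding M_def of_nat_nat[OF \<open>0 \<le> \<lceil>real (L n) ^ 2 / t\<rceil>\<close>] by linarith
  qed
  have L_inf: "filterlim (\<lambda>n. real (L n)) at_top sequentially"
    unfolding L_def by real_asymp
  have L_inv: "(\<lambda>n. c / real (L n)) \<longlonglongrightarrow> 0" for c :: real
    unfolding L_def by real_asymp
  have Lpos: "\<forall>\<^sub>F n in sequentially. L n > 0"
    unfolding L_def using eventually_gt_at_top[of 0] by eventually_elim simp
  have ratio: "(\<lambda>n. real (M n) / real (L n) ^ 2) \<longlonglongrightarrow> 1 / t"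
  proof (rule tendsto_sandwich[where f = "\<lambda>_. 1 / t" and h = "\<lambda>n. 1 / t + 1 / real (L n) ^ 2"])
    show "\<forall>\<^sub>F n in sequentially. 1 / t \<le> real (M n) / real (L n) ^ 2"
      using Lpos by eventually_elim (use M_lower t in \<open>simp add: field_simps\<close>)
    show "\<forall>\<^sub>F n in sequentially. real (M n) / real (L n) ^ 2 \<le> 1 / t + 1 / real (L n) ^ 2"
      using Lpos
    proof eventually_elim
      case (elim n)
      have "real (M n) / real (L n) ^ 2 \<le> (real (L n) ^ 2 / t + 1) / real (L n) ^ 2"
        by (intro divide_right_mono M_upper) simp
      also have "\<dots> = 1 / t + 1 / real (L n) ^ 2" using elim t by (simp add: field_simps)
      finally show ?case .
    qed
    show "(\<lambda>n. 1 / t + 1 / real (L n) ^ 2) \<longlonglongrightarrow> 1 / t"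
      unfolding L_def by real_asymp
  qed auto
  have M_inf: "filterlim M at_top sequentially"
  proof -
    have "filterlim (\<lambda>n. real (L n) ^ 2 / t) at_top sequentially"
      unfolding L_def using t by real_asymp
    then have "filterlim (\<lambda>n. real (M n)) at_top sequentially"
      by (rule filterlim_at_top_mono) (use M_lower in auto)
    then show ?thesis using filterlim_sequentially_iff_filterlim_real by blast
  qed
  define E where "E k = exp (- (pi ^ 2 * (real k + 1/2) ^ 2 / t))" for k :: nat
  define x where "x n k = pi * (real k + 1/2) / real (L n)" for n k :: nat
  define A where "A k n = (if k < n then cos (x n k) ^ (2 * M n) else 0)" for k n :: nat
  have sE: "summable E"
  proof -
    have "real k \<le> (real k + 1/2) ^ 2" for k
      by (simp add: power2_eq_square algebra_simps)
    from summable_exp_quadratic[OF _ this, of "pi ^ 2 / t"] t show ?thesis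
      by (simp add: E_def[abs_def])
  qed
  have limA: "(\<lambda>n. \<Sum>k. A k n) \<longlonglongrightarrow> suminf E"
  proof (rule tannerys_theorem[THEN conjunct2, THEN conjunct2])
    fix k :: nat
    \<comment> \<open>cos x ^ (2 M) is exp (2 M x^2 * (ln (cos x) / x^2)); the last quotient tends
      to -1/2 and M x^2 converges.\<close>
    have lncos: "((\<lambda>y::real. ln (cos y) / y ^ 2) \<longlongrightarrow> - 1/2) (at_right 0)" by real_asymp
    have x0: "filterlim (\<lambda>n. x n k) (at_right 0) sequentially"
      unfolding x_def L_def by real_asymp
    have lim_x: "(\<lambda>n. ln (cos (x n k)) / x n k ^ 2) \<longlonglongrightarrow> - 1/2"
      using filterlim_compose[OF lncos x0] .
    then have "(\<lambda>n. 2 * (pi * (real k + 1/2)) ^ 2 * (real (M n) / real (L n) ^ 2) * (ln (cos (x n k)) / x n k ^ 2))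
        \<longlonglongrightarrow> 2 * (pi * (real k + 1/2)) ^ 2 * (1 / t) * (- 1/2)"
      by (intro tendsto_mult tendsto_const ratio lim_x)
    then have "(\<lambda>n. exp (2 * (pi * (real k + 1/2)) ^ 2 * (real (M n) / real (L n) ^ 2) * (ln (cos (x n k)) / x n k ^ 2)))
        \<longlonglongrightarrow> exp (2 * (pi * (real k + 1/2)) ^ 2 * (1 / t) * (- 1/2))"
      by (rule tendsto_exp)
    also have "2 * (pi * (real k + 1/2)) ^ 2 * (1 / t) * (- 1/2) = - (pi ^ 2 * (real k + 1/2) ^ 2 / t)"
      by (simp add: power_mult_distrib)
    finally show "(\<lambda>n. A k n) \<longlonglongrightarrow> E k"
      unfolding E_def
    proof (rule Lim_transform_eventually)
      have "\<forall>\<^sub>F n in sequentially. x n k \<in> {0<..<1}"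
        using x0 unfolding filterlim_at by (auto dest!: order_tendstoD(2)[of _ 0 _ 1] elim: eventually_elim2)
      then show "\<forall>\<^sub>F n in sequentially. exp (2 * (pi * (real k + 1/2)) ^ 2 * (real (M n) / real (L n) ^ 2) * (ln (cos (x n k)) / x n k ^ 2)) = A k n"
        using eventually_gt_at_top[of k] Lpos
      proof eventually_elim
        case (elim n)
        have c: "cos (x n k) > 0" using elim pi_gt3 by (intro cos_gt_zero) auto
        have "(pi * (real k + 1/2)) ^ 2 / real (L n) ^ 2 = x n k ^ 2" by (simp add: x_def power_divide)
        then have "2 * (pi * (real k + 1/2)) ^ 2 * (real (M n) / real (L n) ^ 2) * (ln (cos (x n k)) / x n k ^ 2)
           = 2 * real (M n) * (x n k ^ 2 * (ln (cos (x n k)) / x n k ^ 2))"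
          by (simp only: divide_inverse mult_ac)
        also have "\<dots> = real (2 * M n) * ln (cos (x n k))" using elim by simp
        also have "exp \<dots> = cos (x n k) ^ (2 * M n)" using c by (simp only: exp_of_nat_mult exp_ln)
        finally show ?case using elim by (simp add: A_def)
      qed
    qed
  next
    show "\<forall>\<^sub>F (k, n) in sequentially \<times>\<^sub>F sequentially. norm (A k n) \<le> E k"
    proof (intro always_eventually allI, clarify)
      fix k n
      show "norm (A k n) \<le> E k"
      proof (cases "k < n")
        case True
        then have Ln: "L n > 0" by (simp add: L_def)
        have xr: "0 \<le> x n k" "x n k \<le> pi / 2"
        proof -
          have "real k + 1/2 \<le> real n" using True by simp
          then have "x n k \<le> pi * real n / real (L n)"
            unfolding x_def by (intro divide_right_mono mult_left_mono) auto
          then show "x n k \<le> pi / 2" using Ln by (simp add: L_def)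
        qed (simp add: x_def)
        then have c: "0 \<le> cos (x n k)" by (intro cos_ge_zero) auto
        have "cos (x n k) ^ (2 * M n) \<le> exp (- (x n k ^ 2 / 2)) ^ (2 * M n)"
          using c cos_le_exp[OF xr] by (rule power_mono[rotated])
        also have "\<dots> = exp (- (x n k ^ 2 * real (M n)))" by (simp add: exp_of_nat_mult[symmetric])
        also have "\<dots> \<le> exp (- (x n k ^ 2 * (real (L n) ^ 2 / t)))"
          by (intro iffD2[OF exp_le_cancel_iff] iffD2[OF neg_le_iff_le] mult_left_mono M_lower) simp
        also have "x n k ^ 2 * (real (L n) ^ 2 / t) = pi ^ 2 * (real k + 1/2) ^ 2 / t"
          using Ln by (simp add: x_def power_divide power_mult_distrib)
        finally show ?thesis using True c by (simp add: A_def E_def)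
      qed (simp add: A_def E_def)
    qed
  qed (use sE in auto)
  define B where "B j n = (-1) ^ Suc j * (real (2 * M n choose (M n + Suc j * L n)) / real (2 * M n choose M n))" for j n :: nat
  define G where "G j = (-1) ^ Suc j * exp (- (t * real (Suc j) ^ 2))" for j :: nat
  have cb: "real (2 * m choose m) > 0" for m :: nat by simp
  have limB: "(\<lambda>n. \<Sum>j. B j n) \<longlonglongrightarrow> suminf G"
  proof (rule tannerys_theorem[THEN conjunct2, THEN conjunct2])
    fix j :: nat
    let ?r = "\<lambda>n. Suc j * L n"
    have lims: "(\<lambda>n. exp (- (real (Suc j) ^ 2 / (real (M n) / real (L n) ^ 2 + c * real (Suc j) / real (L n)))))
        \<longlonglongrightarrow> exp (- (t * real (Suc j) ^ 2))" for c :: real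
    proof -
      have "(\<lambda>n. exp (- (real (Suc j) ^ 2 / (real (M n) / real (L n) ^ 2 + c * real (Suc j) / real (L n)))))
        \<longlonglongrightarrow> exp (- (real (Suc j) ^ 2 / (1 / t + 0)))"
        using t by (intro tendsto_intros ratio L_inv) auto
      then show ?thesis by (simp add: mult.commute)
    qed
    have ev: "\<forall>\<^sub>F n in sequentially. ?r n < M n"
    proof -
      have lim: "(\<lambda>n. real (M n) / real (L n) ^ 2 - real (Suc j) / real (L n)) \<longlonglongrightarrow> 1 / t - 0"
        by (intro tendsto_diff ratio L_inv)
      have "\<forall>\<^sub>F n in sequentially. 0 < real (M n) / real (L n) ^ 2 - real (Suc j) / real (L n)"
        by (rule order_tendstoD(1)[OF lim]) (use t in simp)
      then show ?thesis using Lpos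
      proof eventually_elim
        case (elim n)
        then have "real (Suc j) * real (L n) < real (M n)"
          by (simp add: field_simps power2_eq_square)
        then show ?case by (simp only: of_nat_mult[symmetric] of_nat_less_iff)
      qed
    qed
    have "(\<lambda>n. real (2 * M n choose (M n + ?r n)) / real (2 * M n choose M n)) \<longlonglongrightarrow> exp (- (t * real (Suc j) ^ 2))"
    proof (rule tendsto_sandwich[OF _ _ lims[of "-1"] lims[of 1]])
      have eq: "real (Suc j) ^ 2 / (real (M n) / real (L n) ^ 2 + c * real (Suc j) / real (L n)) =
          real (?r n) ^ 2 / (real (M n) + c * real (?r n))" if "L n > 0" for n c
      proof -
        have "real (M n) + c * real (?r n) = (real (M n) / real (L n) ^ 2 + c * real (Suc j) / real (L n)) * real (L n) ^ 2"
          using that by (simp add: field_simps power2_eq_square)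
        then show ?thesis using that by (simp only: of_nat_mult power_mult_distrib) simp
      qed
      show "\<forall>\<^sub>F n in sequentially. exp (- (real (Suc j) ^ 2 / (real (M n) / real (L n) ^ 2 + (-1) * real (Suc j) / real (L n))))
          \<le> real (2 * M n choose (M n + ?r n)) / real (2 * M n choose M n)"
        using ev Lpos
      proof eventually_elim
        case (elim n)
        have m: "real (M n) + (-1) * real (?r n) = real (M n - ?r n)"
          using elim(1) by (simp only: of_nat_diff less_imp_le)
        show ?case unfolding eq[OF elim(2)] m pos_le_divide_eq[OF cb]
          using central_binomial_ratio_lower[OF order_refl elim(1)] by (simp only: mult.commute)
      qed
      show "\<forall>\<^sub>F n in sequentially. real (2 * M n choose (M n + ?r n)) / real (2 * M n choose M n)
          \<le> exp (- (real (Suc j) ^ 2 / (real (M n) / real (L n) ^ 2 + 1 * real (Suc j) / real (L n))))"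
        using ev Lpos
      proof eventually_elim
        case (elim n)
        have m: "real (M n) + 1 * real (?r n) = real (M n + ?r n)" by simp
        show ?case unfolding eq[OF elim(2)] m pos_divide_le_eq[OF cb]
          using central_binomial_ratio_upper[OF order_refl less_imp_le[OF elim(1)]] by (simp only: mult.commute)
      qed
    qed
    then show "(\<lambda>n. B j n) \<longlonglongrightarrow> G j"
      unfolding B_def G_def by (intro tendsto_intros)
  next
    have "\<forall>\<^sub>F n in sequentially. real (L n) \<ge> sqrt t + 1"
      using L_inf by (auto simp: filterlim_at_top)
    then have "\<forall>\<^sub>F n in sequentially. \<forall>j. norm (B j n) \<le> exp (- (t / 4 * real (Suc j) ^ 2))"
    proof (eventually_elim, intro allI)
      fix n j assume "sqrt t + 1 \<le> real (L n)"
      moreover have "0 \<le> sqrt t" using t by simp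
      ultimately have sq: "sqrt t \<le> real (L n)" and "0 < real (L n)" by linarith+
      then have L1: "0 < L n" by simp
      have "sqrt t ^ 2 \<le> real (L n) ^ 2" using sq t by (intro power_mono) auto
      then have "1 \<le> real (L n) ^ 2 / t" using t by simp
      \<comment> \<open>If the index r = (j + 1) L is at most M, then M + r <= 2 M <= 4 L^2 / t,
        which is the origin of the constant t / 4 in the majorant. For r > M the binomial
        coefficient vanishes.\<close>
      then have M2: "real (M n) \<le> 2 * real (L n) ^ 2 / t" using M_upper[of n] by simp
      have M0: "0 < real (M n)" using M_lower[of n] \<open>1 \<le> real (L n) ^ 2 / t\<close> by linarith
      let ?r = "Suc j * L n"
      have nB: "norm (B j n) = real (2 * M n choose (M n + ?r)) / real (2 * M n choose M n)"
        by (simp only: B_def real_norm_def abs_mult power_abs abs_minus_cancel abs_one power_one mult_1_left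
              abs_divide abs_of_nat)
      show "norm (B j n) \<le> exp (- (t / 4 * real (Suc j) ^ 2))"
      proof (cases "?r \<le> M n")
        case True
        have "real (2 * M n choose (M n + ?r)) / real (2 * M n choose M n) \<le> exp (- (real ?r ^ 2 / real (M n + ?r)))"
          using central_binomial_ratio_upper[OF order_refl True] cb[of "M n"]
          by (simp add: pos_divide_le_eq mult.commute)
        also have "real ?r ^ 2 / real (M n + ?r) \<ge> real ?r ^ 2 / (4 * real (L n) ^ 2 / t)"
        proof (rule divide_left_mono)
          have "real ?r \<le> real (M n)" using True by (simp only: of_nat_le_iff)
          then show "real (M n + ?r) \<le> 4 * real (L n) ^ 2 / t" using M2 unfolding of_nat_add by linarith
        qed (use M0 L1 t in \<open>auto simp: add_pos_nonneg\<close>)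
        then have "exp (- (real ?r ^ 2 / real (M n + ?r))) \<le> exp (- (real ?r ^ 2 / (4 * real (L n) ^ 2 / t)))" by simp
        also have "real ?r ^ 2 / (4 * real (L n) ^ 2 / t) = t / 4 * real (Suc j) ^ 2"
          using L1 t by (simp only: of_nat_mult power_mult_distrib) (simp add: field_simps)
        finally show ?thesis unfolding nB .
      next
        case False
        then have "2 * M n choose (M n + ?r) = 0" by (intro binomial_eq_0) simp
        then show ?thesis unfolding nB by (simp only: of_nat_0 div_0 exp_ge_zero)
      qed
    qed
    then show "\<forall>\<^sub>F (j, n) in sequentially \<times>\<^sub>F sequentially. norm (B j n) \<le> exp (- (t / 4 * real (Suc j) ^ 2))"
      unfolding eventually_prod_filter
      by (intro exI[of _ "\<lambda>_. True"] exI[of _ "\<lambda>n. \<forall>j. norm (B j n) \<le> exp (- (t / 4 * real (Suc j) ^ 2))"] conjI)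
        simp_all
    show "summable (\<lambda>j. exp (- (t / 4 * real (Suc j) ^ 2)))"
      using t by (intro summable_exp_quadratic) (auto simp: power2_eq_square algebra_simps)
  qed auto
  have id: "2 * (\<Sum>k. A k n) = (real (2 * M n choose M n) / 4 ^ M n * sqrt (real (M n))) *
      sqrt (1 / (real (M n) / real (L n) ^ 2)) * (1 + 2 * (\<Sum>j. B j n))" if "n > 0" for n
  proof -
    have L0: "L n > 0" using that by (simp add: L_def)
    have "real (M n) > 0" using M_lower[of n] L0 t by (smt (verit) divide_pos_pos of_nat_0_less_iff zero_less_power)
    \<comment> \<open>The factor L of Polya's identity is split as sqrt M * sqrt (L^2 / M), so that
      the first part meets \<open>central_binomial_asymp\<close> and the second tends to sqrt
      t.\<close>
    then have Lsq: "sqrt (real (M n)) * sqrt (1 / (real (M n) / real (L n) ^ 2)) = real (L n)"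
      using L0 by (simp add: real_sqrt_mult[symmetric])
    have "(\<Sum>k. A k n) = (\<Sum>k<n. cos (x n k) ^ (2 * M n))"
      by (subst suminf_finite[of "{..<n}"]) (auto simp: A_def)
    then have "4 ^ M n * (2 * (\<Sum>k. A k n)) = 2 * (\<Sum>k<n. (2 * cos (x n k)) ^ (2 * M n))"
      by (simp add: power_mult_distrib power_mult sum_distrib_left mult.left_commute)
    also have "\<dots> = real (L n) * (real (2 * M n choose M n) + 2 * (\<Sum>j=1..M n. (-1) ^ j * real (2 * M n choose (M n + j * L n))))"
      unfolding x_def L_def by (rule polya_identity[OF that])
    also have "(\<Sum>j=1..M n. (-1) ^ j * real (2 * M n choose (M n + j * L n))) =
       (\<Sum>j<M n. (-1) ^ Suc j * real (2 * M n choose (M n + Suc j * L n)))"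
      by (simp only: sum.atLeast1_atMost_eq One_nat_def)
    also have "\<dots> = real (2 * M n choose M n) * (\<Sum>j<M n. B j n)"
      using cb[of "M n"] by (simp add: B_def sum_distrib_left)
    also have "(\<Sum>j<M n. B j n) = (\<Sum>j. B j n)"
    proof (rule suminf_finite[symmetric])
      fix j assume "j \<notin> {..<M n}"
      then have "M n < Suc j * 1" by simp
      also have "\<dots> \<le> Suc j * L n" using L0 by (intro mult_le_mono) auto
      finally have "2 * M n choose (M n + Suc j * L n) = 0" by (intro binomial_eq_0) simp
      then show "B j n = 0" by (simp add: B_def)
    qed simp
    finally have "4 ^ M n * (2 * (\<Sum>k. A k n)) = real (L n) * real (2 * M n choose M n) * (1 + 2 * (\<Sum>j. B j n))"
      by (simp add: algebra_simps)
    then have "2 * (\<Sum>k. A k n) = real (2 * M n choose M n) / 4 ^ M n * real (L n) * (1 + 2 * (\<Sum>j. B j n))"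
      by (simp add: field_simps)
    moreover have "real (2 * M n choose M n) / 4 ^ M n * sqrt (real (M n)) * sqrt (1 / (real (M n) / real (L n) ^ 2)) =
        real (2 * M n choose M n) / 4 ^ M n * real (L n)"
      by (simp only: mult.assoc Lsq)
    ultimately show ?thesis by (simp only:)
  qed
  have lim1: "(\<lambda>n. 2 * (\<Sum>k. A k n)) \<longlonglongrightarrow> 2 * suminf E" by (intro tendsto_intros limA)
  have lim2: "(\<lambda>n. (real (2 * M n choose M n) / 4 ^ M n * sqrt (real (M n))) *
      sqrt (1 / (real (M n) / real (L n) ^ 2)) * (1 + 2 * (\<Sum>j. B j n)))
      \<longlonglongrightarrow> 1 / sqrt pi * sqrt (1 / (1 / t)) * (1 + 2 * suminf G)"
    using t by (intro tendsto_intros limB ratio filterlim_compose[OF central_binomial_asymp M_inf]) auto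
  have ev: "\<forall>\<^sub>F n in sequentially. (real (2 * M n choose M n) / 4 ^ M n * sqrt (real (M n))) *
      sqrt (1 / (real (M n) / real (L n) ^ 2)) * (1 + 2 * (\<Sum>j. B j n)) = 2 * (\<Sum>k. A k n)"
    using eventually_gt_at_top[of 0] by eventually_elim (rule id[symmetric])
  have "2 * suminf E = 1 / sqrt pi * sqrt (1 / (1 / t)) * (1 + 2 * suminf G)"
    by (rule LIMSEQ_unique[OF lim1 Lim_transform_eventually[OF lim2 ev]])
  then show ?thesis unfolding E_def[abs_def] G_def[abs_def] by (simp add: field_simps)
qed

section \<open>Analytic continuation to the right half-plane\<close>

lemma holomorphic_exp_series:
  fixes a :: "nat \<Rightarrow> real" and c :: "nat \<Rightarrow> complex"
  assumes a: "\<And>n. a n \<ge> real n" and c: "\<And>n. norm (c n) \<le> 1"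
  shows "(\<lambda>t. \<Sum>n. c n * exp (- (t * of_real (a n)))) holomorphic_on {t. Re t > 0}"
proof (rule holomorphic_uniform_sequence)
  show "open {t. Re t > 0}" by (rule open_halfspace_Re_gt)
  show "(\<lambda>t. \<Sum>n<N. c n * exp (- (t * of_real (a n)))) holomorphic_on {t. Re t > 0}" for N
    by (intro holomorphic_intros)
  fix x :: complex assume "x \<in> {t. Re t > 0}"
  then have x: "Re x > 0" by simp
  define d where "d = Re x / 2"
  have d: "d > 0" using x by (simp add: d_def)
  have Re: "Re t \<ge> d" if "t \<in> cball x d" for t
    using that abs_Re_le_cmod[of "x - t"] by (simp add: d_def dist_norm abs_if split: if_splits)
  have "uniform_limit (cball x d) (\<lambda>N t. \<Sum>n<N. c n * exp (- (t * of_real (a n))))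
      (\<lambda>t. \<Sum>n. c n * exp (- (t * of_real (a n)))) sequentially"
  proof (rule Weierstrass_m_test)
    show "summable (\<lambda>n. exp (- (d * a n)))" by (rule summable_exp_quadratic[OF d a])
    fix n t assume t: "t \<in> cball x d"
    have "0 \<le> a n" using a[of n] of_nat_0_le_iff[of n] by linarith
    then have "norm (exp (- (t * of_real (a n)))) \<le> exp (- (d * a n))"
      using Re[OF t] by (simp add: mult_right_mono)
    then show "norm (c n * exp (- (t * of_real (a n)))) \<le> exp (- (d * a n))"
      using mult_mono[OF c[of n]] by (simp add: norm_mult)
  qed
  moreover have "cball x d \<subseteq> {t. Re t > 0}" using Re d by force
  ultimately show "\<exists>d>0. cball x d \<subseteq> {t. Re t > 0} \<and> uniform_limit (cball x d)
      (\<lambda>N t. \<Sum>n<N. c n * exp (- (t * of_real (a n)))) (\<lambda>t. \<Sum>n. c n * exp (- (t * of_real (a n)))) sequentially"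
    using d by blast
qed

text \<open>Jacobi's theta_2 at nome e^(-s) without its leading factor 2 e^(-s/4), since k^2 + k =
  (k + 1/2)^2 - 1/4.\<close>

definition theta2 :: "complex \<Rightarrow> complex" where
  "theta2 s = (\<Sum>k. exp (- (s * of_real (real k ^ 2 + real k))))"

lemma holomorphic_theta2: "theta2 holomorphic_on {s. Re s > 0}"
  unfolding theta2_def using holomorphic_exp_series[of "\<lambda>k. real k ^ 2 + real k" "\<lambda>_. 1"] by simp

text \<open>Jacobi's imaginary transformation; the factor \<open>exp (- \<pi>\<^sup>2 / (4 t))\<close> has been split off the
  right-hand theta series, so that \<open>theta2\<close> is close to 1.\<close>

lemma theta4_transform:
  fixes t :: complex
  assumes t: "Re t > 0"
  shows "csqrt t * theta4 (exp (- t)) = 2 * sqrt pi * exp (- (pi ^ 2 / (4 * t))) * theta2 (pi ^ 2 / t)"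
proof -
  define S :: "complex set" where "S = {t. Re t > 0}"
  have S: "open S" "connected S"
    unfolding S_def by (simp_all add: open_halfspace_Re_gt convex_connected convex_halfspace_Re_gt)
  have nz: "t \<noteq> 0" if "t \<in> S" for t using that by (auto simp: S_def)
  have theta4: "theta4 (exp (- t)) = 1 + 2 * (\<Sum>j. (-1) ^ Suc j * exp (- (t * of_real (real (Suc j) ^ 2))))" for t :: complex
  proof -
    have "exp (- t) ^ (Suc j ^ 2) = exp (- (t * of_real (real (Suc j) ^ 2)))" for j
      by (subst exp_of_nat_mult[symmetric]) (simp add: mult.commute)
    then show ?thesis unfolding theta4_def by (simp only:)
  qed
  have hol4: "(\<lambda>t. theta4 (exp (- t))) holomorphic_on S"
  proof -
    have "(\<lambda>t. \<Sum>j. (-1) ^ Suc j * exp (- (t * complex_of_real (real (Suc j) ^ 2)))) holomorphic_on S"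
      unfolding S_def
      by (rule holomorphic_exp_series) (auto simp: power2_eq_square norm_power simp flip: of_nat_Suc of_nat_mult)
    then show ?thesis unfolding theta4 by (intro holomorphic_intros)
  qed
  have inS: "pi ^ 2 / t \<in> S" if "t \<in> S" for t :: complex
    using that by (auto simp: S_def Re_divide zero_less_mult_iff intro!: divide_pos_pos add_pos_nonneg simp flip: of_real_power)
  have hol2: "(\<lambda>t. theta2 (pi ^ 2 / t)) holomorphic_on S"
  proof -
    have "(theta2 \<circ> (\<lambda>t. pi ^ 2 / t)) holomorphic_on S"
    proof (rule holomorphic_on_compose_gen)
      show "(\<lambda>t. pi ^ 2 / t) holomorphic_on S" using nz by (intro holomorphic_intros) auto
      show "theta2 holomorphic_on S" unfolding S_def by (rule holomorphic_theta2)
    qed (use inS in auto)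
    then show ?thesis by (simp add: o_def)
  qed
  define f where "f t = csqrt t * theta4 (exp (- t)) - 2 * sqrt pi * exp (- (pi ^ 2 / (4 * t))) * theta2 (pi ^ 2 / t)" for t :: complex
  \<comment> \<open>The difference of both sides is holomorphic on the half-plane and vanishes on
    the positive reals, which accumulate at 1.\<close>
  have "f t = 0"
  proof (rule analytic_continuation[of f S "complex_of_real ` {0<..}" 1 t])
    have "z \<notin> \<real>\<^sub>\<le>\<^sub>0" if "z \<in> S" for z using that by (auto simp: S_def complex_nonpos_Reals_iff)
    then show "f holomorphic_on S"
      unfolding f_def using nz by (intro holomorphic_intros hol4 hol2) auto
    show "complex_of_real ` {0<..} \<subseteq> S" by (auto simp: S_def)
    show "(1::complex) \<in> S" "t \<in> S" using t by (auto simp: S_def)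
    show "(1::complex) islimpt complex_of_real ` {0<..}"
    proof (rule islimpt_sequential[THEN iffD2], intro exI conjI)
      show "\<forall>n. complex_of_real (1 + 1 / real (Suc n)) \<in> complex_of_real ` {0<..} - {1}"
        by (auto simp: add_pos_nonneg simp del: of_real_add)
      have "(\<lambda>n. complex_of_real (1 + 1 / real (Suc n))) \<longlonglongrightarrow> complex_of_real 1"
        by (intro tendsto_of_real) real_asymp
      then show "(\<lambda>n. complex_of_real (1 + 1 / real (Suc n))) \<longlonglongrightarrow> 1"
        by (simp only: of_real_1)
    qed
    fix z assume "z \<in> complex_of_real ` {0<..}"
    then obtain x where x: "z = of_real x" "x > 0" by auto
    have s1: "summable (\<lambda>j. (-1) ^ Suc j * exp (- (x * real (Suc j) ^ 2)))"
      by (rule summable_norm_cancel, rule summable_comparison_test'[OF summable_exp_quadratic[OF x(2), of "\<lambda>j. real (Suc j) ^ 2"], of 0])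
         (auto simp: abs_mult power_abs power2_eq_square algebra_simps)
    have s2: "summable (\<lambda>k. exp (- (pi ^ 2 / x * (real k ^ 2 + real k))))"
      using x by (intro summable_exp_quadratic) auto
    have "theta4 (exp (- z)) = of_real (1 + 2 * (\<Sum>j. (-1) ^ Suc j * exp (- (x * real (Suc j) ^ 2))))"
    proof -
      have "(-1) ^ Suc j * exp (- (z * of_real (real (Suc j) ^ 2))) = complex_of_real ((-1) ^ Suc j * exp (- (x * real (Suc j) ^ 2)))" for j
        unfolding x by (simp flip: exp_of_real)
      then show ?thesis unfolding theta4 using suminf_of_real[OF s1, where 'a = complex] by simp
    qed
    moreover have "theta2 (pi ^ 2 / z) = of_real (\<Sum>k. exp (- (pi ^ 2 / x * (real k ^ 2 + real k))))"
    proof -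
      have "exp (- (pi ^ 2 / z * of_real (real k ^ 2 + real k))) = complex_of_real (exp (- (pi ^ 2 / x * (real k ^ 2 + real k))))" for k
        unfolding x by (simp flip: exp_of_real)
      then show ?thesis unfolding theta2_def using suminf_of_real[OF s2, where 'a = complex] by simp
    qed
    moreover have "exp (- (pi ^ 2 / (4 * z))) = complex_of_real (exp (- (pi ^ 2 / (4 * x))))"
      unfolding x by (simp flip: exp_of_real)
    moreover have "csqrt z = of_real (sqrt x)" using x by simp
    ultimately have "f z = of_real (sqrt x * (1 + 2 * (\<Sum>j. (-1) ^ Suc j * exp (- (x * real (Suc j) ^ 2)))) -
        2 * sqrt pi * (exp (- (pi ^ 2 / (4 * x))) * (\<Sum>k. exp (- (pi ^ 2 / x * (real k ^ 2 + real k))))))"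
      unfolding f_def by (simp only:) simp
    also have "exp (- (pi ^ 2 / (4 * x))) * (\<Sum>k. exp (- (pi ^ 2 / x * (real k ^ 2 + real k)))) =
       (\<Sum>k. exp (- (pi ^ 2 * (real k + 1/2) ^ 2 / x)))"
    proof -
      have "exp (- (pi ^ 2 / (4 * x))) * exp (- (pi ^ 2 / x * (real k ^ 2 + real k))) = exp (- (pi ^ 2 * (real k + 1/2) ^ 2 / x))" for k
        unfolding exp_add[symmetric] using x(2) by (intro arg_cong[of _ _ exp]) (simp add: field_simps power2_eq_square)
      then show ?thesis by (subst suminf_mult[OF s2, symmetric]) simp
    qed
    finally show "f z = 0"
      using theta_transform_real[OF x(2)] by (simp only: diff_self of_real_0)
  qed (use S in auto)
  then show ?thesis by (simp add: f_def)
qed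

section \<open>The generating function near q = 1\<close>

lemma theta2_real:
  assumes "s > 0"
  shows "\<exists>u\<ge>1. theta2 (of_real s) = of_real u"
proof -
  have s: "summable (\<lambda>k. exp (- (s * (real k ^ 2 + real k))))"
    using assms by (intro summable_exp_quadratic) auto
  have "theta2 (of_real s) = of_real (\<Sum>k. exp (- (s * (real k ^ 2 + real k))))"
  proof -
    have "exp (- (of_real s * of_real (real k ^ 2 + real k))) = complex_of_real (exp (- (s * (real k ^ 2 + real k))))" for k
      by (simp flip: exp_of_real)
    then show ?thesis unfolding theta2_def using suminf_of_real[OF s, where 'a = complex] by simp
  qed
  moreover have "1 \<le> (\<Sum>k. exp (- (s * (real k ^ 2 + real k))))"
    using sum_le_suminf[OF s, of "{0}"] by simp
  ultimately show ?thesis by blast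
qed

text \<open>For k >= 1 the exponent satisfies k^2 + k >= 2 k, so with d = exp (-2 Re s) the tail is
  at most d / (1 - d), and d <= 1/2 gives the factor 2.\<close>

lemma norm_theta2_minus_1_le:
  fixes s :: complex
  assumes "exp (- 2 * Re s) \<le> 1 / 2"
  shows "norm (theta2 s - 1) \<le> 2 * exp (- 2 * Re s)"
proof -
  define d where "d = exp (- 2 * Re s)"
  have d: "0 < d" "d \<le> 1/2" using assms by (auto simp: d_def)
  have Re: "Re s > 0"
  proof (rule ccontr)
    assume "\<not> Re s > 0"
    then have "exp 0 \<le> exp (- 2 * Re s)" by (intro iffD2[OF exp_le_cancel_iff]) simp
    with assms show False unfolding exp_zero by linarith
  qed
  have b: "norm (exp (- (s * of_real (real (Suc k) ^ 2 + real (Suc k))))) \<le> d * d ^ k" for k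
  proof -
    have "2 * (real k + 1) \<le> real (Suc k) ^ 2 + real (Suc k)" by (simp add: power2_eq_square algebra_simps)
    then have "Re s * (2 * (real k + 1)) \<le> Re s * (real (Suc k) ^ 2 + real (Suc k))"
      using Re by (intro mult_left_mono) auto
    moreover have "d * d ^ k = exp (- (Re s * (2 * (real k + 1))))"
      unfolding d_def by (subst exp_of_nat_mult[symmetric]) (simp add: exp_add[symmetric] algebra_simps)
    ultimately show ?thesis by simp
  qed
  have geo: "(\<lambda>k. d * d ^ k) sums (d * (1 / (1 - d)))"
    using d by (intro sums_mult geometric_sums) auto
  then have sg: "summable (\<lambda>k. d * d ^ k)" by (rule sums_summable)
  have s1: "summable (\<lambda>k. norm (exp (- (s * of_real (real (Suc k) ^ 2 + real (Suc k))))))"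
    by (rule summable_comparison_test'[OF sg, of 0]) (use b in simp)
  have "theta2 s = 1 + (\<Sum>k. exp (- (s * of_real (real (Suc k) ^ 2 + real (Suc k)))))"
  proof -
    have "summable (\<lambda>k. exp (- (s * of_real (real k ^ 2 + real k))))"
      by (subst summable_Suc_iff[symmetric]) (rule summable_norm_cancel[OF s1])
    from suminf_split_head[OF this] show ?thesis by (simp add: theta2_def)
  qed
  then have "norm (theta2 s - 1) \<le> (\<Sum>k. norm (exp (- (s * of_real (real (Suc k) ^ 2 + real (Suc k))))))"
    using summable_norm[OF s1] by simp
  also have "\<dots> \<le> (\<Sum>k. d * d ^ k)" by (rule suminf_le[OF b s1 sg])
  also have "\<dots> = d * (1 / (1 - d))" using geo by (simp add: sums_iff)
  also have "\<dots> \<le> d * 2" using d by (intro mult_left_mono) (auto simp: field_simps)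
  finally show ?thesis by (simp add: d_def)
qed

text \<open>What the transformation formula gives for \<open>op_gf (exp (- t))\<close> when the
  factor \<open>theta2\<close> is replaced by 1.\<close>

definition op_main :: "complex \<Rightarrow> complex" where
  "op_main t = csqrt t * exp (of_real pi ^ 2 / (4 * t)) / (2 * of_real (sqrt pi))"

lemma op_gf_eq_main:
  fixes t :: complex
  assumes "Re t > 0"
  shows "op_gf (exp (- t)) * theta2 (pi ^ 2 / t) = op_main t"
proof -
  have "norm (exp (- t)) < 1" using assms by simp
  then have gf: "op_gf (exp (- t)) * theta4 (exp (- t)) = 1" by (rule op_gf_mult_theta4)
  have "op_gf (exp (- t)) * theta2 (pi ^ 2 / t) * (2 * sqrt pi) =
      op_gf (exp (- t)) * (2 * sqrt pi * exp (- (pi ^ 2 / (4 * t))) * theta2 (pi ^ 2 / t)) * exp (pi ^ 2 / (4 * t))"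
    by (simp add: exp_minus)
  also have "\<dots> = csqrt t * exp (pi ^ 2 / (4 * t)) * (op_gf (exp (- t)) * theta4 (exp (- t)))"
    unfolding theta4_transform[OF assms, symmetric] by simp
  finally show ?thesis unfolding gf op_main_def by (simp add: field_simps)
qed

text \<open>On the positive axis \<open>theta2\<close> is at least 1, so dropping it from
  \<open>op_gf_eq_main\<close> can only enlarge the bound.\<close>

lemma op_gf_real_le:
  assumes "r > 0"
  shows "op_gf (exp (- r)) \<le> sqrt r * exp (pi ^ 2 / (4 * r)) / (2 * sqrt pi)"
proof -
  have "pi ^ 2 / r > 0" using assms by simp
  from theta2_real[OF this] obtain u where u: "u \<ge> 1" "theta2 (of_real (pi ^ 2 / r)) = of_real u" by blast
  have sm: "summable (\<lambda>n. real (overpartition_count n) * exp (- r) ^ n)"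
    using assms by (intro summable_overpartition_real) auto
  have "op_gf (exp (- complex_of_real r)) = of_real (op_gf (exp (- r)))"
    unfolding op_gf_def using suminf_of_real[OF sm, where 'a = complex]
    by (simp flip: exp_of_real)
  moreover have "op_main (of_real r) = of_real (sqrt r * exp (pi ^ 2 / (4 * r)) / (2 * sqrt pi))"
    unfolding op_main_def using assms by (simp flip: exp_of_real)
  ultimately have "complex_of_real (op_gf (exp (- r)) * u) = of_real (sqrt r * exp (pi ^ 2 / (4 * r)) / (2 * sqrt pi))"
    using op_gf_eq_main[of "of_real r"] assms u(2) by simp
  then have "op_gf (exp (- r)) * u = sqrt r * exp (pi ^ 2 / (4 * r)) / (2 * sqrt pi)"
    by (simp only: of_real_eq_iff)
  moreover have "op_gf (exp (- r)) \<ge> 0"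
    unfolding op_gf_def by (intro suminf_nonneg sm) auto
  ultimately show ?thesis using u(1) mult_left_mono[of 1 u "op_gf (exp (- r))"] by simp
qed

text \<open>With w the \<open>theta2\<close> factor and d the exponential, the difference is op_gf *
  (1 - w). The bound 1/4 on d gives |w - 1| <= 2 d <= 1/2, hence |op_gf| <= 2 |op_main|.\<close>

lemma op_gf_minus_main_le:
  fixes t :: complex
  assumes "Re t > 0" "exp (- 2 * Re (pi ^ 2 / t)) \<le> 1 / 4"
  shows "norm (op_gf (exp (- t)) - op_main t) \<le> 4 * norm (op_main t) * exp (- 2 * Re (pi ^ 2 / t))"
proof -
  define d where "d = exp (- 2 * Re (pi ^ 2 / t))"
  define w where "w = theta2 (pi ^ 2 / t)"
  have w: "norm (w - 1) \<le> 2 * d" unfolding w_def d_def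
    by (rule norm_theta2_minus_1_le) (use assms in simp)
  have "1 - norm (w - 1) \<le> norm w" using norm_triangle_ineq2[of 1 "1 - w"] by (simp add: norm_minus_commute)
  then have w2: "1/2 \<le> norm w" using w assms unfolding d_def by linarith
  have F: "op_gf (exp (- t)) * w = op_main t" unfolding w_def by (rule op_gf_eq_main[OF assms(1)])
  have "norm (op_gf (exp (- t)) - op_main t) = norm (op_gf (exp (- t))) * norm (w - 1)"
    unfolding F[symmetric] norm_mult[symmetric] by (simp add: algebra_simps norm_minus_commute)
  also have "\<dots> \<le> (2 * norm (op_main t)) * (2 * d)"
  proof (rule mult_mono[OF _ w])
    have "norm (op_gf (exp (- t))) * (1/2) \<le> norm (op_gf (exp (- t))) * norm w"
      by (intro mult_left_mono w2) simp
    then show "norm (op_gf (exp (- t))) \<le> 2 * norm (op_main t)" by (simp add: F[symmetric] norm_mult)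
  qed auto
  finally show ?thesis by (simp add: d_def)
qed


section \<open>The circle method\<close>

lemma has_integral_exp_circle:
  fixes r :: real and n k :: nat
  shows "((\<lambda>u. exp (- Complex r u) ^ k * exp (of_nat n * Complex r u)) has_integral
    (if k = n then of_real (2 * pi) else 0)) {-pi..pi}"
proof -
  define m where "m = int n - int k"
  have eq: "exp (- Complex r u) ^ k * exp (of_nat n * Complex r u) = exp (of_int m * Complex r u)" for u
  proof -
    have "exp (- Complex r u) ^ k = exp (of_nat k * (- Complex r u))" by (rule exp_of_nat_mult[symmetric])
    then show ?thesis by (simp add: m_def exp_add[symmetric] algebra_simps)
  qed
  show ?thesis
  proof (cases "k = n")
    case True
    then have "m = 0" by (simp add: m_def)
    then show ?thesis unfolding eq using has_integral_const_real[of "1 :: complex" "-pi" pi] True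
      by (simp add: scaleR_conv_of_real)
  next
    case False
    then have m: "m \<noteq> 0" by (simp add: m_def)
    define G where "G z = exp (of_int m * z) / (of_int m * \<i>)" for z :: complex
    have "((\<lambda>u. G (Complex r u)) has_vector_derivative exp (of_int m * Complex r u)) (at u within {-pi..pi})" for u
    proof -
      have "((\<lambda>u. Complex r u) has_vector_derivative \<i>) (at u)"
        unfolding complex_eq_cancel_iff2 has_vector_derivative_complex_iff by (auto intro!: derivative_eq_intros)
      moreover have "(G has_field_derivative exp (of_int m * Complex r u) / \<i>) (at (Complex r u))"
        unfolding G_def using m by (auto intro!: derivative_eq_intros)
      ultimately have "(G \<circ> (\<lambda>u. Complex r u) has_vector_derivative \<i> * (exp (of_int m * Complex r u) / \<i>)) (at u)"
        by (rule field_vector_diff_chain_at)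
      then show ?thesis by (simp add: o_def has_vector_derivative_at_within)
    qed
    then have "((\<lambda>u. exp (of_int m * Complex r u)) has_integral (G (Complex r pi) - G (Complex r (- pi)))) {-pi..pi}"
      by (intro fundamental_theorem_of_calculus) auto
    moreover have "exp (of_int m * Complex r pi) = exp (of_int m * Complex r (- pi))"
      by (rule exp_eq[THEN iffD2]) (auto intro!: exI[of _ m] simp: complex_eq_iff)
    ultimately show ?thesis unfolding eq using False by (simp add: G_def)
  qed
qed

text \<open>Cauchy's coefficient formula on |q| = exp (-r), written with q = exp (-t) and t = r + i
  u. The series converges uniformly in u, so it may be integrated term by term.\<close>

lemma op_gf_circle_integral:
  assumes "r > 0"
  shows "continuous_on A (\<lambda>u. op_gf (exp (- Complex r u)))"
    and "((\<lambda>u. op_gf (exp (- Complex r u)) * exp (of_nat n * Complex r u)) has_integral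
       of_real (2 * pi * real (overpartition_count n))) {-pi..pi}"
proof -
  let ?F = "\<lambda>K u. \<Sum>k<K. of_nat (overpartition_count k) * exp (- Complex r u) ^ k"
  have cont: "continuous_on B (\<lambda>u. Complex r u)" for B
    by (simp add: complex_eq_iff Complex_eq) (intro continuous_intros)
  have unif: "uniform_limit B ?F (\<lambda>u. op_gf (exp (- Complex r u))) sequentially" for B
    unfolding op_gf_def
  proof (rule Weierstrass_m_test)
    show "summable (\<lambda>k. real (overpartition_count k) * exp (- r) ^ k)"
      using assms by (intro summable_overpartition_real) auto
    show "norm (of_nat (overpartition_count k) * exp (- Complex r u) ^ k) \<le> real (overpartition_count k) * exp (- r) ^ k" for k u
      by (simp add: norm_mult norm_power)
  qed
  have contF: "continuous_on B (?F K)" for K B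
    by (intro continuous_intros cont)
  show "continuous_on A (\<lambda>u. op_gf (exp (- Complex r u)))"
    by (rule uniform_limit_theorem[OF _ unif]) (auto intro!: always_eventually contF)
  let ?e = "\<lambda>u. exp (of_nat n * Complex r u)"
  have "uniform_limit {-pi..pi} (\<lambda>K u. ?F K u * ?e u) (\<lambda>u. op_gf (exp (- Complex r u)) * ?e u) sequentially"
  proof (rule uniform_lim_mult[OF unif uniform_limit_const])
    show "bounded ((\<lambda>u. op_gf (exp (- Complex r u))) ` {-pi..pi})"
      by (intro compact_imp_bounded compact_continuous_image uniform_limit_theorem[OF _ unif])
         (auto intro!: always_eventually contF)
    show "bounded (?e ` {-pi..pi})"
      by (intro compact_imp_bounded compact_continuous_image continuous_intros cont) auto
  qed
  then obtain I J where IJ: "\<And>K. ((\<lambda>u. ?F K u * ?e u) has_integral I K) {-pi..pi}"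
    "((\<lambda>u. op_gf (exp (- Complex r u)) * ?e u) has_integral J) {-pi..pi}" "I \<longlonglongrightarrow> J"
    by (rule uniform_limit_integral) (auto intro!: continuous_intros contF cont)
  have "I K = of_real (2 * pi * real (overpartition_count n))" if "K > n" for K
  proof -
    have "((\<lambda>u. \<Sum>k<K. of_nat (overpartition_count k) * (exp (- Complex r u) ^ k * ?e u)) has_integral
      (\<Sum>k<K. of_nat (overpartition_count k) * (if k = n then of_real (2 * pi) else 0))) {-pi..pi}"
      by (intro has_integral_sum has_integral_mult_right has_integral_exp_circle) auto
    moreover have "(\<Sum>k<K. of_nat (overpartition_count k) * (if k = n then of_real (2 * pi) else 0)) =
        complex_of_real (2 * pi * real (overpartition_count n))"
      using that by (subst sum.remove[of _ n]) (auto simp: sum.neutral)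
    moreover have "(\<Sum>k<K. of_nat (overpartition_count k) * (exp (- Complex r u) ^ k * ?e u)) = ?F K u * ?e u" for u
      by (simp add: sum_distrib_right mult.assoc)
    ultimately show ?thesis using has_integral_unique[OF IJ(1)[of K]] by simp
  qed
  then have "I \<longlonglongrightarrow> of_real (2 * pi * real (overpartition_count n))"
    by (intro tendsto_eventually eventually_mono[OF eventually_gt_at_top[of n]])
  with IJ(3) have "J = of_real (2 * pi * real (overpartition_count n))" by (rule LIMSEQ_unique)
  with IJ(2) show "((\<lambda>u. op_gf (exp (- Complex r u)) * ?e u) has_integral
       of_real (2 * pi * real (overpartition_count n))) {-pi..pi}" by simp
qed

section \<open>Bounds on the minor and major arcs\<close>

lemma half_coth_ge:
  fixes r :: real
  assumes "r > 0"
  shows "2 / r \<le> (1 + exp (- r)) / (1 - exp (- r))"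
proof -
  \<comment> \<open>The claim is coth x >= 1/x at x = r / 2. Clearing denominators leaves g r >= 0,
    and g increases because 1 + x <= exp x.\<close>
  define g where "g x = x * (1 + exp (- x)) - 2 * (1 - exp (- x))" for x :: real
  have "g 0 \<le> g r"
  proof (rule DERIV_nonneg_imp_nondecreasing[of 0 r g])
    fix x :: real assume "0 \<le> x" "x \<le> r"
    have "(g has_real_derivative 1 - exp (- x) * (1 + x)) (at x)"
      unfolding g_def[abs_def] by (auto intro!: derivative_eq_intros simp: algebra_simps)
    moreover have "exp (- x) * (1 + x) \<le> exp (- x) * exp x"
      by (intro mult_left_mono exp_ge_add_one_self) auto
    then have "1 - exp (- x) * (1 + x) \<ge> 0" by (simp add: exp_minus)
    ultimately show "\<exists>y. (g has_real_derivative y) (at x) \<and> 0 \<le> y" by blast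
  qed (use assms in simp)
  then have "2 * (1 - exp (- r)) \<le> r * (1 + exp (- r))" by (simp add: g_def)
  then show ?thesis using assms by (simp add: divide_simps mult.commute)
qed

text \<open>The threshold 54 lies just below pi * sqrt 300, the least \<open>y\<close> at which the
  estimate is later applied; 0.0457 is the radius at the threshold, rounded up.\<close>

lemma circle_radius_bounds:
  fixes y r :: real
  assumes "y \<ge> 54" "r = pi ^ 2 / (4 * y)"
  shows "0 < r" "r \<le> 0.0457"
proof -
  have "pi ^ 2 \<le> 9.8697"
    using power_mono[OF pi_approx(2), of 2] by (simp add: power2_eq_square)
  then have "pi ^ 2 / (4 * y) \<le> 9.8697 / (4 * 54)" using assms by (intro frac_le) auto
  then show "0 < r" "r \<le> 0.0457" using assms by simp_all
qed

text \<open>On this arc the Poisson kernel in \<open>norm_op_gf_le\<close> is at most 1/59 of its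
  value at q = |q|, so the exponent there is at most -(58/59) (2 / r), and 2 / r = 8 y / pi^2. This
  saves 0.79 y out of the y provided by \<open>op_gf_real_le\<close>.\<close>

lemma op_gf_minor_arc:
  fixes y r u :: real
  assumes y: "y \<ge> 54" and r: "r = pi ^ 2 / (4 * y)" and u: "8 * r \<le> \<bar>u\<bar>" "\<bar>u\<bar> \<le> pi"
  shows "norm (op_gf (exp (- Complex r u))) \<le> exp (21/100 * y) / 16"
proof -
  have pi2: "pi ^ 2 \<le> 9.8697"
    using power_mono[OF pi_approx(2), of 2] by (simp add: power2_eq_square)
  note r0 = circle_radius_bounds(1)[OF y r] and r1 = circle_radius_bounds(2)[OF y r]
  define \<rho> where "\<rho> = exp (- r)"
  have rho: "0 < \<rho>" "\<rho> < 1" "1 - \<rho> \<le> r" using r0 exp_ge_add_one_self[of "- r"] by (auto simp: \<rho>_def)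
  define q where "q = exp (- Complex r u)"
  have nq: "norm q = \<rho>" by (simp add: q_def \<rho>_def)
  have q1: "norm (1 - q) ^ 2 = (1 - \<rho>) ^ 2 + 2 * \<rho> * (1 - cos u)"
  proof -
    have "Re q = \<rho> * cos u" "Im q = - \<rho> * sin u" by (simp_all add: q_def \<rho>_def Re_exp Im_exp)
    then have "norm (1 - q) ^ 2 = (1 - \<rho> * cos u) ^ 2 + (\<rho> * sin u) ^ 2" by (simp add: cmod_power2)
    also have "\<dots> = 1 - 2 * \<rho> * cos u + \<rho> ^ 2 * (cos u ^ 2 + sin u ^ 2)"
      unfolding power2_eq_square by algebra
    also have "cos u ^ 2 + sin u ^ 2 = 1" by simp
    finally show ?thesis by (simp add: power2_eq_square algebra_simps)
  qed
  \<comment> \<open>Since |u| >= 8 r, 1 - cos u is at least 1 - exp (-32 r^2), and the exponential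
    is expanded to second order.\<close>
  have cosu: "1 - cos u \<ge> 32 * r ^ 2 * (1 - 16 * r ^ 2)"
  proof -
    have "cos \<bar>u\<bar> \<le> cos (8 * r)" using u r0 by (intro cos_monotone_0_pi_le) auto
    also have "\<dots> \<le> exp (- ((8 * r) ^ 2 / 2))"
      using r0 r1 pi_gt3 by (intro cos_le_exp) auto
    also have "(8 * r) ^ 2 / 2 = 32 * r ^ 2" by (simp add: power2_eq_square)
    also have "exp (- (32 * r ^ 2)) \<le> 1 - 32 * r ^ 2 + (32 * r ^ 2) ^ 2 / 2"
    proof -
      \<comment> \<open>This upper bound comes from the quadratic lower bound of exp x: the product
        of the two quadratics is 1 + x^4 / 4.\<close>
      have "exp (- x) \<le> 1 - x + x ^ 2 / 2" if "x \<ge> 0" for x :: real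
      proof -
        have "1 + x + x ^ 2 / 2 \<le> exp x" by (rule exp_lower_Taylor_quadratic[OF that])
        moreover have "(1 - x + x ^ 2 / 2) * (1 + x + x ^ 2 / 2) = 1 + x ^ 4 / 4"
          by (simp add: power2_eq_square power4_eq_xxxx algebra_simps)
        moreover have "0 \<le> 1 - x + x ^ 2 / 2"
          using zero_le_power2[of "x - 1"] by (simp add: power2_eq_square algebra_simps)
        ultimately have "1 + x ^ 4 / 4 \<le> (1 - x + x ^ 2 / 2) * exp x"
          by (metis mult_left_mono)
        moreover have "0 \<le> x ^ 4" by simp
        ultimately have "1 \<le> (1 - x + x ^ 2 / 2) * exp x" by linarith
        then show ?thesis by (simp add: exp_minus field_simps)
      qed
      from this[of "32 * r ^ 2"] show ?thesis by simp
    qed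
    finally show ?thesis by (simp add: power2_eq_square algebra_simps)
  qed
  \<comment> \<open>For small r the ratio of the two sides without the constant is about (r^2 + u^2)
    / r^2 >= 65 when |u| = 8 r; 59 leaves room for the losses at r = 0.0457.\<close>
  have key: "59 * (1 - \<rho>) ^ 2 \<le> norm (1 - q) ^ 2"
  proof -
    have r2: "r ^ 2 \<le> 0.0457 ^ 2" using r0 r1 by (intro power_mono) auto
    have "58 \<le> 2 * (1 - 0.0457) * (32 * (1 - 16 * (0.0457::real) ^ 2))" by (simp add: power2_eq_square)
    also have "\<dots> \<le> 2 * \<rho> * (32 * (1 - 16 * r ^ 2))"
      using rho r0 r1 r2 by (intro mult_mono) (auto simp: power2_eq_square)
    finally have "58 * r ^ 2 \<le> 2 * \<rho> * (32 * (1 - 16 * r ^ 2)) * r ^ 2" by (intro mult_right_mono) auto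
    also have "\<dots> = 2 * \<rho> * (32 * r ^ 2 * (1 - 16 * r ^ 2))" by simp
    also have "\<dots> \<le> 2 * \<rho> * (1 - cos u)" using cosu rho by (intro mult_left_mono) auto
    finally have "58 * r ^ 2 \<le> 2 * \<rho> * (1 - cos u)" .
    moreover have "58 * (1 - \<rho>) ^ 2 \<le> 58 * r ^ 2" using rho by (intro mult_left_mono power_mono) auto
    ultimately show ?thesis unfolding q1 by linarith
  qed
  define w where "w = (1 + \<rho>) / (1 - \<rho>)"
  have w: "2 / r \<le> w" unfolding w_def \<rho>_def by (rule half_coth_ge[OF r0])
  have w0: "w > 0" using rho by (simp add: w_def)
  have "(1 - \<rho> ^ 2) / norm (1 - q) ^ 2 \<le> (1 - \<rho> ^ 2) / (59 * (1 - \<rho>) ^ 2)"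
  proof (rule divide_left_mono[OF key])
    show "0 \<le> 1 - \<rho> ^ 2" using rho by (simp add: power_le_one)
    show "0 < norm (1 - q) ^ 2 * (59 * (1 - \<rho>) ^ 2)"
      using key rho by (intro mult_pos_pos) (auto intro!: less_le_trans[OF _ key])
  qed
  also have "\<dots> = w / 59"
  proof -
    have "1 - \<rho> ^ 2 = (1 - \<rho>) * (1 + \<rho>)" by (simp add: power2_eq_square algebra_simps)
    then show ?thesis using rho by (simp add: w_def power2_eq_square)
  qed
  finally have "(1 - \<rho> ^ 2) / norm (1 - q) ^ 2 - w \<le> - (58 / 59) * w" by linarith
  also have "\<dots> \<le> - (58 / 59) * (2 / r)" using w by simp
  also have "2 / r = 8 * y / pi ^ 2" by (simp add: r)
  also have "- (58 / 59) * (8 * y / pi ^ 2) \<le> - (79/100) * y"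
  proof -
    have "8 * y / 9.8697 \<le> 8 * y / pi ^ 2" using y pi2 by (intro divide_left_mono) auto
    then show ?thesis using y by simp
  qed
  finally have ex: "(1 - \<rho> ^ 2) / norm (1 - q) ^ 2 - w \<le> - (79/100) * y" .
  have F: "op_gf \<rho> \<le> exp y / 16"
  proof -
    have "op_gf \<rho> \<le> sqrt r * exp (pi ^ 2 / (4 * r)) / (2 * sqrt pi)"
      unfolding \<rho>_def by (rule op_gf_real_le[OF r0])
    also have "pi ^ 2 / (4 * r) = y" using y by (simp add: r)
    also have "sqrt r * exp y / (2 * sqrt pi) = exp y * (sqrt (r / pi) / 2)"
      by (simp add: real_sqrt_divide mult.commute)
    also have "\<dots> \<le> exp y * (1 / 16)"
    proof (intro mult_left_mono)
      have "r / pi = pi / (4 * y)" by (simp add: r power2_eq_square)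
      also have "\<dots> \<le> 3.15 / (4 * 54)" using y pi_approx by (intro frac_le) auto
      also have "\<dots> \<le> (1 / 8) ^ 2" by (simp add: power2_eq_square)
      finally have "sqrt (r / pi) \<le> sqrt ((1 / 8) ^ 2)" by (rule real_sqrt_le_mono)
      then show "sqrt (r / pi) / 2 \<le> 1 / 16" by simp
    qed simp
    finally show ?thesis by simp
  qed
  have "norm (op_gf q) \<le> op_gf \<rho> * exp ((1 - \<rho> ^ 2) / norm (1 - q) ^ 2 - w)"
    using norm_op_gf_le[of q] rho unfolding nq w_def by simp
  also have "\<dots> \<le> exp y / 16 * exp (- (79/100) * y)"
    using F ex by (intro mult_mono) auto
  also have "\<dots> = exp (21/100 * y) / 16" by (simp add: exp_add[symmetric])
  finally show ?thesis by (simp add: q_def)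
qed

text \<open>With s = Re (pi^2 / t) the main term grows like exp (s / 4) while its relative error
  decays like exp (-2 s). Since |t|^2 <= 65 r^2, s is at least 4 y / 65 > 3.\<close>

lemma op_gf_major_arc:
  fixes y r u :: real
  assumes y: "y \<ge> 54" and r: "r = pi ^ 2 / (4 * y)" and u: "\<bar>u\<bar> \<le> 8 * r"
  shows "norm (op_gf (exp (- Complex r u)) - op_main (Complex r u)) \<le> 1"
proof -
  note r0 = circle_radius_bounds(1)[OF y r] and r1 = circle_radius_bounds(2)[OF y r]
  define t where "t = Complex r u"
  have t: "Re t > 0" using r0 by (simp add: t_def)
  define s where "s = Re (pi ^ 2 / t)"
  have sform: "s = pi ^ 2 * r / (r ^ 2 + u ^ 2)"
    by (simp add: s_def t_def Re_divide flip: of_real_power)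
  have u2: "u ^ 2 \<le> 64 * r ^ 2" using power_mono[OF u, of 2] by (simp add: power_mult_distrib)
  have "pi ^ 2 * r / (65 * r ^ 2) \<le> s"
    unfolding sform using u2 r0 by (intro divide_left_mono) (auto intro!: mult_pos_pos add_pos_nonneg)
  then have "4 * y / 65 \<le> s" using r0 y by (simp add: r power2_eq_square)
  then have s: "s \<ge> 3" using y by linarith
  have e4: "exp (- 2 * s) \<le> 1 / 4"
  proof -
    have "4 \<le> 1 + 2 * s" using s by simp
    also have "\<dots> \<le> exp (2 * s)" by (rule exp_ge_add_one_self)
    finally show ?thesis by (simp add: exp_minus field_simps)
  qed
  have nt: "norm t \<le> 9 * r"
    using cmod_le[of t] u r0 by (simp add: t_def)
  have "norm (op_gf (exp (- t)) - op_main t) \<le> 4 * norm (op_main t) * exp (- 2 * s)"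
    unfolding s_def by (rule op_gf_minus_main_le[OF t]) (use e4 s_def in simp)
  also have "norm (op_main t) = sqrt (norm t) * exp (s / 4) / (2 * sqrt pi)"
  proof -
    have "Re (of_real pi ^ 2 / (4 * t)) = s / 4"
    proof -
      have "of_real pi ^ 2 / (4 * t) = (of_real pi ^ 2 / t) / 4" by simp
      then show ?thesis by (simp only: Re_divide_numeral s_def of_real_power)
    qed
    then show ?thesis by (simp add: op_main_def norm_divide norm_mult)
  qed
  also have "4 * (sqrt (norm t) * exp (s / 4) / (2 * sqrt pi)) * exp (- 2 * s) =
      2 * (sqrt (norm t) / sqrt pi) * (exp (s / 4) * exp (- 2 * s))" by simp
  also have "exp (s / 4) * exp (- 2 * s) = exp (- (7 / 4 * s))" by (simp add: exp_add[symmetric])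
  also have "2 * (sqrt (norm t) / sqrt pi) * exp (- (7 / 4 * s)) \<le> 1 * 1"
  proof (intro mult_mono)
    have "norm t / pi \<le> (1 / 2) ^ 2" using nt r1 pi_gt3 by (simp add: field_simps)
    then have "sqrt (norm t / pi) \<le> sqrt ((1 / 2) ^ 2)" by (rule real_sqrt_le_mono)
    then show "2 * (sqrt (norm t) / sqrt pi) \<le> 1" by (simp add: real_sqrt_divide)
  qed (use s in auto)
  finally show ?thesis by (simp add: t_def)
qed

section \<open>The integral of the main term\<close>

lemma gaussian_has_integral:
  assumes "y > (0::real)"
  shows "((\<lambda>s. exp (- (2 * y * s ^ 2))) has_integral sqrt (pi / (2 * y))) UNIV"
proof -
  define \<sigma> where "\<sigma> = sqrt (1 / (4 * y))"
  have s: "\<sigma> > 0" "\<sigma> ^ 2 = 1 / (4 * y)" using assms by (simp_all add: \<sigma>_def)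
  have "(normal_density 0 \<sigma> has_integral 1) UNIV"
    using has_integral_integral_lborel[OF integrable_normal_density[OF s(1), of 0]] integral_normal_density[OF s(1), of 0]
    by simp
  from has_integral_mult_right[OF this, of "sqrt (pi / (2 * y))"]
  have "((\<lambda>x. sqrt (pi / (2 * y)) * normal_density 0 \<sigma> x) has_integral sqrt (pi / (2 * y))) UNIV"
    by simp
  moreover have "sqrt (pi / (2 * y)) * normal_density 0 \<sigma> x = exp (- (2 * y * x ^ 2))" for x
  proof -
    have "2 * pi * \<sigma> ^ 2 = pi / (2 * y)" "x ^ 2 / (2 * \<sigma> ^ 2) = 2 * y * x ^ 2"
      unfolding s(2) using assms by (simp_all add: field_simps)
    moreover have "sqrt (pi / (2 * y)) \<noteq> 0" using assms by simp
    ultimately show ?thesis by (simp add: normal_density_def)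
  qed
  ultimately show ?thesis by simp
qed

text \<open>The derivative of s exp (-2 y s^2) is (1 - 4 y s^2) exp (-2 y s^2), and 1 - 4 s^2 = (1 -
  1/y) + (1/y) (1 - 4 y s^2). So the integral is 1 - 1/y times a truncated Gaussian integral plus a
  boundary term; at a^2 = 1/2 both the cut-off tail and the boundary term are of order exp
  (-y).\<close>

lemma gaussian_main_integral:
  fixes y a :: real
  assumes y: "y > 1" and a: "a = sqrt (1 / 2)"
  obtains J where "((\<lambda>s. (1 - 4 * s ^ 2) * exp (- (2 * y * s ^ 2))) has_integral J) {- a..a}"
    "\<bar>J - (1 - 1 / y) * sqrt (pi / (2 * y))\<bar> \<le> 6 * exp (- y)"
proof -
  have a0: "a > 0" and a2: "a ^ 2 = 1 / 2" unfolding a by auto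
  define g where "g z s = exp (- (2 * z * s ^ 2))" for z s :: real
  define I where "I z = integral {- a..a} (g z)" for z
  have I: "(g z has_integral I z) {- a..a}" for z
    unfolding I_def g_def[abs_def] by (intro integrable_integral integrable_continuous_real continuous_intros)
  have tail: "(g z has_integral (sqrt (pi / (2 * z)) - I z)) (UNIV - {- a..a})" if "z > 0" for z
    using gaussian_has_integral[OF that] I[of z]
    by (intro has_integral_setdiff) (auto simp: g_def[abs_def])
  have I1: "0 \<le> I 1" by (rule has_integral_nonneg[OF I]) (simp add: g_def)
  have T: "0 \<le> sqrt (pi / (2 * y)) - I y"
    using y by (intro has_integral_nonneg[OF tail]) (auto simp: g_def)
  \<comment> \<open>On the tail 2 s^2 >= 1, so exp (-2 y s^2) <= exp (1 - y) exp (-2 s^2): the tail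
    is compared with that of the fixed Gaussian with parameter 1.\<close>
  have "sqrt (pi / (2 * y)) - I y \<le> exp (1 - y) * (sqrt (pi / (2 * 1)) - I 1)"
  proof (rule has_integral_le[OF tail has_integral_mult_right[OF tail]])
    fix s assume "s \<in> UNIV - {- a..a}"
    then have "a \<le> \<bar>s\<bar>" by auto
    then have "1 / 2 \<le> s ^ 2" using power_mono[of a "\<bar>s\<bar>" 2] a0 a2 by simp
    then have "(y - 1) * 1 \<le> (y - 1) * (2 * s ^ 2)" using y by (intro mult_left_mono) auto
    then have "- (2 * y * s ^ 2) \<le> (1 - y) + - (2 * 1 * s ^ 2)" by (simp add: algebra_simps)
    then show "g y s \<le> exp (1 - y) * g 1 s" unfolding g_def by (simp only: exp_add[symmetric] exp_le_cancel_iff)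
  qed (use y in auto)
  also have "\<dots> \<le> exp (1 - y) * sqrt (pi / 2)" using I1 by (intro mult_left_mono) auto
  also have "\<dots> \<le> 4 * exp (- y)"
  proof -
    have "sqrt (pi / 2) \<le> sqrt ((1.3) ^ 2)" using pi_approx by (intro real_sqrt_le_mono) (simp add: power2_eq_square)
    then have "sqrt (pi / 2) \<le> 1.3" by simp
    moreover have "exp (1::real) \<le> 3" using exp_le by simp
    ultimately have "exp 1 * sqrt (pi / 2) \<le> 3 * 1.3" by (intro mult_mono) auto
    then have "exp (- y) * (exp 1 * sqrt (pi / 2)) \<le> exp (- y) * 4" by (intro mult_left_mono) auto
    then show ?thesis by (simp add: exp_diff exp_minus field_simps)
  qed
  finally have T': "sqrt (pi / (2 * y)) - I y \<le> 4 * exp (- y)" .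
  have "((\<lambda>s. (1 - 4 * y * s ^ 2) * g y s) has_integral (a * g y a - (- a) * g y (- a))) {- a..a}"
  proof (rule fundamental_theorem_of_calculus)
    fix s assume "s \<in> {- a..a}"
    have "((\<lambda>s. s * g y s) has_real_derivative (1 - 4 * y * s ^ 2) * g y s) (at s within {- a..a})"
      unfolding g_def by (auto intro!: derivative_eq_intros simp: power2_eq_square algebra_simps)
    then show "((\<lambda>s. s * g y s) has_vector_derivative (1 - 4 * y * s ^ 2) * g y s) (at s within {- a..a})"
      by (simp only: has_real_derivative_iff_has_vector_derivative)
  qed (use a0 in simp)
  moreover have "a * g y a - (- a) * g y (- a) = 2 * a * exp (- y)"
    by (simp add: g_def a2)
  ultimately have B: "((\<lambda>s. (1 - 4 * y * s ^ 2) * g y s) has_integral 2 * a * exp (- y)) {- a..a}" by simp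
  define J where "J = (1 - 1 / y) * I y + (1 / y) * (2 * a * exp (- y))"
  have "((\<lambda>s. (1 - 1 / y) * g y s + (1 / y) * ((1 - 4 * y * s ^ 2) * g y s)) has_integral J) {- a..a}"
    unfolding J_def by (intro has_integral_add has_integral_mult_right I B)
  moreover have "(1 - 1 / y) * g y s + (1 / y) * ((1 - 4 * y * s ^ 2) * g y s) = (1 - 4 * s ^ 2) * exp (- (2 * y * s ^ 2))" for s
    using y by (simp add: g_def field_simps)
  ultimately have "((\<lambda>s. (1 - 4 * s ^ 2) * exp (- (2 * y * s ^ 2))) has_integral J) {- a..a}" by simp
  moreover have "\<bar>J - (1 - 1 / y) * sqrt (pi / (2 * y))\<bar> \<le> 6 * exp (- y)"
  proof -
    have "J - (1 - 1 / y) * sqrt (pi / (2 * y)) = (1 / y) * (2 * a * exp (- y)) - (1 - 1 / y) * (sqrt (pi / (2 * y)) - I y)"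
      by (simp add: J_def algebra_simps)
    moreover have "0 \<le> (1 - 1 / y) * (sqrt (pi / (2 * y)) - I y)"
      using y T by (intro mult_nonneg_nonneg) auto
    moreover have "(1 - 1 / y) * (sqrt (pi / (2 * y)) - I y) \<le> 1 * (4 * exp (- y))"
      by (rule mult_mono) (use y T T' in auto)
    moreover have "0 \<le> (1 / y) * (2 * a * exp (- y))" "(1 / y) * (2 * a * exp (- y)) \<le> 1 * (2 * exp (- y))"
    proof -
      have "a \<le> 1" by (rule power2_le_imp_le) (use a2 in auto)
      then have "2 * a * exp (- y) \<le> 2 * exp (- y)" by simp
      then show "(1 / y) * (2 * a * exp (- y)) \<le> 1 * (2 * exp (- y))" using y a0 by (intro mult_mono) auto
    qed (use y a0 in auto)
    ultimately show ?thesis by (simp add: abs_le_iff)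
  qed
  ultimately show ?thesis by (rule that)
qed

text \<open>The integrand is holomorphic on the plane slit along the nonpositive reals, a starlike
  set. With a primitive, moving the contour reduces to comparing values of \<open>P\<close> at end
  points.\<close>

lemma main_term_primitive:
  fixes N :: real
  obtains P where "\<And>t. t \<notin> \<real>\<^sub>\<le>\<^sub>0 \<Longrightarrow>
    (P has_field_derivative csqrt t * exp (of_real (pi ^ 2) / (4 * t) + of_real N * t)) (at t)"
proof -
  define S :: "complex set" where "S = - (complex_of_real ` {..0})"
  have S: "t \<in> S \<longleftrightarrow> t \<notin> \<real>\<^sub>\<le>\<^sub>0" for t
    unfolding S_def nonpos_Reals_def by auto
  have "open S" unfolding S_def by (metis S S_def closed_nonpos_Reals_complex open_Compl Compl_iff subsetI subset_antisym)
  have d: "(\<lambda>t. csqrt t * exp (of_real (pi ^ 2) / (4 * t) + of_real N * t)) field_differentiable at t" if "t \<in> S" for t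
  proof -
    have "t \<noteq> 0" "t \<notin> \<real>\<^sub>\<le>\<^sub>0" using that S by auto
    then show ?thesis
      by (intro field_differentiable_mult field_differentiable_at_csqrt
           field_differentiable_compose[of "\<lambda>t. of_real (pi ^ 2) / (4 * t) + of_real N * t" _ exp, unfolded o_def]
           field_differentiable_add field_differentiable_divide field_differentiable_const field_differentiable_ident
           field_differentiable_within_exp) auto
  qed
  have "\<exists>g. \<forall>x\<in>S. (g has_field_derivative csqrt x * exp (of_real (pi ^ 2) / (4 * x) + of_real N * x)) (at x)"
  proof (rule holomorphic_starlike_primitive[where k = "{}"])
    show "continuous_on S (\<lambda>t. csqrt t * exp (of_real (pi ^ 2) / (4 * t) + of_real N * t))"
      using d by (meson continuous_at_imp_continuous_on field_differentiable_imp_continuous_at)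
    show "starlike S" unfolding S_def by (rule starlike_slotted_complex_plane_left)
  qed (use d \<open>open S\<close> in auto)
  then show ?thesis using S that by blast
qed

text \<open>On the arc \<open>t = t0 \<sigma>\<^sup>2\<close> with \<open>\<sigma> = sqrt (1 - s\<^sup>2) + i s\<close> the exponent is the real number
  \<open>y (1 - 2 s\<^sup>2)\<close>, so the saddle point integral becomes a Gaussian integral.\<close>

lemma primitive_arc:
  fixes y N t0 a J :: real
  assumes P: "\<And>t. t \<notin> \<real>\<^sub>\<le>\<^sub>0 \<Longrightarrow>
      (P has_field_derivative csqrt t * exp (of_real (pi ^ 2) / (4 * t) + of_real N * t)) (at t)"
    and y: "y > 1" and N: "N = y ^ 2 / pi ^ 2" and t0: "t0 = pi ^ 2 / (2 * y)" and a: "a = sqrt (1 / 2)"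
    and J: "((\<lambda>s. (1 - 4 * s ^ 2) * exp (- (2 * y * s ^ 2))) has_integral J) {- a..a}"
  shows "Im (P (Complex 0 t0) - P (Complex 0 (- t0))) = 2 * t0 * sqrt t0 * exp y * J"
proof -
  have a0: "a > 0" and a2: "a ^ 2 = 1 / 2" unfolding a by auto
  have t00: "t0 > 0" using y by (simp add: t0)
  define c where "c s = sqrt (1 - s ^ 2)" for s :: real
  define \<sigma> where "\<sigma> s = Complex (c s) s" for s
  define G where "G z = P (of_real t0 * z ^ 2)" for z
  define D where "D s = Complex (- s / c s) 1 * (csqrt (of_real t0 * \<sigma> s ^ 2) *
      exp (of_real (pi ^ 2) / (4 * (of_real t0 * \<sigma> s ^ 2)) + of_real N * (of_real t0 * \<sigma> s ^ 2)) * (of_real t0 * (2 * \<sigma> s)))" for s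
  have s2: "s ^ 2 \<le> 1 / 2" if "s \<in> {- a..a}" for s
  proof -
    have "\<bar>s\<bar> \<le> a" using that by auto
    then have "\<bar>s\<bar> ^ 2 \<le> a ^ 2" by (intro power_mono) auto
    then show ?thesis by (simp add: a2)
  qed
  have c0: "c s > 0" "c s ^ 2 = 1 - s ^ 2" if "s \<in> {- a..a}" for s
    using s2[OF that] by (simp_all add: c_def)
  have slit: "of_real t0 * \<sigma> s ^ 2 \<notin> \<real>\<^sub>\<le>\<^sub>0" if "s \<in> {- a..a}" for s
  proof
    assume "of_real t0 * \<sigma> s ^ 2 \<in> \<real>\<^sub>\<le>\<^sub>0"
    then have "Re (of_real t0 * \<sigma> s ^ 2) \<le> 0" "Im (of_real t0 * \<sigma> s ^ 2) = 0"
      by (simp_all add: complex_nonpos_Reals_iff)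
    moreover have "Im (of_real t0 * \<sigma> s ^ 2) = t0 * (2 * (c s * s))" "Re (of_real t0 * \<sigma> s ^ 2) = t0 * (c s ^ 2 - s ^ 2)"
      by (simp_all add: \<sigma>_def power2_eq_square)
    ultimately have "s = 0" "t0 * (c s ^ 2 - s ^ 2) \<le> 0" using t00 c0(1)[OF that] by simp_all
    then show False using t00 c0(2)[OF that] by simp
  qed
  have der: "((\<lambda>s. G (\<sigma> s)) has_vector_derivative D s) (at s within {- a..a})" if s: "s \<in> {- a..a}" for s
  proof -
    have "(c has_real_derivative - s / c s) (at s)"
      unfolding c_def[abs_def] using s2[OF s]
      by (auto intro!: derivative_eq_intros simp: field_simps)
    then have "(\<sigma> has_vector_derivative Complex (- s / c s) 1) (at s)"
      unfolding \<sigma>_def[abs_def] has_vector_derivative_complex_iff by simp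
    moreover have "(G has_field_derivative
        (csqrt (of_real t0 * \<sigma> s ^ 2) *
      exp (of_real (pi ^ 2) / (4 * (of_real t0 * \<sigma> s ^ 2)) + of_real N * (of_real t0 * \<sigma> s ^ 2)) * (of_real t0 * (2 * \<sigma> s)))) (at (\<sigma> s))"
      unfolding G_def
      by (rule DERIV_chain'[where g = P and f = "\<lambda>z. of_real t0 * z ^ 2", OF _ P[OF slit[OF s]]]) (auto intro!: derivative_eq_intros)
    ultimately have "(G \<circ> \<sigma> has_vector_derivative D s) (at s)"
      unfolding D_def by (rule field_vector_diff_chain_at)
    then show ?thesis by (simp add: o_def has_vector_derivative_at_within)
  qed
  have "(D has_integral (G (\<sigma> a) - G (\<sigma> (- a)))) {- a..a}"
    by (rule fundamental_theorem_of_calculus) (use a0 der in auto)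
  then have "((\<lambda>s. Im (D s)) has_integral Im (G (\<sigma> a) - G (\<sigma> (- a)))) {- a..a}"
    by (rule has_integral_linear[OF _ bounded_linear_Im, unfolded o_def])
  moreover have "Im (D s) = 2 * t0 * sqrt t0 * exp y * ((1 - 4 * s ^ 2) * exp (- (2 * y * s ^ 2)))"
    if s: "s \<in> {- a..a}" for s
  proof -
    \<comment> \<open>As |sigma| = 1, the reciprocal of sigma^2 is its conjugate; both terms of the
      exponent have the coefficient y / 2, so they add up to the real number y Re (sigma^2).\<close>
    have un: "\<sigma> s * cnj (\<sigma> s) = 1"
      using c0[OF s] by (simp add: \<sigma>_def complex_eq_iff power2_eq_square algebra_simps)
    have nz: "\<sigma> s \<noteq> 0" using un by auto
    have "csqrt (of_real t0 * \<sigma> s ^ 2) = csqrt ((of_real (sqrt t0) * \<sigma> s) ^ 2)"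
      using t00 by (simp add: power_mult_distrib flip: of_real_power)
    also have "\<dots> = of_real (sqrt t0) * \<sigma> s"
      using t00 c0[OF s] by (intro csqrt_square) (simp add: \<sigma>_def)
    finally have cs: "csqrt (of_real t0 * \<sigma> s ^ 2) = of_real (sqrt t0) * \<sigma> s" .
    have "of_real (pi ^ 2) / (4 * (of_real t0 * \<sigma> s ^ 2)) + of_real N * (of_real t0 * \<sigma> s ^ 2) =
       of_real (pi ^ 2 / (4 * t0)) * (1 / \<sigma> s ^ 2) + of_real (N * t0) * \<sigma> s ^ 2" by simp
    also have "pi ^ 2 / (4 * t0) = y / 2" using y by (simp add: t0)
    also have "N * t0 = y / 2" using y by (simp add: t0 N power2_eq_square)
    also have "1 / \<sigma> s ^ 2 = cnj (\<sigma> s) ^ 2"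
      using un nz by (simp add: field_simps flip: power_mult_distrib)
    also have "of_real (y / 2) * cnj (\<sigma> s) ^ 2 + of_real (y / 2) * \<sigma> s ^ 2 = complex_of_real (y * (1 - 2 * s ^ 2))"
    proof -
      have cc: "c s * c s = 1 - s * s" using c0(2)[OF s] by (simp add: power2_eq_square)
      show ?thesis
        by (simp add: complex_eq_iff \<sigma>_def power2_eq_square cc; simp add: algebra_simps)
    qed
    finally have ex: "of_real (pi ^ 2) / (4 * (of_real t0 * \<sigma> s ^ 2)) + of_real N * (of_real t0 * \<sigma> s ^ 2) =
       complex_of_real (y * (1 - 2 * s ^ 2))" .
    have "Complex (- s / c s) 1 = \<i> * \<sigma> s / of_real (c s)"
      using c0[OF s] by (simp add: complex_eq_iff \<sigma>_def)
    then have "D s = \<i> * \<sigma> s / of_real (c s) * (of_real (sqrt t0) * \<sigma> s * of_real (exp (y * (1 - 2 * s ^ 2))) * (of_real t0 * (2 * \<sigma> s)))"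
      unfolding D_def cs ex exp_of_real by simp
    also have "\<dots> = of_real (2 * t0 * sqrt t0 * exp (y * (1 - 2 * s ^ 2)) / c s) * (\<i> * \<sigma> s ^ 3)"
      using c0(1)[OF s] by (simp add: power3_eq_cube)
    finally have "Im (D s) = 2 * t0 * sqrt t0 * exp (y * (1 - 2 * s ^ 2)) / c s * Re (\<sigma> s ^ 3)"
      by (simp del: of_real_mult of_real_divide)
    \<comment> \<open>The factor c s in Re (sigma^3) cancels the denominator that comes from the
      derivative of sigma.\<close>
    also have "Re (\<sigma> s ^ 3) = c s * (c s ^ 2 - 3 * s ^ 2)"
      by (simp add: \<sigma>_def power3_eq_cube power2_eq_square algebra_simps)
    also have "c s ^ 2 - 3 * s ^ 2 = 1 - 4 * s ^ 2" using c0(2)[OF s] by simp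
    also have "exp (y * (1 - 2 * s ^ 2)) = exp y * exp (- (2 * y * s ^ 2))"
      by (simp add: exp_add[symmetric] algebra_simps)
    finally show ?thesis using c0(1)[OF s] by simp
  qed
  ultimately have "((\<lambda>s. 2 * t0 * sqrt t0 * exp y * ((1 - 4 * s ^ 2) * exp (- (2 * y * s ^ 2)))) has_integral
      Im (G (\<sigma> a) - G (\<sigma> (- a)))) {- a..a}"
    by (rule has_integral_eq[rotated]) auto
  moreover have "((\<lambda>s. 2 * t0 * sqrt t0 * exp y * ((1 - 4 * s ^ 2) * exp (- (2 * y * s ^ 2)))) has_integral
      2 * t0 * sqrt t0 * exp y * J) {- a..a}"
    by (intro has_integral_mult_right J)
  ultimately have "Im (G (\<sigma> a) - G (\<sigma> (- a))) = 2 * t0 * sqrt t0 * exp y * J"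
    by (rule has_integral_unique)
  \<comment> \<open>At s = a and s = -a, sigma is exp (i pi / 4) or its conjugate, so the arc ends
    on the imaginary axis.\<close>
  moreover have "c a = a" "c (- a) = a" using a2 a0 by (simp_all add: c_def a)
  then have "of_real t0 * \<sigma> a ^ 2 = Complex 0 t0" "of_real t0 * \<sigma> (- a) ^ 2 = Complex 0 (- t0)"
    using a2 by (simp_all add: \<sigma>_def complex_eq_iff power2_eq_square)
  ultimately show ?thesis by (simp add: G_def)
qed

text \<open>The segment joins an end of the arc, at height 2 r on the imaginary axis, to an end of
  the major arc; \<open>e\<close> selects the upper or lower one. Along it the two terms of the
  exponent have real parts at most y / 48 and y / 4.\<close>

lemma primitive_segment:
  fixes y N r e :: real
  assumes P: "\<And>t. t \<notin> \<real>\<^sub>\<le>\<^sub>0 \<Longrightarrow>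
      (P has_field_derivative csqrt t * exp (of_real (pi ^ 2) / (4 * t) + of_real N * t)) (at t)"
    and y: "y \<ge> 54" and N: "N = y ^ 2 / pi ^ 2" and r: "r = pi ^ 2 / (4 * y)" and e: "\<bar>e\<bar> = 1"
  shows "norm (P (Complex r (e * (8 * r))) - P (Complex 0 (e * (2 * r)))) \<le> exp (28/100 * y)"
proof -
  note r0 = circle_radius_bounds(1)[OF y r] and r1 = circle_radius_bounds(2)[OF y r]
  have e2: "e ^ 2 = 1" using e by (metis power2_abs one_power2)
  let ?S = "closed_segment (Complex 0 (e * (2 * r))) (Complex r (e * (8 * r)))"
  have pt: "z \<notin> \<real>\<^sub>\<le>\<^sub>0 \<and> norm (csqrt z * exp (of_real (pi ^ 2) / (4 * z) + of_real N * z)) \<le> exp (28/100 * y)" if "z \<in> ?S" for z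
  proof -
    from that obtain s where s: "0 \<le> s" "s \<le> 1"
      and zs: "z = (1 - s) *\<^sub>R Complex 0 (e * (2 * r)) + s *\<^sub>R Complex r (e * (8 * r))"
      unfolding in_segment by blast
    have z: "z = Complex (s * r) (e * ((2 + 6 * s) * r))"
      unfolding zs by (simp add: complex_eq_iff algebra_simps)
    have im: "Im z ^ 2 = ((2 + 6 * s) * r) ^ 2" unfolding z by (simp add: power_mult_distrib e2)
    have im0: "Im z \<noteq> 0"
    proof
      assume "Im z = 0"
      then have "((2 + 6 * s) * r) ^ 2 = 0" using im by simp
      then show False using s r0 by simp
    qed
    have Re: "Re (of_real (pi ^ 2) / (4 * z)) = pi ^ 2 / 4 * (Re z / (Re z ^ 2 + Im z ^ 2))"
      by (simp add: Re_divide power2_eq_square divide_simps)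
    have "Re z / (Re z ^ 2 + Im z ^ 2) \<le> 1 / (48 * r)"
    proof -
      \<comment> \<open>The difference of the two sides is (2 - 6 s)^2. Hence Re (1 / z) <= 1 / (48
        r) on the whole segment.\<close>
      have "48 * s \<le> (2 + 6 * s) ^ 2"
        using zero_le_power2[of "2 - 6 * s"] by (simp add: power2_eq_square algebra_simps)
      then have "48 * s * r ^ 2 \<le> (2 + 6 * s) ^ 2 * r ^ 2" by (intro mult_right_mono) auto
      then have "48 * r * Re z \<le> Re z ^ 2 + Im z ^ 2"
        unfolding im using zero_le_power2[of "Re z"] by (simp add: z power2_eq_square algebra_simps)
      moreover have "0 < Re z ^ 2 + Im z ^ 2" using im0 by (simp add: add_nonneg_pos)
      ultimately show ?thesis using r0 by (simp add: field_simps)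
    qed
    then have "Re (of_real (pi ^ 2) / (4 * z)) \<le> pi ^ 2 / 4 * (1 / (48 * r))"
      unfolding Re by (intro mult_left_mono) auto
    also have "\<dots> = y / 48" using y by (simp add: r)
    finally have R1: "Re (of_real (pi ^ 2) / (4 * z)) \<le> y / 48" .
    have "Re (of_real N * z) = s * (N * r)" by (simp add: z)
    also have "N * r = y / 4" using y by (simp add: N r power2_eq_square)
    also have "s * (y / 4) \<le> 1 * (y / 4)" using s y by (intro mult_right_mono) auto
    finally have R2: "Re (of_real N * z) \<le> y / 4" by simp
    have "norm (exp (of_real (pi ^ 2) / (4 * z) + of_real N * z)) \<le> exp (28/100 * y)"
      using R1 R2 y unfolding norm_exp_eq_Re plus_complex.sel by simp
    moreover have "norm (csqrt z) \<le> 1"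
    proof -
      have "norm z \<le> \<bar>Re z\<bar> + \<bar>Im z\<bar>" by (rule cmod_le)
      also have "\<dots> = s * r + (2 + 6 * s) * r" using s r0 e by (simp add: z abs_mult)
      also have "\<dots> \<le> 1 * 0.0457 + (2 + 6 * 1) * 0.0457"
        using s r0 r1 by (intro add_mono mult_mono) auto
      finally show ?thesis by (simp add: norm_csqrt)
    qed
    ultimately have "norm (csqrt z) * norm (exp (of_real (pi ^ 2) / (4 * z) + of_real N * z)) \<le> 1 * exp (28/100 * y)"
      by (intro mult_mono) auto
    then show ?thesis using im0 by (auto simp: norm_mult complex_nonpos_Reals_iff)
  qed
  have "norm (P (Complex r (e * (8 * r))) - P (Complex 0 (e * (2 * r)))) \<le>
      exp (28/100 * y) * norm (Complex r (e * (8 * r)) - Complex 0 (e * (2 * r)))"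
    by (rule field_differentiable_bound[OF convex_closed_segment])
       (use pt P in \<open>auto intro: has_field_derivative_at_within\<close>)
  also have "\<dots> \<le> exp (28/100 * y) * 1"
  proof (intro mult_left_mono)
    have "norm (Complex r (e * (8 * r)) - Complex 0 (e * (2 * r))) \<le> \<bar>r\<bar> + \<bar>e * (6 * r)\<bar>"
      using cmod_le[of "Complex r (e * (8 * r)) - Complex 0 (e * (2 * r))"] by (simp add: algebra_simps)
    also have "\<dots> \<le> 1" using r0 r1 e by (simp add: abs_mult)
    finally show "norm (Complex r (e * (8 * r)) - Complex 0 (e * (2 * r))) \<le> 1" .
  qed simp
  finally show ?thesis by simp
qed

text \<open>Subtracting the main term on the major arc leaves an integrand bounded by
  \<open>B\<close> on the whole circle. The main term itself is integrated by the primitive, along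
  one segment, the saddle arc and the other segment.\<close>

lemma overpartition_count_estimate:
  fixes n :: nat and y :: real
  assumes y: "y \<ge> 54" and yn: "y = pi * sqrt (real n)"
  shows "\<bar>real (overpartition_count n) - exp y / (8 * real n) * (1 - 1 / y)\<bar> \<le> exp (46/100 * y) / 15"
proof -
  define r where "r = pi ^ 2 / (4 * y)"
  define t0 where "t0 = pi ^ 2 / (2 * y)"
  define N where "N = y ^ 2 / pi ^ 2"
  have Nn: "real n = N" by (simp add: N_def yn power_mult_distrib)
  note r0 = circle_radius_bounds(1)[OF y r_def] and r1 = circle_radius_bounds(2)[OF y r_def]
  have Nr: "N * r = y / 4" using y by (simp add: N_def r_def power2_eq_square)
  have t0r: "t0 = 2 * r" by (simp add: t0_def r_def)
  \<comment> \<open>The exponent 0.46 is 0.21 from the minor arc plus 0.25 from |exp (n t)| = exp (y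
    / 4).\<close>
  define B where "B = exp (46/100 * y) / 16"
  obtain P where P: "\<And>t. t \<notin> \<real>\<^sub>\<le>\<^sub>0 \<Longrightarrow>
      (P has_field_derivative csqrt t * exp (of_real (pi ^ 2) / (4 * t) + of_real N * t)) (at t)"
    using main_term_primitive[of N] by blast
  define M where "M u = op_main (Complex r u) * exp (of_nat n * Complex r u)" for u
  define \<Delta> where "\<Delta> = P (Complex r (8 * r)) - P (Complex r (- (8 * r)))"
  define m where "m = \<Delta> / (2 * of_real (sqrt pi) * \<i>)"
  have "(M has_integral m) {- (8 * r)..8 * r}"
  proof -
    have "((\<lambda>u. P (Complex r u)) has_vector_derivative 2 * of_real (sqrt pi) * \<i> * M u) (at u within {- (8 * r)..8 * r})" for u
    proof -
      have "((\<lambda>u. Complex r u) has_vector_derivative \<i>) (at u)"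
        unfolding has_vector_derivative_complex_iff by (auto intro!: derivative_eq_intros)
      moreover have "Complex r u \<notin> \<real>\<^sub>\<le>\<^sub>0" using r0 by (simp add: complex_nonpos_Reals_iff)
      ultimately have "(P \<circ> Complex r has_vector_derivative \<i> * (csqrt (Complex r u) *
          exp (of_real (pi ^ 2) / (4 * Complex r u) + of_real N * Complex r u))) (at u)"
        by (intro field_vector_diff_chain_at P)
      moreover have "\<i> * (csqrt (Complex r u) * exp (of_real (pi ^ 2) / (4 * Complex r u) + of_real N * Complex r u)) =
          2 * of_real (sqrt pi) * \<i> * M u"
        unfolding M_def op_main_def Nn[symmetric] exp_add by simp
      ultimately have "((\<lambda>u. P (Complex r u)) has_vector_derivative 2 * of_real (sqrt pi) * \<i> * M u) (at u)"
        by (simp only: o_def)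
      then show ?thesis by (rule has_vector_derivative_at_within)
    qed
    then have "((\<lambda>u. 2 * of_real (sqrt pi) * \<i> * M u) has_integral \<Delta>) {- (8 * r)..8 * r}"
      unfolding \<Delta>_def using r0 by (intro fundamental_theorem_of_calculus) auto
    from has_integral_mult_right[OF this, of "1 / (2 * of_real (sqrt pi) * \<i>)"]
    show ?thesis by (simp add: m_def)
  qed
  then have int_M: "((\<lambda>u. if u \<in> {- (8 * r)..8 * r} then M u else 0) has_integral m) {- pi..pi}"
    by (subst has_integral_restrict) (use r1 pi_gt3 in auto)
  \<comment> \<open>The main term is continued by 0, so that a single sup bound over the full period
    suffices.\<close>
  define K where "K u = op_gf (exp (- Complex r u)) * exp (of_nat n * Complex r u) -
      (if u \<in> {- (8 * r)..8 * r} then M u else 0)" for u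
  have "(K has_integral (of_real (2 * pi * real (overpartition_count n)) - m)) {- pi..pi}"
    unfolding K_def by (intro has_integral_diff op_gf_circle_integral r0 int_M)
  moreover have "norm (K u) \<le> B" if u: "u \<in> {- pi..pi}" for u
  proof -
    have en: "norm (exp (of_nat n * Complex r u)) = exp (y / 4)"
      using Nr Nn by simp
    show ?thesis
    proof (cases "u \<in> {- (8 * r)..8 * r}")
      case True
      then have "\<bar>u\<bar> \<le> 8 * r" by auto
      have "K u = (op_gf (exp (- Complex r u)) - op_main (Complex r u)) * exp (of_nat n * Complex r u)"
        using True by (simp add: K_def M_def algebra_simps)
      then have "norm (K u) \<le> 1 * exp (y / 4)"
        unfolding norm_mult en
        using mult_right_mono[OF op_gf_major_arc[OF y r_def \<open>\<bar>u\<bar> \<le> 8 * r\<close>], of "exp (y / 4)"]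
        by (simp only: norm_mult en exp_ge_zero simp_thms)
      also have "\<dots> \<le> (exp (21/100 * y) / 16) * exp (y / 4)"
      proof (intro mult_right_mono)
        have "16 \<le> 1 + 21/100 * y + (21/100 * y) ^ 2 / 2"
        proof -
          have "11 ^ 2 \<le> (21/100 * y) ^ 2" using y by (intro power_mono) auto
          then show ?thesis using y by simp
        qed
        also have "\<dots> \<le> exp (21/100 * y)" using y by (intro exp_lower_Taylor_quadratic) auto
        finally show "1 \<le> exp (21/100 * y) / 16" by simp
      qed simp
      also have "\<dots> = B" by (simp add: B_def exp_add[symmetric])
      finally show ?thesis .
    next
      case False
      then have "8 * r \<le> \<bar>u\<bar>" "\<bar>u\<bar> \<le> pi" using u by auto
      note minor = op_gf_minor_arc[OF y r_def this]
      have "K u = op_gf (exp (- Complex r u)) * exp (of_nat n * Complex r u)"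
        by (simp only: K_def False if_False diff_0_right)
      then have "norm (K u) \<le> exp (21/100 * y) / 16 * exp (y / 4)"
        using mult_right_mono[OF minor, of "exp (y / 4)"] by (simp only: norm_mult en exp_ge_zero simp_thms)
      also have "\<dots> = B" by (simp add: B_def exp_add[symmetric])
      finally show ?thesis .
    qed
  qed
  ultimately have "norm (of_real (2 * pi * real (overpartition_count n)) - m) \<le> B * (2 * pi)"
    using has_integral_bound_real[of B "{}" K _ "- pi" pi] by (auto simp: B_def)
  then have "\<bar>Re (of_real (2 * pi * real (overpartition_count n)) - m)\<bar> \<le> B * (2 * pi)"
    using abs_Re_le_cmod order_trans by blast
  then have e1: "\<bar>2 * pi * real (overpartition_count n) - Re m\<bar> \<le> B * (2 * pi)" by simp
  have Rem: "Re m = Im \<Delta> / (2 * sqrt pi)"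
  proof -
    have "m = \<Delta> / \<i> / of_real (2 * sqrt pi)" 
      by (simp only: m_def of_real_mult of_real_numeral divide_divide_eq_left mult_ac)
    moreover have "Re (\<Delta> / \<i>) = Im \<Delta>" by (simp add: Re_divide)
    ultimately show ?thesis by (simp only: Re_divide_of_real)
  qed
  define a where "a = sqrt (1 / 2 :: real)"
  have y1: "y > 1" using y by simp
  obtain J where J: "((\<lambda>s. (1 - 4 * s ^ 2) * exp (- (2 * y * s ^ 2))) has_integral J) {- a..a}"
    "\<bar>J - (1 - 1 / y) * sqrt (pi / (2 * y))\<bar> \<le> 6 * exp (- y)"
    using gaussian_main_integral[OF y1 a_def] by blast
  define Q where "Q = 2 * t0 * sqrt t0 * exp y * ((1 - 1 / y) * sqrt (pi / (2 * y)))"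
  have arc: "Im (P (Complex 0 t0) - P (Complex 0 (- t0))) = 2 * t0 * sqrt t0 * exp y * J"
    by (rule primitive_arc[OF P y1 N_def t0_def a_def J(1)])
  have t0c: "0 < t0" "2 * t0 * sqrt t0 \<le> 1/6"
  proof -
    have "sqrt t0 \<le> sqrt ((1/2) ^ 2)" using t0r r1 by (intro real_sqrt_le_mono) (simp add: power2_eq_square)
    then have "t0 * sqrt t0 \<le> (1/10) * (1/2)" using t0r r0 r1 by (intro mult_mono) auto
    then show "0 < t0" "2 * t0 * sqrt t0 \<le> 1/6" using t0r r0 by auto
  qed
  have "\<bar>2 * t0 * sqrt t0 * exp y * J - Q\<bar> = 2 * t0 * sqrt t0 * exp y * \<bar>J - (1 - 1 / y) * sqrt (pi / (2 * y))\<bar>"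
    unfolding Q_def right_diff_distrib[symmetric] abs_mult using t0c by simp
  also have "\<dots> \<le> 2 * t0 * sqrt t0 * exp y * (6 * exp (- y))"
    using t0c by (intro mult_left_mono J) auto
  also have "\<dots> = 2 * t0 * sqrt t0 * 6" by (simp add: exp_minus)
  also have "\<dots> \<le> 1" using t0c by simp
  finally have e2: "\<bar>2 * t0 * sqrt t0 * exp y * J - Q\<bar> \<le> 1" .
  \<comment> \<open>The arc ends at height t0 = 2 r, where the segments start.\<close>
  have seg: "\<bar>Im (P (Complex r (8 * r)) - P (Complex 0 t0))\<bar> \<le> exp (28/100 * y)"
    "\<bar>Im (P (Complex r (- (8 * r))) - P (Complex 0 (- t0)))\<bar> \<le> exp (28/100 * y)"
    using order_trans[OF abs_Im_le_cmod primitive_segment[OF P y N_def r_def, of 1]]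
      order_trans[OF abs_Im_le_cmod primitive_segment[OF P y N_def r_def, of "-1"]]
    by (simp_all add: t0r)
  have e3: "\<bar>Im \<Delta> - Q\<bar> \<le> 2 * exp (28/100 * y) + 1"
    using seg e2 arc unfolding \<Delta>_def by (simp add: abs_le_iff)
  have sp: "3.5 \<le> 2 * sqrt pi"
  proof -
    have "sqrt ((1.75) ^ 2) \<le> sqrt pi" using pi_gt3 pi_approx by (intro real_sqrt_le_mono) (simp add: power2_eq_square)
    then show ?thesis by simp
  qed
  have e4: "\<bar>Re m - Q / (2 * sqrt pi)\<bar> \<le> exp (28/100 * y)"
  proof -
    have "\<bar>Re m - Q / (2 * sqrt pi)\<bar> = \<bar>Im \<Delta> - Q\<bar> / (2 * sqrt pi)"
      unfolding Rem diff_divide_distrib[symmetric] by (simp add: abs_divide)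
    also have "\<dots> \<le> (2 * exp (28/100 * y) + 1) / 3.5" using e3 sp by (intro frac_le) auto
    also have "\<dots> \<le> exp (28/100 * y)"
    proof -
      have "(2 * E + 1) / 3.5 \<le> E" if "1 \<le> E" for E :: real using that by simp
      moreover have "1 \<le> exp (28/100 * y)" using y by simp
      ultimately show ?thesis by blast
    qed
    finally show ?thesis .
  qed
  \<comment> \<open>The constants of the saddle point integral combine to 2 pi times the claimed
    main term; the square roots pair up to sqrt (2 y)^2.\<close>
  have X: "Q / (2 * sqrt pi) = 2 * pi * (exp y / (8 * real n) * (1 - 1 / y))"
  proof -
    have "sqrt t0 = pi / sqrt (2 * y)" "sqrt (pi / (2 * y)) = sqrt pi / sqrt (2 * y)"
      using y by (simp_all add: t0_def real_sqrt_divide)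
    then have "Q / (2 * sqrt pi) = t0 * pi / (sqrt (2 * y) * sqrt (2 * y)) * exp y * (1 - 1 / y)"
      by (simp add: Q_def)
    also have "sqrt (2 * y) * sqrt (2 * y) = 2 * y" using y by simp
    also have "t0 * pi / (2 * y) = 2 * pi * (1 / (8 * N))"
      using y by (simp add: t0_def N_def power2_eq_square field_simps)
    finally show ?thesis by (simp add: Nn)
  qed
  have "\<bar>2 * pi * (real (overpartition_count n) - exp y / (8 * real n) * (1 - 1 / y))\<bar> \<le> B * (2 * pi) + exp (28/100 * y)"
    using e1 e4 unfolding X by (simp add: right_diff_distrib abs_le_iff)
  then have "2 * pi * \<bar>real (overpartition_count n) - exp y / (8 * real n) * (1 - 1 / y)\<bar> \<le> B * (2 * pi) + exp (28/100 * y)"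
    by (simp add: abs_mult)
  also have "exp (28/100 * y) \<le> 2 * pi * (exp (28/100 * y) / 6)"
    using pi_gt3 by simp
  finally have "2 * pi * \<bar>real (overpartition_count n) - exp y / (8 * real n) * (1 - 1 / y)\<bar> \<le>
      2 * pi * (B + exp (28/100 * y) / 6)"
    by (simp add: algebra_simps)
  then have "\<bar>real (overpartition_count n) - exp y / (8 * real n) * (1 - 1 / y)\<bar> \<le> B + exp (28/100 * y) / 6"
    by (rule mult_left_le_imp_le) simp
  also have "\<dots> \<le> exp (46/100 * y) / 15"
  proof -
    \<comment> \<open>The factor 40 is what turns the two errors into 1/16 + 1/(6 * 40) =
      1/15.\<close>
    have "40 \<le> 1 + 18/100 * y + (18/100 * y) ^ 2 / 2"
    proof -
      have "9 ^ 2 \<le> (18/100 * y) ^ 2" using y by (intro power_mono) auto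
      then show ?thesis using y by simp
    qed
    also have "\<dots> \<le> exp (18/100 * y)" using y by (intro exp_lower_Taylor_quadratic) auto
    finally have "exp (28/100 * y) * 40 \<le> exp (28/100 * y) * exp (18/100 * y)" by (intro mult_left_mono) auto
    also have "\<dots> = exp (46/100 * y)" by (simp add: exp_add[symmetric])
    finally show ?thesis by (simp add: B_def)
  qed
  finally show ?thesis .
qed


section \<open>Verified computation for small arguments\<close>

text \<open>Rewriting traverses the whole remaining list after every step, so lists are shortened in
  chunks of eight.\<close>

fun drop8 :: "'a list \<Rightarrow> 'a list" where
  "drop8 (a # b # c # d # e # f # g # h # xs) = xs"
| "drop8 xs = []"

fun skip :: "int \<Rightarrow> 'a list \<Rightarrow> 'a list" where
  "skip k [] = []"
| "skip k (x # xs) = (if k \<le> 0 then x # xs else if k < 8 then skip (k - 1) xs else skip (k - 8) (drop8 (x # xs)))"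

lemma drop8_eq: "drop8 xs = drop 8 xs"
  by (induction xs rule: drop8.induct) (simp_all add: eval_nat_numeral)

lemma skip_eq: "skip k xs = drop (nat k) xs"
proof (induction k xs rule: skip.induct)
  case (2 k x xs)
  have "drop (nat k) (x # xs) = drop (nat (k - 1)) xs" if "k > 0"
    using that by (cases "nat k") (auto simp: nat_diff_distrib')
  moreover have "drop (nat (k - 8)) (drop 8 (x # xs)) = drop (nat k) (x # xs)" if "k \<ge> 8"
    using that by (simp only: drop_drop) (simp add: nat_diff_distrib)
  ultimately show ?case using 2 by (auto simp: drop8_eq)
qed simp

text \<open>Entries are taken at the positions j^2 - 1 only: after the head at j^2 - 1, exactly 2 j
  entries precede the one at (j + 1)^2 - 1, so \<open>k\<close> is 2 j and grows by 2. The nested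
  subtraction produces the alternating signs.\<close>

function alt_sum :: "int \<Rightarrow> int list \<Rightarrow> int" where
  "alt_sum k [] = 0"
| "alt_sum k (x # xs) = x - alt_sum (k + 2) (skip k xs)"
  by pat_completeness auto
termination by (relation "Wellfounded.measure (\<lambda>(k, xs). length xs)") (auto simp: skip_eq)

text \<open>The recurrence solved for the newest value. The list is in decreasing order of the
  argument, so the value j^2 places below the new one sits at position j^2 - 1.\<close>

definition op_next :: "int list \<Rightarrow> int list" where
  "op_next xs = 2 * alt_sum 2 xs # xs"

primrec op_list :: "nat \<Rightarrow> int list" where
  "op_list 0 = [1]"
| "op_list (Suc n) = op_next (op_list n)"

lemma alt_sum_eq:
  assumes "j \<ge> 1"
  shows "alt_sum (2 * int j) (drop (j ^ 2 - 1) zs) =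
    (\<Sum>i | j \<le> i \<and> i ^ 2 \<le> length zs. (-1) ^ (i + j) * zs ! (i ^ 2 - 1))"
  using assms
proof (induction "Suc (length zs) - j" arbitrary: j rule: less_induct)
  case (less j)
  have j2: "j \<le> j ^ 2" "1 \<le> j ^ 2" using less.prems by (simp_all add: power2_eq_square Suc_le_eq)
  have fin: "finite {i. k \<le> i \<and> i ^ 2 \<le> length zs}" for k
  proof (rule finite_subset)
    show "{i. k \<le> i \<and> i ^ 2 \<le> length zs} \<subseteq> {..length zs}"
      by (auto intro: order_trans[rotated] simp: power2_nat_le_imp_le)
  qed simp
  show ?case
  proof (cases "j ^ 2 \<le> length zs")
    case False
    have "\<not> i ^ 2 \<le> length zs" if "j \<le> i" for i
      using power_mono[OF that, of 2] False by linarith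
    then have "{i. j \<le> i \<and> i ^ 2 \<le> length zs} = {}" by blast
    moreover have "drop (j ^ 2 - 1) zs = []" using False by simp
    ultimately show ?thesis by (simp only: alt_sum.simps sum.empty)
  next
    case True
    have Suc: "Suc (j ^ 2 - 1) = j ^ 2" using j2 by simp
    have "drop (j ^ 2 - 1) zs = zs ! (j ^ 2 - 1) # drop (j ^ 2) zs"
      using Cons_nth_drop_Suc[of "j ^ 2 - 1" zs] True j2 unfolding Suc by simp
    moreover have "skip (2 * int j) (drop (j ^ 2) zs) = drop (Suc j ^ 2 - 1) zs"
    proof -
      have "nat (2 * int j) + j ^ 2 = Suc j ^ 2 - 1" by (simp add: power2_eq_square nat_mult_distrib)
      then show ?thesis by (simp only: skip_eq drop_drop)
    qed
    moreover have "2 * int j + 2 = 2 * int (Suc j)" by simp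
    ultimately have "alt_sum (2 * int j) (drop (j ^ 2 - 1) zs) =
        zs ! (j ^ 2 - 1) - alt_sum (2 * int (Suc j)) (drop (Suc j ^ 2 - 1) zs)"
      by (simp only: alt_sum.simps)
    also have "alt_sum (2 * int (Suc j)) (drop (Suc j ^ 2 - 1) zs) =
        (\<Sum>i | Suc j \<le> i \<and> i ^ 2 \<le> length zs. (-1) ^ (i + Suc j) * zs ! (i ^ 2 - 1))"
      using True j2 by (intro less.hyps) auto
    also have "\<dots> = - (\<Sum>i | Suc j \<le> i \<and> i ^ 2 \<le> length zs. (-1) ^ (i + j) * zs ! (i ^ 2 - 1))"
      by (simp add: sum_negf)
    also have "zs ! (j ^ 2 - 1) - - (\<Sum>i | Suc j \<le> i \<and> i ^ 2 \<le> length zs. (-1) ^ (i + j) * zs ! (i ^ 2 - 1)) =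
       (\<Sum>i\<in>insert j {i. Suc j \<le> i \<and> i ^ 2 \<le> length zs}. (-1) ^ (i + j) * zs ! (i ^ 2 - 1))"
      using fin[of "Suc j"] by (simp add: mult_2[symmetric])
    also have "insert j {i. Suc j \<le> i \<and> i ^ 2 \<le> length zs} = {i. j \<le> i \<and> i ^ 2 \<le> length zs}"
      using True by (auto simp: Suc_le_eq)
    finally show ?thesis .
  qed
qed

definition op_values :: "nat \<Rightarrow> int list" where
  "op_values n = map (\<lambda>i. int (overpartition_count (n - i))) [0..<Suc n]"

lemma op_next_values: "op_next (op_values n) = op_values (Suc n)"
proof -
  have len: "length (op_values n) = Suc n" by (simp add: op_values_def)
  have "2 * int 1 = 2" by simp
  from alt_sum_eq[of 1 "op_values n"]
  have "alt_sum 2 (op_values n) = (\<Sum>i | 1 \<le> i \<and> i ^ 2 \<le> Suc n. (-1) ^ (i + 1) * op_values n ! (i ^ 2 - 1))"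
    by (simp add: len)
  also have "\<dots> = (\<Sum>i | 0 < i \<and> i ^ 2 \<le> Suc n. - ((-1) ^ i * int (overpartition_count (Suc n - i ^ 2))))"
  proof (rule sum.cong)
    fix i assume "i \<in> {i. 0 < i \<and> i ^ 2 \<le> Suc n}"
    then have "i ^ 2 - 1 < Suc n" "n - (i ^ 2 - 1) = Suc n - i ^ 2" by auto
    then have "op_values n ! (i ^ 2 - 1) = int (overpartition_count (Suc n - i ^ 2))"
      unfolding op_values_def by (simp del: upt_Suc)
    then show "(-1) ^ (i + 1) * op_values n ! (i ^ 2 - 1) = - ((-1) ^ i * int (overpartition_count (Suc n - i ^ 2)))"
      by simp
  qed auto
  finally have "real_of_int (2 * alt_sum 2 (op_values n)) =
      - (2 * (\<Sum>i | 0 < i \<and> i ^ 2 \<le> Suc n. (-1) ^ i * real (overpartition_count (Suc n - i ^ 2))))"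
    by (simp add: sum_negf)
  also have "\<dots> = real (overpartition_count (Suc n))"
    using overpartition_recurrence[of "Suc n"] by simp
  finally have "2 * alt_sum 2 (op_values n) = int (overpartition_count (Suc n))" by linarith
  then show ?thesis
    unfolding op_next_def op_values_def by (simp add: upt_conv_Cons map_Suc_upt[symmetric] del: upt_Suc)
qed

lemma overpartition_count_0: "overpartition_count 0 = 1"
  using opc_eq[of 0 0] by (simp add: opc_0)

lemma op_list_eq: "op_list n = op_values n"
  by (induction n) (simp_all add: op_next_values, simp add: op_values_def overpartition_count_0)

text \<open>Directed fixed-point arithmetic with 60 fractional bits. The large literals are
  \<open>2^57\<close>, \<open>2^60\<close>, \<open>2^61\<close>, \<open>3 * 2^60\<close>, \<open>2^110\<close>, \<open>\<lfloor>2^60 * pi^2\<rfloor>\<close> and bounds of \<open>2^100 * pi^2\<close>;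
  powers written as \<open>2 ^ k\<close> would be recomputed at every use. With \<open>y = pi * sqrt n\<close>, \<open>exp y\<close> is
  obtained from \<open>exp (y / 1024)\<close> by ten squarings; the last two shifts lower the number of fractional
  bits to 40 and 20, since the values have become large.\<close>

primrec exp_lo :: "int \<Rightarrow> int \<Rightarrow> int list \<Rightarrow> int" where
  "exp_lo x a [] = a"
| "exp_lo x a (j # js) = exp_lo x (1152921504606846976 + drop_bit 60 (x * a) div j) js"

primrec exp_up :: "int \<Rightarrow> int \<Rightarrow> int list \<Rightarrow> int" where
  "exp_up x a [] = a"
| "exp_up x a (j # js) = exp_up x (1152921504606846977 + (drop_bit 60 (x * a) + 1) div j) js"

primrec sq_lo :: "int \<Rightarrow> nat list \<Rightarrow> int" where
  "sq_lo a [] = a"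
| "sq_lo a (s # ss) = sq_lo (drop_bit s (a * a)) ss"

primrec sq_up :: "int \<Rightarrow> nat list \<Rightarrow> int" where
  "sq_up a [] = a"
| "sq_up a (s # ss) = sq_up (drop_bit s (a * a) + 1) ss"

section \<open>Correctness of the rounded exponential\<close>

lemma drop_bit_bounds:
  fixes a :: int
  shows "real_of_int (drop_bit k a) \<le> real_of_int a / 2 ^ k" "real_of_int a / 2 ^ k \<le> real_of_int (drop_bit k a) + 1"
proof -
  have "drop_bit k a = \<lfloor>real_of_int a / real_of_int (2 ^ k)\<rfloor>"
    by (simp only: drop_bit_eq_div floor_divide_of_int_eq)
  then have "drop_bit k a = \<lfloor>real_of_int a / 2 ^ k\<rfloor>" by simp
  then show "real_of_int (drop_bit k a) \<le> real_of_int a / 2 ^ k" "real_of_int a / 2 ^ k \<le> real_of_int (drop_bit k a) + 1"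
    by linarith+
qed

text \<open>The normalised Taylor remainder 1 + x / (k + 1) + x^2 / ((k + 1) (k + 2)) + ..., which
  is the exact value that Horner's scheme approximates when the divisors k, ..., 1 are still to
  come.\<close>

definition exp_tail :: "real \<Rightarrow> nat \<Rightarrow> real" where
  "exp_tail x k = (exp x - (\<Sum>i<k. x ^ i / fact i)) * fact k / x ^ k"

lemma exp_tail_0: "exp_tail x 0 = exp x"
  by (simp add: exp_tail_def)

lemma exp_tail_Suc:
  assumes "x \<noteq> 0"
  shows "exp_tail x k = 1 + x / real (Suc k) * exp_tail x (Suc k)"
  unfolding exp_tail_def using assms by (simp add: field_simps del: of_nat_Suc)

text \<open>By Lagrange's form of the remainder it equals exp t for some |t| <= x. The two bounds
  justify the starting values of \<open>exp_lo\<close> and \<open>exp_up\<close>.\<close>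

lemma exp_tail_bounds:
  assumes "x > 0"
  shows "1 \<le> exp_tail x k" "exp_tail x k \<le> exp x"
proof -
  have tay: "0 \<le> exp_tail x k \<and> exp_tail x k \<le> exp x" for k
  proof -
    obtain t where t: "\<bar>t\<bar> \<le> \<bar>x\<bar>" "exp x = (\<Sum>m<k. x ^ m / fact m) + exp t / fact k * x ^ k"
      using Maclaurin_exp_le by blast
    have "exp_tail x k = exp t" unfolding exp_tail_def t(2) using assms by simp
    then show ?thesis using t(1) assms by simp
  qed
  then show "exp_tail x k \<le> exp x" by blast
  have "0 \<le> x / real (Suc k) * exp_tail x (Suc k)"
    using tay[of "Suc k"] assms by (intro mult_nonneg_nonneg) auto
  then show "1 \<le> exp_tail x k" using exp_tail_Suc[of x k] assms by linarith
qed

text \<open>The hypothesis on \<open>a\<close> is the invariant of Horner's scheme; both roundings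
  go down. Nonnegativity is carried along for the squarings that follow.\<close>

lemma exp_lo_le:
  assumes "X > 0" "0 \<le> a" "real_of_int a \<le> 2 ^ 60 * exp_tail (real_of_int X / 2 ^ 60) k"
  shows "0 \<le> exp_lo X a (map int (rev [1..<Suc k])) \<and>
    real_of_int (exp_lo X a (map int (rev [1..<Suc k]))) \<le> 2 ^ 60 * exp (real_of_int X / 2 ^ 60)"
  using assms(2,3)
proof (induction k arbitrary: a)
  case 0
  then show ?case by (simp add: exp_tail_0)
next
  case (Suc k)
  define x where "x = real_of_int X / 2 ^ 60"
  define b where "b = 1152921504606846976 + drop_bit 60 (X * a) div int (Suc k)"
  have x: "x > 0" using assms(1) by (simp add: x_def)
  have "0 \<le> drop_bit 60 (X * a)" using Suc.prems(1) assms(1) by simp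
  then have b0: "0 \<le> b" unfolding b_def by (simp add: pos_imp_zdiv_nonneg_iff add_nonneg_nonneg)
  have "real_of_int (drop_bit 60 (X * a) div int (Suc k)) \<le> real_of_int (drop_bit 60 (X * a)) / real (Suc k)"
    using real_of_int_div4[of "drop_bit 60 (X * a)" "int (Suc k)"] by simp
  also have "\<dots> \<le> real_of_int (X * a) / 2 ^ 60 / real (Suc k)"
    by (intro divide_right_mono drop_bit_bounds) simp
  also have "real_of_int (X * a) / 2 ^ 60 = x * real_of_int a" by (simp add: x_def)
  also have "x * real_of_int a / real (Suc k) \<le> x * (2 ^ 60 * exp_tail x (Suc k)) / real (Suc k)"
    using Suc.prems(2) x by (intro divide_right_mono mult_left_mono) (auto simp: x_def)
  finally have "real_of_int b \<le> 2 ^ 60 + x * (2 ^ 60 * exp_tail x (Suc k)) / real (Suc k)"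
    unfolding b_def by simp
  also have "\<dots> = 2 ^ 60 * exp_tail x k"
    using exp_tail_Suc[of x k] x by (simp add: algebra_simps)
  finally have "real_of_int b \<le> 2 ^ 60 * exp_tail x k" .
  from Suc.IH[OF b0 this[unfolded x_def]] show ?case
    by (simp add: b_def)
qed

lemma exp_up_ge:
  assumes "X > 0" "2 ^ 60 * exp_tail (real_of_int X / 2 ^ 60) k \<le> real_of_int a"
  shows "2 ^ 60 * exp (real_of_int X / 2 ^ 60) \<le> real_of_int (exp_up X a (map int (rev [1..<Suc k])))"
  using assms(2)
proof (induction k arbitrary: a)
  case 0
  then show ?case by (simp add: exp_tail_0)
next
  case (Suc k)
  define x where "x = real_of_int X / 2 ^ 60"
  \<comment> \<open>The literal is 2^60 + 1: its extra unit covers the rounding of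
    \<open>div\<close>, the inner one that of \<open>drop_bit\<close>.\<close>
  define b where "b = 1152921504606846977 + (drop_bit 60 (X * a) + 1) div int (Suc k)"
  have x: "x > 0" using assms(1) by (simp add: x_def)
  have "x * (2 ^ 60 * exp_tail x (Suc k)) / real (Suc k) \<le> x * real_of_int a / real (Suc k)"
    using Suc.prems x by (intro divide_right_mono mult_left_mono) (auto simp: x_def)
  also have "x * real_of_int a = real_of_int (X * a) / 2 ^ 60" by (simp add: x_def)
  also have "real_of_int (X * a) / 2 ^ 60 / real (Suc k) \<le> (real_of_int (drop_bit 60 (X * a)) + 1) / real (Suc k)"
    by (intro divide_right_mono drop_bit_bounds) simp
  also have "\<dots> \<le> real_of_int ((drop_bit 60 (X * a) + 1) div int (Suc k)) + 1"
    using real_of_int_div2[of "drop_bit 60 (X * a) + 1" "int (Suc k)"]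
      real_of_int_div3[of "drop_bit 60 (X * a) + 1" "int (Suc k)"] by simp
  finally have "2 ^ 60 + x * (2 ^ 60 * exp_tail x (Suc k)) / real (Suc k) \<le> real_of_int b"
    unfolding b_def by simp
  also have "2 ^ 60 + x * (2 ^ 60 * exp_tail x (Suc k)) / real (Suc k) = 2 ^ 60 * exp_tail x k"
    using exp_tail_Suc[of x k] x by (simp add: algebra_simps)
  finally have "2 ^ 60 * exp_tail x k \<le> real_of_int b" .
  from Suc.IH[OF this[unfolded x_def]] show ?case
    by (simp add: b_def)
qed

lemma sq_lo_le:
  assumes "0 \<le> a" "real_of_int a \<le> A"
  shows "0 \<le> sq_lo a ss \<and> real_of_int (sq_lo a ss) \<le> foldl (\<lambda>A k. A ^ 2 / 2 ^ k) A ss"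
  using assms
proof (induction ss arbitrary: a A)
  case (Cons k ss)
  have "real_of_int (drop_bit k (a * a)) \<le> real_of_int (a * a) / 2 ^ k" by (rule drop_bit_bounds)
  also have "\<dots> \<le> A ^ 2 / 2 ^ k"
    using Cons.prems by (simp add: power2_eq_square divide_right_mono mult_mono)
  finally have "real_of_int (drop_bit k (a * a)) \<le> A ^ 2 / 2 ^ k" .
  moreover have "0 \<le> drop_bit k (a * a)" by simp
  ultimately show ?case using Cons.IH by simp
qed simp

lemma sq_up_ge:
  assumes "0 \<le> A" "A \<le> real_of_int a"
  shows "foldl (\<lambda>A k. A ^ 2 / 2 ^ k) A ss \<le> real_of_int (sq_up a ss)"
  using assms
proof (induction ss arbitrary: a A)
  case (Cons k ss)
  have "A ^ 2 / 2 ^ k \<le> real_of_int (a * a) / 2 ^ k"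
    using Cons.prems by (simp add: power2_eq_square divide_right_mono mult_mono)
  also have "\<dots> \<le> real_of_int (drop_bit k (a * a) + 1)" using drop_bit_bounds(2)[of "a * a" k] by simp
  finally have "A ^ 2 / 2 ^ k \<le> real_of_int (drop_bit k (a * a) + 1)" .
  then show ?case using Cons.IH by simp
qed simp

text \<open>A Newton step for \<open>v = 2^70 / y\<close>. It needs no correctness proof, because \<open>check_arg\<close> and
  \<open>check_exp\<close> verify the enclosures of \<open>2^50 * y\<close> and \<open>2^60 / y\<close> derived from \<open>v\<close>.\<close>

definition rsqrt_step :: "int \<Rightarrow> int \<Rightarrow> int" where
  "rsqrt_step c v = drop_bit 61 (v * (3458764513820540928 - drop_bit 70 (c * drop_bit 70 (v * v))))"

text \<open>Applied to an approximation of 2^60 / y^2, it gives one of 2^60 / y^6, rounded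
  down.\<close>

definition cube :: "int \<Rightarrow> int" where
  "cube a = drop_bit 60 (drop_bit 60 (a * a) * a)"

text \<open>\<open>P\<close> stands for 2^80 * 40 n p, \<open>l\<close> and \<open>u\<close> enclose
  2^20 exp y, \<open>i\<close> and \<open>j\<close> enclose 2^60 / y from above and below, and
  \<open>w\<close> is a lower bound of 2^60 / y^6, the safe direction in both inequalities. The
  common factor 5 makes the tolerance \<open>b\<close> an integer.\<close>

definition enclosed :: "int \<Rightarrow> int \<Rightarrow> int \<Rightarrow> int \<Rightarrow> int \<Rightarrow> int \<Rightarrow> int \<Rightarrow> bool" where
  "enclosed b P l u i j w \<longleftrightarrow> P < l * (5 * (1152921504606846976 - i) + b * w) \<and>
     u * (5 * (1152921504606846976 - j - w)) < P"

text \<open>The same integers \<open>xl\<close> and \<open>xu\<close> are read as bounds of 2^50 y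
  and of 2^60 (y / 1024). The two products compared with 2^110 certify \<open>i\<close> and
  \<open>j\<close>.\<close>

definition check_exp :: "int \<Rightarrow> int \<Rightarrow> int \<Rightarrow> int \<Rightarrow> int \<Rightarrow> int \<Rightarrow> bool" where
  "check_exp b P xl xu i j \<longleftrightarrow>
     1298074214633706907132624082305024 \<le> i * xl \<and> j * xu \<le> 1298074214633706907132624082305024 \<and>
     enclosed b P
       (sq_lo (exp_lo xl 1152921504606846976 [9,8,7,6,5,4,3,2,1]) [60,60,60,60,60,60,60,60,80,60])
       (sq_up (exp_up xu 2305843009213693952 [9,8,7,6,5,4,3,2,1]) [60,60,60,60,60,60,60,60,80,60])
       i j (cube (drop_bit 60 (j * j)))"

text \<open>Comparing squares certifies the enclosure of 2^50 y. The shift by 83 supplies the factor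
  8 and the scale 2^80 = 2^20 * 2^60 of the products in \<open>enclosed\<close>.\<close>

definition check_arg :: "int \<Rightarrow> int \<Rightarrow> int \<Rightarrow> int \<Rightarrow> int \<Rightarrow> int \<Rightarrow> bool" where
  "check_arg n b p xl xu j \<longleftrightarrow> 0 < xl \<and> xu < 144115188075855872 \<and> 32 < j \<and>
     xl * xl \<le> 12511209943056100000000000000000 * n \<and> 12511209943056101000000000000000 * n \<le> xu * xu \<and>
     check_exp b (push_bit 83 (5 * n * p)) xl xu (j + 32) (j - 32)"

text \<open>The margins 16 and, in \<open>check_arg\<close>, 32 absorb the error of the Newton
  iterate. Intermediate results are passed as parameters so that each is evaluated once.\<close>

definition check_with :: "int \<Rightarrow> int \<Rightarrow> int \<Rightarrow> int \<Rightarrow> int \<Rightarrow> bool" where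
  "check_with n b p x v \<longleftrightarrow> check_arg n b p (x - 16) (x + 16) (drop_bit 10 v)"

text \<open>As pi^2 n = y^2, multiplying v = 2^70 / y by 2^60 pi^2 n gives 2^130 y, and the shift
  leaves 2^50 y.\<close>

definition check_value :: "int \<Rightarrow> int \<Rightarrow> int \<Rightarrow> int \<Rightarrow> bool" where
  "check_value n b p v \<longleftrightarrow> check_with n b p (drop_bit 80 (11378879155978302162 * n * v)) v"

text \<open>The constant in the upper bound, in units of \<open>y\<^sup>-\<^sup>6 / 5\<close>: the bound with constant 1 fails at
  \<open>n = 93\<close>, and the stronger bound at \<open>n = 95\<close> makes up for it.\<close>

definition tolerance :: "int \<Rightarrow> int" where
  "tolerance n = (if n = 93 then 6 else if n = 95 then 0 else 5)"

text \<open>From n to n + 1 the value 1 / sqrt n changes by less than 0.6 percent, and a Newton step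
  squares the relative error up to a factor of about 3/2; three steps bring it to about
  10^-17.\<close>

primrec check_range :: "nat \<Rightarrow> int \<Rightarrow> int \<Rightarrow> int list \<Rightarrow> bool" where
  "check_range 0 n v xs = True"
| "check_range (Suc k) n v xs = (check_value n (tolerance n) (hd xs) v \<and>
     check_range k (n + 1) (rsqrt_step (11378879155978302162 * (n + 1)) (rsqrt_step (11378879155978302162 * (n + 1))
       (rsqrt_step (11378879155978302162 * (n + 1)) v))) (op_next xs))"

section \<open>Correctness of the checks\<close>

lemma pi_square_bounds:
  "12511209943056100000000000000000 \<le> pi ^ 2 * 2 ^ 100" "pi ^ 2 * 2 ^ 100 \<le> 12511209943056101000000000000000"
proof -
  have p: "3.1415926535897932384 \<le> pi" "pi \<le> 3.1415926535897932385"
    unfolding pi_machin using arctan_bounds[of "1/5" 8] arctan_bounds[of "1/239" 4]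
    by (simp_all add: eval_nat_numeral)
  from power_mono[OF p(1), of 2] show "12511209943056100000000000000000 \<le> pi ^ 2 * 2 ^ 100"
    by (simp add: power2_eq_square)
  from power_mono[OF p(2), of 2] show "pi ^ 2 * 2 ^ 100 \<le> 12511209943056101000000000000000"
    by (simp add: power2_eq_square)
qed

lemma exp_pow_1024: "exp (y / 1024) ^ 1024 = exp (y :: real)"
  using exp_of_nat_mult[of 1024 "y / 1024"] by simp

lemma foldl_squares:
  "foldl (\<lambda>A k. A ^ 2 / 2 ^ k) (2 ^ 60 * E) [60,60,60,60,60,60,60,60,80,60] = 2 ^ 20 * (E :: real) ^ 1024"
  by (simp add: power_mult_distrib power_divide flip: power_mult)

text \<open>Each integer comparison certifies one real enclosure, for whatever \<open>v\<close> is
  supplied. The condition \<open>y >= 2\<close> makes 1 - 1/y - 1/y^6 nonnegative, as multiplication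
  by the upper bound of exp y requires.\<close>

lemma check_value_sound:
  fixes n p b v :: int
  assumes "check_value n b p v" "n > 0" "p \<ge> 0" "b \<ge> 0"
  defines "y \<equiv> pi * sqrt (real_of_int n)"
  assumes "y \<ge> 2"
  shows "5 * 8 * real_of_int n * real_of_int p < exp y * (5 * (1 - 1 / y) + real_of_int b / y ^ 6)"
    and "exp y * (1 - 1 / y - 1 / y ^ 6) < 8 * real_of_int n * real_of_int p"
proof -
  define x where "x = drop_bit 80 (11378879155978302162 * n * v)"
  define xl where "xl = x - 16"
  define xu where "xu = x + 16"
  define i where "i = drop_bit 10 v + 32"
  define j where "j = drop_bit 10 v - 32"
  define P where "P = push_bit 83 (5 * n * p)"
  define w where "w = cube (drop_bit 60 (j * j))"
  let ?L = "exp_lo xl 1152921504606846976 [9,8,7,6,5,4,3,2,1]"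
  let ?U = "exp_up xu 2305843009213693952 [9,8,7,6,5,4,3,2,1]"
  let ?ss = "[60,60,60,60,60,60,60,60,80,60] :: nat list"
  define l where "l = sq_lo ?L ?ss"
  define u where "u = sq_up ?U ?ss"
  have c: "0 < xl" "xu < 144115188075855872" "0 < j"
     "xl * xl \<le> 12511209943056100000000000000000 * n" "12511209943056101000000000000000 * n \<le> xu * xu"
     "1298074214633706907132624082305024 \<le> i * xl" "j * xu \<le> 1298074214633706907132624082305024"
     "P < l * (5 * (1152921504606846976 - i) + b * w)" "u * (5 * (1152921504606846976 - j - w)) < P"
    using assms(1)
    unfolding check_value_def check_with_def check_arg_def check_exp_def enclosed_def
      x_def[symmetric] xl_def[symmetric] xu_def[symmetric] i_def[symmetric] j_def[symmetric]
      P_def[symmetric] w_def[symmetric] l_def[symmetric] u_def[symmetric]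
    by (auto simp: j_def)
  have y0: "y > 0" using assms by simp
  have y2: "y ^ 2 = pi ^ 2 * real_of_int n" using assms by (simp add: y_def power_mult_distrib)
  have xl_le: "real_of_int xl \<le> y * 2 ^ 50"
  proof (rule power2_le_imp_le)
    have "real_of_int xl ^ 2 = real_of_int (xl * xl)" by (simp add: power2_eq_square)
    also have "\<dots> \<le> real_of_int (12511209943056100000000000000000 * n)" using c(4) by (simp only: of_int_le_iff)
    also have "\<dots> \<le> pi ^ 2 * 2 ^ 100 * real_of_int n"
      using mult_right_mono[OF pi_square_bounds(1), of "real_of_int n"] assms(2) by simp
    also have "\<dots> = (y * 2 ^ 50) ^ 2" unfolding power_mult_distrib y2 by simp
    finally show "real_of_int xl ^ 2 \<le> (y * 2 ^ 50) ^ 2" .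
  qed (use y0 in simp)
  have xl_xu: "0 < xu" using c(1) by (simp add: xl_def xu_def)
  have xu_ge: "y * 2 ^ 50 \<le> real_of_int xu"
  proof (rule power2_le_imp_le)
    have "(y * 2 ^ 50) ^ 2 = pi ^ 2 * 2 ^ 100 * real_of_int n" unfolding power_mult_distrib y2 by simp
    also have "\<dots> \<le> real_of_int (12511209943056101000000000000000 * n)"
      using mult_right_mono[OF pi_square_bounds(2), of "real_of_int n"] assms(2) by simp
    also have "\<dots> \<le> real_of_int (xu * xu)" using c(5) by (simp only: of_int_le_iff)
    also have "\<dots> = real_of_int xu ^ 2" by (simp add: power2_eq_square)
    finally show "(y * 2 ^ 50) ^ 2 \<le> real_of_int xu ^ 2" .
  qed (use xl_xu in simp)
  have list: "[9,8,7,6,5,4,3,2,1] = map int (rev [1..<Suc 9])"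
    by (simp add: upt_rec)
  have l: "0 \<le> l" "real_of_int l \<le> 2 ^ 20 * exp y"
  proof -
    let ?z = "real_of_int xl / 2 ^ 60"
    have z: "?z > 0" using c(1) by simp
    have e: "0 \<le> ?L"
      "real_of_int ?L \<le> 2 ^ 60 * exp ?z"
      using exp_lo_le[of xl 1152921504606846976 9] c(1) exp_tail_bounds(1)[OF z, of 9]
      unfolding list by simp_all
    have "exp ?z \<le> exp (y / 1024)" using xl_le by (simp add: field_simps)
    then have "real_of_int ?L \<le> 2 ^ 60 * exp (y / 1024)"
      by (intro order_trans[OF e(2)] mult_left_mono) auto
    from sq_lo_le[OF e(1) this, of ?ss]
    have "0 \<le> l \<and> real_of_int l \<le> 2 ^ 20 * exp y"
      by (simp only: l_def foldl_squares exp_pow_1024)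
    then show "0 \<le> l" "real_of_int l \<le> 2 ^ 20 * exp y" by blast+
  qed
  have u: "2 ^ 20 * exp y \<le> real_of_int u"
  proof -
    let ?z = "real_of_int xu / 2 ^ 60"
    have z: "?z > 0" using xl_xu by simp
    have "?z \<le> 1 / 2" using c(2) by simp
    then have "exp ?z \<le> 2" using exp_half_le2 by (meson exp_le_cancel_iff order_trans)
    \<comment> \<open>The starting value of \<open>exp_up\<close> is 2^61 = 2^60 * 2, valid because
      the remainder is at most exp ?z <= 2.\<close>
    then have "2 ^ 60 * exp_tail ?z 9 \<le> real_of_int 2305843009213693952"
      using exp_tail_bounds(2)[OF z, of 9] by simp
    then have "2 ^ 60 * exp ?z \<le> real_of_int ?U"
      unfolding list by (rule exp_up_ge[OF xl_xu])
    moreover have "exp (y / 1024) \<le> exp ?z" using xu_ge by (simp add: field_simps)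
    then have "2 ^ 60 * exp (y / 1024) \<le> 2 ^ 60 * exp ?z" by (intro mult_left_mono) auto
    ultimately have e: "2 ^ 60 * exp (y / 1024) \<le> real_of_int ?U"
      by (rule order_trans[rotated])
    have "0 \<le> 2 ^ 60 * exp (y / 1024)" by simp
    from sq_up_ge[OF this e, of ?ss]
    show ?thesis by (simp only: u_def foldl_squares exp_pow_1024)
  qed
  have i: "2 ^ 60 / y \<le> real_of_int i"
  proof -
    have "0 < i" using c(3) by (simp add: i_def j_def)
    then have "real_of_int i * real_of_int xl \<le> real_of_int i * (y * 2 ^ 50)"
      using xl_le by (intro mult_left_mono) auto
    moreover have "2 ^ 110 \<le> real_of_int (i * xl)" using c(6) by (simp only: of_int_le_iff[symmetric, where 'a = real]) simp
    ultimately have "2 ^ 110 \<le> real_of_int i * (y * 2 ^ 50)"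
      unfolding of_int_mult by (rule order_trans[rotated])
    then show ?thesis using y0 by (simp add: field_simps)
  qed
  have j: "real_of_int j \<le> 2 ^ 60 / y"
  proof -
    have "real_of_int j * (y * 2 ^ 50) \<le> real_of_int j * real_of_int xu"
      using xu_ge c(3) by (intro mult_left_mono) auto
    moreover have "real_of_int (j * xu) \<le> 2 ^ 110" using c(7) by (simp only: of_int_le_iff[symmetric, where 'a = real]) simp
    ultimately have "real_of_int j * (y * 2 ^ 50) \<le> 2 ^ 110"
      unfolding of_int_mult by (rule order_trans)
    then show ?thesis using y0 by (simp add: field_simps)
  qed
  have mul: "0 \<le> drop_bit 60 (a * b) \<and> real_of_int (drop_bit 60 (a * b)) \<le> 2 ^ 60 / (s * t)"
    if "0 \<le> a" "0 \<le> b" "real_of_int a \<le> 2 ^ 60 / s" "real_of_int b \<le> 2 ^ 60 / t" for a b s t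
  proof -
    have "real_of_int (drop_bit 60 (a * b)) \<le> real_of_int (a * b) / 2 ^ 60" by (rule drop_bit_bounds)
    also have "\<dots> \<le> (2 ^ 60 / s) * (2 ^ 60 / t) / 2 ^ 60"
    proof (rule divide_right_mono)
      have "0 \<le> 2 ^ 60 / s" using that(1) by (intro order_trans[OF _ that(3)]) simp
      then show "real_of_int (a * b) \<le> (2 ^ 60 / s) * (2 ^ 60 / t)"
        unfolding of_int_mult using that(2) by (intro mult_mono that(3,4)) auto
    qed simp
    finally show ?thesis using that by simp
  qed
  have w: "0 \<le> w" "real_of_int w \<le> 2 ^ 60 / y ^ 6"
  proof -
    define j2 where "j2 = drop_bit 60 (j * j)"
    have 2: "0 \<le> j2" "real_of_int j2 \<le> 2 ^ 60 / (y * y)" using mul[OF _ _ j j] c(3) by (simp_all add: j2_def)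
    define j4 where "j4 = drop_bit 60 (j2 * j2)"
    have 4: "0 \<le> j4" "real_of_int j4 \<le> 2 ^ 60 / ((y * y) * (y * y))" using mul[OF 2(1) 2(1) 2(2) 2(2)] by (simp_all add: j4_def)
    have "w = drop_bit 60 (j4 * j2)" by (simp add: w_def cube_def j4_def j2_def)
    then show "0 \<le> w" "real_of_int w \<le> 2 ^ 60 / y ^ 6"
      using mul[OF 4(1) 2(1) 4(2) 2(2)] by (simp_all add: eval_nat_numeral mult.assoc)
  qed
  have P: "real_of_int P = 2 ^ 80 * (5 * 8 * real_of_int n * real_of_int p)"
    by (simp add: P_def push_bit_eq_mult)
  have P0: "0 \<le> P" using assms by (simp add: P_def push_bit_eq_mult)
  show "5 * 8 * real_of_int n * real_of_int p < exp y * (5 * (1 - 1 / y) + real_of_int b / y ^ 6)"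
  proof -
    define K where "K = 5 * (1152921504606846976 - i) + b * w"
    define k where "k = 5 * (1 - 1 / y) + real_of_int b / y ^ 6"
    have "real_of_int b * real_of_int w \<le> real_of_int b * (2 ^ 60 / y ^ 6)"
      using w assms by (intro mult_left_mono) auto
    then have K: "real_of_int K \<le> 2 ^ 60 * k" unfolding K_def k_def using i by (simp add: algebra_simps)
    \<comment> \<open>Positivity of the bracket is read off from the check itself, since 0 <= P < l
      * K.\<close>
    have "0 < l * K" using c(8) P0 by (simp add: K_def)
    then have "0 < K" using l(1) by (simp add: zero_less_mult_iff)
    have "real_of_int P < real_of_int (l * K)" using c(8) by (simp only: K_def of_int_less_iff)
    also have "\<dots> \<le> (2 ^ 20 * exp y) * (2 ^ 60 * k)"
      using l K \<open>0 < K\<close> by (simp only: of_int_mult) (intro mult_mono, auto)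
    also have "\<dots> = 2 ^ 80 * (exp y * k)" by simp
    finally show ?thesis unfolding P k_def by (simp only: mult_less_cancel_left_pos zero_less_power zero_less_numeral)
  qed
  show "exp y * (1 - 1 / y - 1 / y ^ 6) < 8 * real_of_int n * real_of_int p"
  proof -
    define K where "K = 1152921504606846976 - j - w"
    define k where "k = 1 - 1 / y - 1 / y ^ 6"
    have K: "2 ^ 60 * k \<le> real_of_int K" unfolding K_def k_def using j w(2) by (simp add: algebra_simps)
    have k0: "0 \<le> k"
    proof -
      have "y ^ 1 \<le> y ^ 6" using assms by (intro power_increasing) auto
      then have "2 \<le> y ^ 6" using assms by simp
      then have "1 / y \<le> 1 / 2" "1 / y ^ 6 \<le> 1 / 2" using assms by (auto intro!: divide_left_mono)
      then show ?thesis by (simp add: k_def)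
    qed
    have "2 ^ 80 * (5 * (exp y * k)) = (2 ^ 20 * exp y) * (5 * (2 ^ 60 * k))" by simp
    also have "\<dots> \<le> real_of_int u * (5 * real_of_int K)"
    proof (rule mult_mono[OF u])
      show "5 * (2 ^ 60 * k) \<le> 5 * real_of_int K" using K by (rule mult_left_mono) simp
      show "0 \<le> real_of_int u" by (rule order_trans[OF _ u]) simp
    qed (use k0 in simp)
    also have "\<dots> = real_of_int (u * (5 * K))" by simp
    also have "\<dots> < real_of_int P" using c(9) by (simp only: K_def of_int_less_iff)
    finally have "5 * (exp y * k) < 5 * 8 * real_of_int n * real_of_int p"
      unfolding P by (simp only: mult_less_cancel_left_pos zero_less_power zero_less_numeral)
    then show ?thesis by (simp add: k_def)
  qed
qed

text \<open>The seed changes along the range, so only its existence is passed on.\<close>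

lemma check_range_sound:
  assumes "check_range k (int m) v (op_values m)" "m \<le> n" "n < m + k"
  shows "\<exists>v. check_value (int n) (tolerance (int n)) (int (overpartition_count n)) v"
  using assms
proof (induction k arbitrary: m v)
  case (Suc k)
  have hd: "hd (op_values m) = int (overpartition_count m)"
    by (simp add: op_values_def upt_conv_Cons del: upt_Suc)
  show ?case
  proof (cases "n = m")
    case True
    then show ?thesis using Suc.prems(1) hd by auto
  next
    case False
    have "int m + 1 = int (Suc m)" by simp
    with Suc.prems(1) have "\<exists>v. check_range k (int (Suc m)) v (op_values (Suc m))"
      unfolding check_range.simps op_next_values by metis
    with Suc.IH[of "Suc m"] Suc.prems False show ?thesis by auto
  qed
qed simp

text \<open>The literal is close to 2^70 / (pi * sqrt 93) and seeds the Newton iteration; the range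
  is 93 to 199. The next lemma continues likewise from 200 to 299.\<close>

lemma check_range_93: "check_range 107 93 38968020901391773468 (op_list 93)"
  by code_simp

lemma check_range_200: "check_range 100 200 26572647471256178289 (op_list 200)"
  by code_simp

lemma check_all:
  assumes n: "93 \<le> n" "n < 300"
  defines "y \<equiv> pi * sqrt (real n)"
  shows "5 * 8 * real n * real (overpartition_count n) <
      exp y * (5 * (1 - 1 / y) + real_of_int (tolerance (int n)) / y ^ 6)"
    and "exp y * (1 - 1 / y - 1 / y ^ 6) < 8 * real n * real (overpartition_count n)"
proof -
  obtain v where v: "check_value (int n) (tolerance (int n)) (int (overpartition_count n)) v"
  proof (cases "n < 200")
    case True
    then show ?thesis
      using check_range_93 check_range_sound[of 107 93 _ n] n that by (auto simp: op_list_eq)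
  next
    case False
    then show ?thesis
      using check_range_200 check_range_sound[of 100 200 _ n] n that by (auto simp: op_list_eq)
  qed
  have t: "tolerance (int n) \<ge> 0" by (simp add: tolerance_def)
  have "sqrt 1 \<le> sqrt (real n)" using n by (intro real_sqrt_le_mono) simp
  then have "2 * 1 \<le> pi * sqrt (real n)" using pi_ge_two by (intro mult_mono) auto
  then have "2 \<le> pi * sqrt (real_of_int (int n))" by simp
  from check_value_sound[OF v _ _ t this] n
  show "5 * 8 * real n * real (overpartition_count n) <
      exp y * (5 * (1 - 1 / y) + real_of_int (tolerance (int n)) / y ^ 6)"
    and "exp y * (1 - 1 / y - 1 / y ^ 6) < 8 * real n * real (overpartition_count n)"
    by (simp_all add: y_def)
qed


section \<open>The inequalities\<close>

text \<open>Take eighth roots: 0.72 y stays below the tangent-type bound of exp v at v = 3.672,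
  which is the value for y = 54.4, and 0.72^8 exceeds 0.07.\<close>

lemma power8_le_exp:
  fixes y :: real
  assumes "y \<ge> 54.4"
  shows "0.07 * y ^ 8 \<le> exp (54/100 * y)"
proof -
  define v where "v = 54/800 * y"
  \<comment> \<open>exp 3.672 is bounded from below as a 64th power, 3.672 / 64 = 0.057375, where
    the quadratic Taylor bound is accurate enough.\<close>
  have "(39.18::real) \<le> 1.059 ^ 64" by (simp add: eval_nat_numeral)
  also have "\<dots> \<le> exp (0.057375) ^ 64"
  proof (rule power_mono)
    have "1.059 \<le> 1 + 0.057375 + (0.057375::real) ^ 2 / 2" by (simp add: power2_eq_square)
    also have "\<dots> \<le> exp 0.057375" by (rule exp_lower_Taylor_quadratic) simp
    finally show "1.059 \<le> exp (0.057375::real)" .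
  qed simp
  also have "\<dots> = exp (3.672::real)" by (simp add: exp_of_nat_mult[symmetric])
  finally have e: "39.18 \<le> exp (3.672::real)" .
  have "0.72 * y \<le> 39.18 * (1 + (v - 3.672))" using assms by (simp add: v_def)
  also have "\<dots> \<le> exp 3.672 * exp (v - 3.672)"
    using e assms exp_ge_add_one_self[of "v - 3.672"] by (intro mult_mono) (auto simp: v_def)
  also have "\<dots> = exp v" by (simp add: exp_add[symmetric])
  finally have "(0.72 * y) ^ 8 \<le> exp v ^ 8" using assms by (intro power_mono) auto
  also have "exp v ^ 8 = exp (54/100 * y)" by (simp add: exp_of_nat_mult[symmetric] v_def)
  finally have "0.72 ^ 8 * y ^ 8 \<le> exp (54/100 * y)" by (simp only: power_mult_distrib)
  moreover have "0.07 * y ^ 8 \<le> 0.72 ^ 8 * y ^ 8"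
  proof (rule mult_right_mono)
    show "(0.07::real) \<le> 0.72 ^ 8" by (simp add: eval_nat_numeral)
    show "0 \<le> y ^ 8" by (rule zero_le_even_power) simp
  qed
  ultimately show ?thesis by (rule order_trans[rotated])
qed

definition op_normal :: "nat \<Rightarrow> real" where
  "op_normal n = 8 * real n * real (overpartition_count n) / exp (pi * sqrt (real n))"

text \<open>Below 300 this is the computation. From 300 on, the error relative to exp y / (8 n) is
  at most (8/15) n exp (-0.54 y), which \<open>power8_le_exp\<close> pushes below y^-6.\<close>

lemma op_normal_bounds:
  fixes n :: nat
  assumes n: "n \<ge> 93"
  defines "y \<equiv> pi * sqrt (real n)"
  shows "1 - 1 / y - 1 / y ^ 6 < op_normal n"
    and "op_normal n < 1 - 1 / y + real_of_int (tolerance (int n)) / 5 / y ^ 6"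
proof -
  have "1 - 1 / y - 1 / y ^ 6 < op_normal n \<and> op_normal n < 1 - 1 / y + real_of_int (tolerance (int n)) / 5 / y ^ 6"
  proof (cases "n < 300")
    case True
    define T where "T = real_of_int (tolerance (int n))"
    define W where "W = 1 - 1 / y + T / 5 / y ^ 6"
    have eq: "5 * (1 - 1 / y) + T / y ^ 6 = 5 * W" by (simp add: W_def)
    have "8 * real n * real (overpartition_count n) < exp y * W"
      using check_all(1)[OF n True] unfolding T_def[symmetric] y_def[symmetric] eq by linarith
    moreover have "exp y * (1 - 1 / y - 1 / y ^ 6) < 8 * real n * real (overpartition_count n)"
      using check_all(2)[OF n True] unfolding y_def[symmetric] .
    ultimately show ?thesis
      unfolding op_normal_def y_def[symmetric] T_def[symmetric] W_def[symmetric]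
      by (simp only: pos_less_divide_eq pos_divide_less_eq exp_gt_zero mult.commute[of _ "exp y"])
  next
    case False
    have y: "y \<ge> 54.4"
    proof -
      have "sqrt (17.32 ^ 2) \<le> sqrt (real n)" using False by (intro real_sqrt_le_mono) (simp add: power2_eq_square)
      then have "3.141592 * 17.32 \<le> pi * sqrt (real n)" using pi_approx by (intro mult_mono) auto
      then show ?thesis by (simp add: y_def)
    qed
    have n0: "real n > 0" using False by simp
    have yn: "y ^ 2 = pi ^ 2 * real n" by (simp add: y_def power_mult_distrib)
    define \<delta> where "\<delta> = real (overpartition_count n) - exp y / (8 * real n) * (1 - 1 / y)"
    have "\<bar>\<delta>\<bar> \<le> exp (46/100 * y) / 15"
      unfolding \<delta>_def using y by (intro overpartition_count_estimate) (auto simp: y_def)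
    then have "8 * real n / exp y * \<bar>\<delta>\<bar> \<le> 8 * real n / exp y * (exp (46/100 * y) / 15)"
      by (rule mult_left_mono) simp
    moreover have "\<bar>8 * real n / exp y * \<delta>\<bar> = 8 * real n / exp y * \<bar>\<delta>\<bar>" by (simp add: abs_mult)
    ultimately have "\<bar>8 * real n / exp y * \<delta>\<bar> \<le> 8 * real n / exp y * (exp (46/100 * y) / 15)" by simp
    also have "\<dots> = 8 / 15 * real n * exp (- (54/100 * y))"
    proof -
      have "exp (46/100 * y) / exp y = exp (- (54/100 * y))" by (simp add: exp_diff[symmetric])
      then show ?thesis by (simp add: field_simps)
    qed
    also have "\<dots> < 1 / y ^ 6"
    proof -
      \<comment> \<open>n <= y^2 / 9 since pi > 3; then (8/15) n is at most 0.06 y^2, and the gap to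
        0.07 y^2 makes the inequality strict.\<close>
      have "9 * real n \<le> y ^ 2"
        unfolding yn using pi_gt3 power_mono[of 3 pi 2] by (intro mult_right_mono) auto
      then have "8 / 15 * real n \<le> 0.06 * y ^ 2" by simp
      also have "\<dots> < 0.07 * y ^ 2" using y by simp
      finally have "8 / 15 * real n * y ^ 6 < 0.07 * y ^ 2 * y ^ 6"
        using y by (intro mult_strict_right_mono) auto
      also have "\<dots> = 0.07 * y ^ 8" by (simp add: power_add[symmetric])
      also have "\<dots> \<le> exp (54/100 * y)" by (rule power8_le_exp[OF y])
      finally show ?thesis using y by (simp add: exp_minus field_simps)
    qed
    finally have "- (1 / y ^ 6) < 8 * real n / exp y * \<delta>" "8 * real n / exp y * \<delta> < 1 / y ^ 6"
      unfolding abs_less_iff by linarith+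
    moreover have "op_normal n = 1 - 1 / y + 8 * real n / exp y * \<delta>"
      unfolding op_normal_def y_def[symmetric] \<delta>_def using n0 by (simp add: field_simps)
    moreover have "tolerance (int n) = 5" using False by (simp add: tolerance_def)
    then have "real_of_int (tolerance (int n)) / 5 / y ^ 6 = 1 / y ^ 6" by simp
    ultimately show ?thesis by linarith
  qed
  then show "1 - 1 / y - 1 / y ^ 6 < op_normal n"
    and "op_normal n < 1 - 1 / y + real_of_int (tolerance (int n)) / 5 / y ^ 6" by blast+
qed

text \<open>The normalising factors 8 n / exp y leave the exponential and n^2 / ((n - 1) (n + 1)),
  which is y^4 / (x^2 z^2).\<close>

lemma u_ratio_eq:
  assumes n: "n \<ge> 94"
  defines "x \<equiv> pi * sqrt (real n - 1)" and "y \<equiv> pi * sqrt (real n)" and "z \<equiv> pi * sqrt (real n + 1)"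
  shows "u_ratio n = exp (x - 2 * y + z) * y ^ 4 / (x ^ 2 * z ^ 2) * (op_normal (n - 1) * op_normal (n + 1) / op_normal n ^ 2)"
proof -
  have pos: "real n - 1 > 0" "real n > 0" "real n + 1 > 0" using n by auto
  have r: "real (n - 1) = real n - 1" "real (n + 1) = real n + 1" using n by (simp_all add: of_nat_diff)
  have p0: "real (overpartition_count n) > 0"
  proof -
    have "(replicate_mset n 1, {}) \<in> overpartitions n"
      by (auto simp: overpartitions_def split: if_splits)
    then have "overpartitions n \<noteq> {}" by blast
    then show ?thesis unfolding overpartition_count_def using finite_overpartitions by (simp add: card_gt_0_iff)
  qed
  have sq: "x ^ 2 = pi ^ 2 * (real n - 1)" "y ^ 2 = pi ^ 2 * real n" "z ^ 2 = pi ^ 2 * (real n + 1)"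
    using pos by (simp_all add: x_def y_def z_def power_mult_distrib)
  have y4: "y ^ 4 = pi ^ 4 * real n ^ 2"
    using arg_cong[OF sq(2), of "\<lambda>t. t ^ 2"] by (simp add: power_mult_distrib flip: power_mult)
  have ex: "exp (x - 2 * y + z) = exp x * exp z / exp y ^ 2"
    by (simp add: exp_add exp_diff exp_double)
  have alg: "p * q / m ^ 2 = X * Z / Y ^ 2 * (w ^ 4 * k ^ 2) / (w ^ 2 * a * (w ^ 2 * b)) *
      ((8 * a * p / X) * (8 * b * q / Z) / (8 * k * m / Y) ^ 2)"
    if "X > 0" "Y > 0" "Z > 0" "w > 0" "a > 0" "b > 0" "k > 0" "m > 0" for p q m X Y Z w a b k :: real
    using that by (simp add: divide_simps) (simp add: power2_eq_square power4_eq_xxxx algebra_simps)?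
  have opn: "op_normal (n - 1) * op_normal (n + 1) / op_normal n ^ 2 =
     (8 * (real n - 1) * real (overpartition_count (n - 1)) / exp x) * (8 * (real n + 1) * real (overpartition_count (n + 1)) / exp z) /
     (8 * real n * real (overpartition_count n) / exp y) ^ 2"
    unfolding op_normal_def r x_def y_def z_def ..
  show ?thesis unfolding u_ratio_def ex sq y4 opn
    by (rule alg) (use pos p0 in auto)
qed

theorem theorem2p2:
  fixes n :: nat
  assumes "n \<ge> 94"
  shows "f_lower n < u_ratio n \<and> u_ratio n < g_upper n"
proof -
  define x where "x = pi * sqrt (real n - 1)"
  define y where "y = pi * sqrt (real n)"
  define z where "z = pi * sqrt (real n + 1)"
  have r: "real (n - 1) = real n - 1" "real (n + 1) = real n + 1" using assms by (simp_all add: of_nat_diff)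
  have big: "28 \<le> pi * sqrt t" if "t \<ge> 93" for t
  proof -
    have "sqrt (9.5 ^ 2) \<le> sqrt t" using that by (intro real_sqrt_le_mono) (simp add: power2_eq_square)
    then have "3 * 9.5 \<le> pi * sqrt t" using pi_gt3 by (intro mult_mono) auto
    then show ?thesis by simp
  qed
  have xyz: "x \<ge> 28" "y \<ge> 28" "z \<ge> 28"
    unfolding x_def y_def z_def using assms by (auto intro!: big)
  define lo where "lo t = 1 - 1 / t - 1 / t ^ 6" for t :: real
  define up where "up t = 1 - 1 / t + 1 / t ^ 6" for t :: real
  have lo0: "lo t > 0" if "t \<ge> 28" for t
  proof -
    have "t ^ 1 \<le> t ^ 6" using that by (intro power_increasing) auto
    then have "1 / t ^ 6 \<le> 1 / 28" "1 / t \<le> 1 / 28" using that by (auto intro!: divide_left_mono simp: divide_simps)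
    then show ?thesis by (simp add: lo_def)
  qed
  define A where "A = op_normal (n - 1)"
  define B where "B = op_normal n"
  define C where "C = op_normal (n + 1)"
  have A: "lo x < A" "A < 1 - 1 / x + real_of_int (tolerance (int (n - 1))) / 5 / x ^ 6"
    using op_normal_bounds[of "n - 1"] assms unfolding A_def x_def lo_def r by auto
  have B: "lo y < B" "B < 1 - 1 / y + real_of_int (tolerance (int n)) / 5 / y ^ 6"
    using op_normal_bounds[of n] assms unfolding B_def y_def lo_def by auto
  have C: "lo z < C" "C < 1 - 1 / z + real_of_int (tolerance (int (n + 1))) / 5 / z ^ 6"
    using op_normal_bounds[of "n + 1"] assms unfolding C_def z_def lo_def r by auto
  have Bup: "B < up y"
  proof -
    have "real_of_int (tolerance (int n)) / 5 \<le> 1" using assms by (simp add: tolerance_def)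
    then have "real_of_int (tolerance (int n)) / 5 / y ^ 6 \<le> 1 / y ^ 6" using xyz by (intro divide_right_mono) auto
    then show ?thesis using B(2) by (simp add: up_def)
  qed
  have ABC: "0 < A" "0 < B" "0 < C" using A(1) B(1) C(1) lo0 xyz by (auto intro: less_trans)
  \<comment> \<open>At n = 94 the factor A belongs to 93, where only the constant 6/5 is available.
    The bound for C at 95 has no y^-6 term at all, and that slack covers the excess of 1/5.\<close>
  have AC: "A * C < up x * up z"
  proof (cases "n = 94")
    case False
    have "real_of_int (tolerance (int (n - 1))) / 5 \<le> 1" "real_of_int (tolerance (int (n + 1))) / 5 \<le> 1"
      using assms False by (simp_all add: tolerance_def of_nat_diff)
    then have "real_of_int (tolerance (int (n - 1))) / 5 / x ^ 6 \<le> 1 / x ^ 6"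
      "real_of_int (tolerance (int (n + 1))) / 5 / z ^ 6 \<le> 1 / z ^ 6"
      using xyz by (intro divide_right_mono; simp)+
    then have "A < up x" "C < up z" using A(2) C(2) by (simp_all add: up_def)
    then show ?thesis using ABC by (intro mult_strict_mono) auto
  next
    case True
    have "A < 1 - 1 / x + 6 / 5 / x ^ 6" "C < 1 - 1 / z"
      using A(2) C(2) True by (simp_all add: tolerance_def)
    then have "A * C < (1 - 1 / x + 6 / 5 / x ^ 6) * (1 - 1 / z)"
      using ABC by (intro mult_strict_mono) auto
    also have "\<dots> \<le> up x * up z"
    proof -
      \<comment> \<open>As 95^3 <= 2 * 93^3, the slack 1/z^6 is at least half of 1/x^6; with 1 - 1/x
        >= 27/28 this exceeds the required fifth.\<close>
      have "z ^ 6 \<le> 2 * x ^ 6"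
      proof -
        have "x ^ 6 = pi ^ 6 * 93 ^ 3" "z ^ 6 = pi ^ 6 * 95 ^ 3"
        proof -
          have "x ^ 2 = pi ^ 2 * 93" "z ^ 2 = pi ^ 2 * 95" unfolding x_def z_def True by (simp_all add: power_mult_distrib)
          then have "(x ^ 2) ^ 3 = (pi ^ 2 * 93) ^ 3" "(z ^ 2) ^ 3 = (pi ^ 2 * 95) ^ 3" by (simp_all only:)
          then show "x ^ 6 = pi ^ 6 * 93 ^ 3" "z ^ 6 = pi ^ 6 * 95 ^ 3"
            by (simp_all only: power_mult_distrib power_mult[symmetric]) simp_all
        qed
        then show ?thesis by simp
      qed
      then have "1 / (2 * x ^ 6) \<le> 1 / z ^ 6" using xyz by (intro divide_left_mono) auto
      then have i: "1 / 2 * (1 / x ^ 6) \<le> 1 / z ^ 6" by simp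
      have x1: "1 / x \<le> 1 / 28" using xyz by (intro divide_left_mono) auto
      have z1: "0 \<le> 1 / z" using xyz by simp
      have p: "0 \<le> 1 / x ^ 6" using xyz by simp
      have "1 / 5 * (1 / x ^ 6) * (1 - 1 / z) \<le> 1 / 5 * (1 / x ^ 6) * 1" using z1 p by (intro mult_left_mono) auto
      also have "\<dots> \<le> (27/28) * (1 / 2 * (1 / x ^ 6))" using p by linarith
      also have "\<dots> \<le> (1 - 1 / x + 1 / x ^ 6) * (1 / z ^ 6)"
        by (rule mult_mono) (use i x1 p in linarith)+
      finally have F: "1 / 5 * (1 / x ^ 6) * (1 - 1 / z) \<le> (1 - 1 / x + 1 / x ^ 6) * (1 / z ^ 6)" .
      have "(1 - u + 6 / 5 * p) * (1 - v) \<le> (1 - u + p) * (1 - v + q)"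
        if "1 / 5 * p * (1 - v) \<le> (1 - u + p) * q" for u v p q :: real
      proof -
        have "(1 - u + p) * (1 - v + q) - (1 - u + 6 / 5 * p) * (1 - v) =
            (1 - u + p) * q - 1 / 5 * p * (1 - v)"
          by (simp add: field_simps)
        with that show ?thesis by linarith
      qed
      from this[OF F] show ?thesis by (simp add: up_def)
    qed
    finally show ?thesis .
  qed
  have lower: "lo x * lo z / up y ^ 2 < A * C / B ^ 2"
    using A(1) C(1) Bup ABC lo0 xyz by (intro frac_less mult_strict_mono power_strict_mono less_imp_le) (auto intro: less_imp_le)
  have upper: "A * C / B ^ 2 < up x * up z / lo y ^ 2"
  proof (rule frac_less)
    show "lo y ^ 2 \<le> B ^ 2" using B(1) lo0[OF xyz(2)] by (intro power_mono) auto
  qed (use AC ABC lo0[OF xyz(2)] in auto)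
  define E where "E = exp (x - 2 * y + z) * y ^ 4 / (x ^ 2 * z ^ 2)"
  have E0: "E > 0" using xyz by (simp add: E_def)
  have u: "u_ratio n = E * (A * C / B ^ 2)"
    unfolding E_def A_def B_def C_def x_def y_def z_def by (rule u_ratio_eq[OF assms])
  have loeq: "t ^ 6 - t ^ 5 - 1 = t ^ 6 * lo t" "t ^ 6 - t ^ 5 + 1 = t ^ 6 * up t" if "t \<ge> 28" for t
    using that by (simp_all add: lo_def up_def algebra_simps power_diff_conv_inverse eval_nat_numeral)
  have up0: "up t > 0" if "t \<ge> 28" for t
    using lo0[OF that] that by (simp add: up_def lo_def) (smt (verit) divide_pos_pos zero_less_power)
  have norm: "exp (x - 2 * y + z) * ((x ^ 6 * a) * y ^ 16 * (z ^ 6 * c)) / (x ^ 8 * (y ^ 6 * b) ^ 2 * z ^ 8) = E * (a * c / b ^ 2)"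
    if "b > 0" for a b c
  proof -
    have "y ^ 16 = (y ^ 6) ^ 2 * y ^ 4" "x ^ 8 = x ^ 6 * x ^ 2" "z ^ 8 = z ^ 6 * z ^ 2"
      by (simp_all flip: power_mult power_add)
    then show ?thesis unfolding E_def power_mult_distrib using that xyz by (simp only:) (simp add: field_simps)
  qed
  have f: "f_lower n = E * (lo x * lo z / up y ^ 2)"
    unfolding f_lower_def Let_def x_def[symmetric] y_def[symmetric] z_def[symmetric]
      loeq[OF xyz(1)] loeq[OF xyz(2)] loeq[OF xyz(3)] by (rule norm[OF up0[OF xyz(2)]])
  have g: "g_upper n = E * (up x * up z / lo y ^ 2)"
    unfolding g_upper_def Let_def x_def[symmetric] y_def[symmetric] z_def[symmetric]
      loeq[OF xyz(1)] loeq[OF xyz(2)] loeq[OF xyz(3)] by (rule norm[OF lo0[OF xyz(2)]])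
  show ?thesis unfolding f g u using lower upper E0 by (simp add: mult_strict_left_mono del: times_divide_eq_right)
qed

end
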